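(* Let $k\geq 1$ and assume that $\mathbb{E}[m_0^{r_k+\varepsilon}]<\infty$ for some $\varepsilon>0$. Then for every $r>0$, $$\lim_{n\to\infty}\frac{\mathbb{E}_k[Z_n^{-r}]}{A_{k,n}(r)} = C(k,r),$$ where $C(k,r)\in(0,\infty)$ is given by $$C(k,r)=\begin{cases}\dfrac{1}{\Gamma(r)}\displaystyle\int_0^\infty Q_k(e^{-t})\,t^{r-1}\,dt & \text{if } r>r_k,\\[2mm] \dfrac{\gamma_k^{-1}}{\Gamma(r)}\,\mathbb{E}^{(r)}\Big[\displaystyle\int_0^\infty \bar G_{k,1}(\phi_\xi(t))\,t^{r-1}\,dt\Big] & \text{if } r=r_k,\\[2mm] \dfrac{1}{\Gamma(r)}\displaystyle\int_0^\infty \phi_k^{(r)}(t)\,t^{r-1}\,dt & \text{if } r<r_k,\end{cases}$$ and $\Gamma(r)=\int_0^\infty x^{r-1}e^{-x}dx$.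
   Context: Branching process in a random environment (BPRE). The environment $\xi=(\xi_0,\xi_1,\dots)$ is an i.i.d. sequence of random variables with values in a measurable space $\Xi$; each $\xi_n$ determines a probability distribution $(p_i(\xi_n))_{i\ge 0}$ on $\{0,1,2,\dots\}$ with generating function $f_n(s)=\sum_{i\ge0}p_i(\xi_n)s^i$. The process is $Z_{n+1}=\sum_{i=1}^{Z_n}N_{n,i}$, where conditionally on $\xi$ the $N_{n,i}$ ($n\ge0,i\ge1$) are independent and $N_{n,i}$ has generating function $f_n$. $\mathbb{P}_\xi,\mathbb{E}_\xi$ denote the quenched law/expectation (given $\xi$), and $\mathbb{P}_k,\mathbb{E}_k$ the annealed law/expectation (averaged over $\xi$) when $Z_0=k$; $\mathbb{P}=\mathbb{P}_1$, $\mathbb{E}=\mathbb{E}_1$. Let $m_n=\sum_i i\,p_i(\xi_n)$, $\Pi_0=1$, $\Pi_n=m_0\cdots m_{n-1}$, $W_n=Z_n/\Pi_n$ and $W=\lim_n W_n$ (a.s. limit of the nonnegative martingale $W_n$), $X=\log m_0$. Standing assumptions: $p_0(\xi_0)=0$ a.s.; $\mathbb{E}X\in(0,\infty)$; $\mathbb{E}[\frac{Z_1}{m_0}\log^+Z_1]<\infty$ (with $Z_0=1$); $\mathbb{P}(Z_1=1)>0$. Notation: $\gamma_k=\mathbb{P}_k(Z_1=k)=\mathbb{E}[p_1(\xi_0)^k]$; $c_r=\mathbb{E}[m_0^{-r}]$; $r_k\in(0,\infty)$ denotes the solution of $\mathbb{E}[m_0^{-r_k}]=\gamma_k$ (assumed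 to exist); $A_{k,n}(r)=\gamma_k^n$ if $r>r_k$, $A_{k,n}(r)=n\gamma_k^n$ if $r=r_k$, $A_{k,n}(r)=c_r^n$ if $r<r_k$. $G_{k,n}(t)=\mathbb{E}_k[t^{Z_n}]$ for $t\in[0,1]$, and $\bar G_{k,1}(t)=G_{k,1}(t)-\gamma_k t^k$. $Q_k(t)=\lim_{n\to\infty}G_{k,n}(t)/\gamma_k^n$ for $t\in[0,1)$ (this limit exists and is a power series $\sum_{j\ge k}q_{k,j}t^j$ with $q_{k,k}=1$). $\phi_\xi(t)=\mathbb{E}_\xi[e^{-tW}]$ with $Z_0=1$. For $r>0$, $\mathbb{P}_k^{(r)}$ is the probability measure defined by $\mathbb{E}_k^{(r)}[T]=\mathbb{E}_k[\Pi_n^{-r}T]/c_r^n$ for every $\mathcal{F}_n$-measurable $T$, where $\mathcal{F}_n=\sigma(\xi,N_{j,i}:0\le j\le n-1,i\ge1)$; $\mathbb{E}^{(r)}=\mathbb{E}_1^{(r)}$, and $\phi_k^{(r)}(t)=\mathbb{E}_k^{(r)}[e^{-tW}]$.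
   Formalization: As defined, P_k^{(r)} does not exist unless m_0 is constant, since F_n contains all of ξ. It is taken here as the law making the environment i.i.d. with density m_0^{-r}/c_r and the quenched law unchanged, so the identity holds for T depending on ξ_0,…,ξ_{n-1} and N_{j,i}, j<n. *)

theory Defs
  imports "HOL-Probability.Probability"
begin

text \<open>Branching process in a random environment.
  The environment space is a probability space M on a type 'e (law of xi_0);
  each environment x determines the offspring distribution p x :: nat pmf.
  The environment sequence xi :: nat => 'e is i.i.d. with law M (product measure);
  given xi, the offspring numbers N_{n,i} are the coordinates omega (n,i) of the
  product of the pmfs p (xi n).\<close>

definition mean :: "('e \<Rightarrow> nat pmf) \<Rightarrow> 'e \<Rightarrow> real" where
  "mean p x = (\<integral>j. real j \<partial>measure_pmf (p x))"

definition envP :: "'e measure \<Rightarrow> (nat \<Rightarrow> 'e) measure" where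
  "envP M = PiM UNIV (\<lambda>_::nat. M)"

definition qlaw :: "('e \<Rightarrow> nat pmf) \<Rightarrow> (nat \<Rightarrow> 'e) \<Rightarrow> (nat \<times> nat \<Rightarrow> nat) measure" where
  "qlaw p \<xi> = PiM UNIV (\<lambda>ni::nat \<times> nat. measure_pmf (p (\<xi> (fst ni))))"

fun Zpr :: "nat \<Rightarrow> (nat \<times> nat \<Rightarrow> nat) \<Rightarrow> nat \<Rightarrow> nat" where
  "Zpr k \<omega> 0 = k"
| "Zpr k \<omega> (Suc n) = (\<Sum>i\<in>{1..Zpr k \<omega> n}. \<omega> (n, i))"

definition annE :: "'e measure \<Rightarrow> ('e \<Rightarrow> nat pmf) \<Rightarrow>
    ((nat \<Rightarrow> 'e) \<Rightarrow> (nat \<times> nat \<Rightarrow> nat) \<Rightarrow> real) \<Rightarrow> real" where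
  "annE M p T = (\<integral>\<xi>. (\<integral>\<omega>. T \<xi> \<omega> \<partial>qlaw p \<xi>) \<partial>envP M)"

definition gam :: "'e measure \<Rightarrow> ('e \<Rightarrow> nat pmf) \<Rightarrow> nat \<Rightarrow> real" where
  "gam M p k = (\<integral>x. pmf (p x) 1 ^ k \<partial>M)"

definition cr :: "'e measure \<Rightarrow> ('e \<Rightarrow> nat pmf) \<Rightarrow> real \<Rightarrow> real" where
  "cr M p r = (\<integral>x. mean p x powr (-r) \<partial>M)"

definition Pin :: "('e \<Rightarrow> nat pmf) \<Rightarrow> (nat \<Rightarrow> 'e) \<Rightarrow> nat \<Rightarrow> real" where
  "Pin p \<xi> n = (\<Prod>j<n. mean p (\<xi> j))"

definition Wlim :: "('e \<Rightarrow> nat pmf) \<Rightarrow> (nat \<Rightarrow> 'e) \<Rightarrow> nat \<Rightarrow> (nat \<times> nat \<Rightarrow> nat) \<Rightarrow> real" where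
  "Wlim p \<xi> k \<omega> = lim (\<lambda>n. real (Zpr k \<omega> n) / Pin p \<xi> n)"

definition phiq :: "('e \<Rightarrow> nat pmf) \<Rightarrow> (nat \<Rightarrow> 'e) \<Rightarrow> real \<Rightarrow> real" where
  "phiq p \<xi> t = (\<integral>\<omega>. exp (- t * Wlim p \<xi> 1 \<omega>) \<partial>qlaw p \<xi>)"

definition Gf :: "'e measure \<Rightarrow> ('e \<Rightarrow> nat pmf) \<Rightarrow> nat \<Rightarrow> nat \<Rightarrow> real \<Rightarrow> real" where
  "Gf M p k n t = annE M p (\<lambda>\<xi> \<omega>. t ^ Zpr k \<omega> n)"

definition Gbar :: "'e measure \<Rightarrow> ('e \<Rightarrow> nat pmf) \<Rightarrow> nat \<Rightarrow> real \<Rightarrow> real" where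
  "Gbar M p k t = Gf M p k 1 t - gam M p k * t ^ k"

definition Qk :: "'e measure \<Rightarrow> ('e \<Rightarrow> nat pmf) \<Rightarrow> nat \<Rightarrow> real \<Rightarrow> real" where
  "Qk M p k t = lim (\<lambda>n. Gf M p k n t / gam M p k ^ n)"

text \<open>The r-tilted environment law: density m_0^{-r} / c_r.  Under P^{(r)} the
  environment is i.i.d. with this law and the quenched law is unchanged.\<close>
definition tilt :: "'e measure \<Rightarrow> ('e \<Rightarrow> nat pmf) \<Rightarrow> real \<Rightarrow> 'e measure" where
  "tilt M p r = density M (\<lambda>x. ennreal (mean p x powr (-r) / cr M p r))"

definition phir :: "'e measure \<Rightarrow> ('e \<Rightarrow> nat pmf) \<Rightarrow> real \<Rightarrow> nat \<Rightarrow> real \<Rightarrow> real" where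
  "phir M p r k t = annE (tilt M p r) p (\<lambda>\<xi> \<omega>. exp (- t * Wlim p \<xi> k \<omega>))"

definition Acoef :: "'e measure \<Rightarrow> ('e \<Rightarrow> nat pmf) \<Rightarrow> real \<Rightarrow> nat \<Rightarrow> nat \<Rightarrow> real \<Rightarrow> real" where
  "Acoef M p rk k n r =
     (if r > rk then gam M p k ^ n
      else if r = rk then real n * gam M p k ^ n
      else cr M p r ^ n)"

definition Cconst :: "'e measure \<Rightarrow> ('e \<Rightarrow> nat pmf) \<Rightarrow> real \<Rightarrow> nat \<Rightarrow> real \<Rightarrow> real" where
  "Cconst M p rk k r =
     (if r > rk then
        (1 / Gamma r) * (LBINT t:{0<..}. Qk M p k (exp (- t)) * t powr (r - 1))
      else if r = rk then
        (inverse (gam M p k) / Gamma r) *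
          annE (tilt M p r) p
            (\<lambda>\<xi> \<omega>. LBINT t:{0<..}. Gbar M p k (phiq p \<xi> t) * t powr (r - 1))
      else
        (1 / Gamma r) * (LBINT t:{0<..}. phir M p r k t * t powr (r - 1)))"

end

theory Submission
  imports Defs
begin

text \<open>
  Under the annealed law \<open>Z\<^sub>n\<close> is a nondecreasing Markov chain, and everything rests on the bound
  \<open>E\<^sub>j[Z\<^sub>n powr (- r)] \<le> C * c\<^sub>r ^ n\<close>, uniform in \<open>j \<ge> k\<close>, whenever \<open>\<gamma>\<^sub>k < c\<^sub>r\<close>. In one step,
  \<open>E\<^sub>z[(Z\<^sub>1 / z) powr (- r)] \<le> c\<^sub>r + e(z)\<close>, where the \<open>L log L\<close> condition makes \<open>e\<close> summable along geometric
  sequences. A Lyapunov function gives the bound up to an exponential loss; applied to the exponent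
  \<open>r + 1\<close> it shows that \<open>Z\<^sub>n\<close> grows geometrically under the weight \<open>Z\<^sub>n powr (- r)\<close>, so that the errors
  \<open>e(Z\<^sub>n)\<close> sum up and a Gronwall argument removes the loss.

  By \<open>\<Gamma>(r) * z powr (- r) = \<integral> exp (- t z) t powr (r - 1) dt\<close> each regime then follows by monotone
  convergence: by Jensen's inequality the Laplace transforms of \<open>W\<^sub>n\<close> under the tilted law increase to that
  of \<open>W\<close> (\<open>r < r\<^sub>k\<close>), and \<open>G\<^sub>k\<^sub>,\<^sub>n / \<gamma>\<^sub>k ^ n\<close> increases to \<open>Q\<^sub>k\<close> (\<open>r > r\<^sub>k\<close>). For \<open>r = r\<^sub>k\<close> the first-step
  decomposition writes \<open>E\<^sub>k[Z\<^sub>n powr (- r)] / \<gamma>\<^sub>k ^ n\<close> as a sum with convergent increments, and the limit is a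
  Cesaro mean. In the last two cases the bound is used from \<open>k + 1\<close> on.
\<close>

section \<open>Sums of offspring and the quenched law of the population\<close>

primrec iid_sum :: "nat pmf \<Rightarrow> nat \<Rightarrow> nat pmf" where
  "iid_sum q 0 = return_pmf 0"
| "iid_sum q (Suc z) = bind_pmf q (\<lambda>a. map_pmf ((+) a) (iid_sum q z))"

primrec zlaw :: "(nat \<Rightarrow> nat pmf) \<Rightarrow> nat \<Rightarrow> nat \<Rightarrow> nat pmf" where
  "zlaw q 0 k = return_pmf k"
| "zlaw q (Suc n) k = bind_pmf (iid_sum (q 0) k) (zlaw (\<lambda>i. q (Suc i)) n)"

lemma zlaw_Suc_last: "zlaw q (Suc n) k = bind_pmf (zlaw q n k) (iid_sum (q n))"
proof (induction n arbitrary: q k)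
  case 0
  have "zlaw (\<lambda>i. q (Suc i)) 0 = return_pmf" by (simp add: fun_eq_iff)
  then show ?case by (simp add: bind_return_pmf bind_return_pmf' del: zlaw.simps(1))
    (simp add: bind_return_pmf)
next
  case (Suc n)
  have "zlaw q (Suc (Suc n)) k = bind_pmf (iid_sum (q 0) k) (zlaw (\<lambda>i. q (Suc i)) (Suc n))"
    by simp
  also have "\<dots> = bind_pmf (iid_sum (q 0) k)
      (\<lambda>j. bind_pmf (zlaw (\<lambda>i. q (Suc i)) n j) (iid_sum (q (Suc n))))"
    by (subst Suc.IH[abs_def]) simp
  also have "\<dots> = bind_pmf (zlaw q (Suc n) k) (iid_sum (q (Suc n)))"
    by (simp add: bind_assoc_pmf)
  finally show ?case .
qed

lemma nn_integral_iid_sum_mono: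
  fixes h :: "nat \<Rightarrow> ennreal"
  assumes "antimono h" and "\<And>j. tr j \<le> j"
  shows "(\<integral>\<^sup>+j. h j \<partial>iid_sum q z) \<le> (\<integral>\<^sup>+j. h j \<partial>iid_sum (map_pmf tr q) z)"
  using assms(1)
proof (induction z arbitrary: h)
  case 0
  then show ?case by simp
next
  case (Suc z)
  have "(\<integral>\<^sup>+j. h j \<partial>iid_sum q (Suc z)) = (\<integral>\<^sup>+a. \<integral>\<^sup>+j. h (a + j) \<partial>iid_sum q z \<partial>q)"
    by simp
  also have "\<dots> \<le> (\<integral>\<^sup>+a. \<integral>\<^sup>+j. h (tr a + j) \<partial>iid_sum q z \<partial>q)"
    by (intro nn_integral_mono antimonoD[OF Suc.prems]) (simp add: assms(2))
  also have "\<dots> \<le> (\<integral>\<^sup>+a. \<integral>\<^sup>+j. h (tr a + j) \<partial>iid_sum (map_pmf tr q) z \<partial>q)"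
    by (intro nn_integral_mono Suc.IH antimonoI antimonoD[OF Suc.prems]) simp
  finally show ?case by simp
qed

lemma nn_integral_power_iid_sum:
  fixes u :: ennreal
  shows "(\<integral>\<^sup>+j. u ^ j \<partial>iid_sum q z) = (\<integral>\<^sup>+j. u ^ j \<partial>q) ^ z"
  by (induction z) (simp_all add: power_add nn_integral_cmult nn_integral_multc)

lemma set_iid_sum_ge:
  assumes "0 \<notin> set_pmf q" "j \<in> set_pmf (iid_sum q z)"
  shows "z \<le> j"
  using assms(2)
proof (induction z arbitrary: j)
  case (Suc z)
  then obtain a b where "a \<in> set_pmf q" "b \<in> set_pmf (iid_sum q z)" "j = a + b"
    by auto
  with Suc.IH[of b] assms(1) show ?case
    by (cases a) auto
qed simp

lemma pmf_iid_sum_same: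
  assumes "0 \<notin> set_pmf q"
  shows "pmf (iid_sum q z) z = pmf q 1 ^ z"
proof (induction z)
  case (Suc z)
  have "ennreal (pmf (iid_sum q (Suc z)) (Suc z)) =
      (\<integral>\<^sup>+a. ennreal (pmf (map_pmf ((+) a) (iid_sum q z)) (Suc z)) \<partial>q)"
    by (simp add: ennreal_pmf_bind)
  also have "\<dots> = (\<integral>\<^sup>+a. ennreal (pmf q 1 ^ z) * indicator {1} a \<partial>q)"
  proof (intro nn_integral_cong_AE AE_pmfI)
    fix a assume a: "a \<in> set_pmf q"
    then have "a \<noteq> 0" using assms by metis
    then consider "a = 1" | "a \<ge> 2" by linarith
    then show "ennreal (pmf (map_pmf ((+) a) (iid_sum q z)) (Suc z)) =
        ennreal (pmf q 1 ^ z) * indicator {1} a"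
    proof cases
      case 1
      have "pmf (map_pmf ((+) a) (iid_sum q z)) (a + z) = pmf (iid_sum q z) z"
        by (rule pmf_map_inj') (auto simp: inj_def)
      with 1 Suc.IH show ?thesis by simp
    next
      case 2
      have "Suc z \<notin> set_pmf (map_pmf ((+) a) (iid_sum q z))"
        using 2 set_iid_sum_ge[OF assms, of _ z] by fastforce
      then have "pmf (map_pmf ((+) a) (iid_sum q z)) (Suc z) = 0"
        unfolding set_pmf_iff by blast
      then show ?thesis using 2 by simp
    qed
  qed
  also have "\<dots> = ennreal (pmf q 1 ^ z) * ennreal (pmf q 1)"
    by (subst nn_integral_cmult) (simp_all add: emeasure_pmf_single)
  finally show ?case
    by (simp add: ennreal_mult[symmetric] mult.commute)
qed simp

lemma set_zlaw_ge:
  assumes "\<And>i. 0 \<notin> set_pmf (q i)" "j \<in> set_pmf (zlaw q n k)"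
  shows "k \<le> j"
  using assms
proof (induction n arbitrary: q k)
  case (Suc n)
  then obtain i where i: "i \<in> set_pmf (iid_sum (q 0) k)" "j \<in> set_pmf (zlaw (\<lambda>i. q (Suc i)) n i)"
    by auto
  have "k \<le> i" using set_iid_sum_ge[OF Suc.prems(1) i(1)] .
  moreover have "i \<le> j" by (rule Suc.IH[OF Suc.prems(1) i(2)])
  ultimately show ?case by simp
qed simp

lemma nn_integral_power_zlaw:
  fixes u :: ennreal
  shows "(\<integral>\<^sup>+j. u ^ j \<partial>zlaw q n k) = (\<integral>\<^sup>+j. u ^ j \<partial>zlaw q n 1) ^ k"
proof (induction n arbitrary: u)
  case (Suc n)
  show ?case
    using Suc.IH[of "\<integral>\<^sup>+j. u ^ j \<partial>q n"]
    by (simp del: zlaw.simps(2) add: zlaw_Suc_last nn_integral_power_iid_sum)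
qed simp

lemma exp_mean_le_nn_integral:
  assumes "integrable (measure_pmf q) real" and m: "(\<integral>j. real j \<partial>measure_pmf q) = m" "m > 0"
  shows "ennreal (exp (- s)) \<le> (\<integral>\<^sup>+j. ennreal (exp (- s * real j / m)) \<partial>q)"
proof (cases "integrable (measure_pmf q) (\<lambda>j. exp (- s * real j / m))")
  case True
  have "exp (- s) = (\<integral>j. exp (- s) * (1 + s) - exp (- s) * s / m * real j \<partial>q)"
    using assms by (simp add: algebra_simps)
  also have "\<dots> \<le> (\<integral>j. exp (- s * real j / m) \<partial>q)"
  proof (rule integral_mono)
    fix j :: nat
    have "exp (- s) * (1 + (s - s * real j / m)) \<le> exp (- s) * exp (s - s * real j / m)"
      by (intro mult_left_mono exp_ge_add_one_self) auto
    then show "exp (- s) * (1 + s) - exp (- s) * s / m * real j \<le> exp (- s * real j / m)"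
      by (simp add: algebra_simps flip: exp_add)
  qed (use assms True in auto)
  finally show ?thesis
    by (subst nn_integral_eq_integral[OF True]) (auto intro: ennreal_leI)
next
  case False
  then have "(\<integral>\<^sup>+j. ennreal (exp (- s * real j / m)) \<partial>q) = \<infinity>"
    by (auto simp: integrable_iff_bounded less_top[symmetric])
  then show ?thesis by simp
qed

section \<open>Independence under the quenched law\<close>

lemma (in prob_space) indep_var_nn_integral_mult:
  fixes X Y :: "'a \<Rightarrow> ennreal"
  assumes "indep_var borel X borel Y"
  shows "(\<integral>\<^sup>+\<omega>. X \<omega> * Y \<omega> \<partial>M) = (\<integral>\<^sup>+\<omega>. X \<omega> \<partial>M) * (\<integral>\<^sup>+\<omega>. Y \<omega> \<partial>M)"
proof -
  have [measurable]: "X \<in> borel_measurable M" "Y \<in> borel_measurable M"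
    using assms indep_var_distribution_eq by blast+
  have D: "distr M borel X \<Otimes>\<^sub>M distr M borel Y = distr M (borel \<Otimes>\<^sub>M borel) (\<lambda>\<omega>. (X \<omega>, Y \<omega>))"
    using assms indep_var_distribution_eq by blast
  interpret Y: prob_space "distr M borel Y" by (rule prob_space_distr) simp
  have "(\<integral>\<^sup>+\<omega>. X \<omega> * Y \<omega> \<partial>M) = (\<integral>\<^sup>+z. fst z * snd z \<partial>(distr M borel X \<Otimes>\<^sub>M distr M borel Y))"
    unfolding D by (subst nn_integral_distr) (auto intro!: borel_measurable_times_ennreal)
  also have "\<dots> = (\<integral>\<^sup>+x. \<integral>\<^sup>+y. x * y \<partial>distr M borel Y \<partial>distr M borel X)"
    by (subst Y.nn_integral_fst[symmetric]) auto
  also have "\<dots> = (\<integral>\<^sup>+\<omega>. X \<omega> \<partial>M) * (\<integral>\<^sup>+\<omega>. Y \<omega> \<partial>M)"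
    by (simp add: nn_integral_cmult nn_integral_multc nn_integral_distr)
  finally show ?thesis .
qed

abbreviation offspring_space :: "(nat \<times> nat \<Rightarrow> nat) measure" where
  "offspring_space \<equiv> PiM UNIV (\<lambda>_. count_space UNIV)"

lemma sets_qlaw [measurable_cong]: "sets (qlaw p \<xi>) = sets offspring_space"
  unfolding qlaw_def by (intro sets_PiM_cong) auto

lemma space_qlaw [simp]: "space (qlaw p \<xi>) = UNIV"
  unfolding qlaw_def by (auto simp: space_PiM)

lemma prob_space_qlaw: "prob_space (qlaw p \<xi>)"
  unfolding qlaw_def by (intro prob_space_PiM measure_pmf.prob_space_axioms)

lemma indep_vars_qlaw:
  "prob_space.indep_vars (qlaw p \<xi>) (\<lambda>_. count_space UNIV) (\<lambda>i \<omega>. \<omega> i) UNIV"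
proof -
  interpret prob_space "qlaw p \<xi>" by (rule prob_space_qlaw)
  have comp: "distr (qlaw p \<xi>) (count_space UNIV) (\<lambda>\<omega>. \<omega> i) = measure_pmf (p (\<xi> (fst i)))" for i
  proof -
    have "distr (qlaw p \<xi>) (count_space UNIV) (\<lambda>\<omega>. \<omega> i) =
        distr (PiM UNIV (\<lambda>i. measure_pmf (p (\<xi> (fst i))))) (measure_pmf (p (\<xi> (fst i)))) (\<lambda>\<omega>. \<omega> i)"
      unfolding qlaw_def by (intro distr_cong) auto
    also have "\<dots> = measure_pmf (p (\<xi> (fst i)))"
      by (intro distr_PiM_component measure_pmf.prob_space_axioms) auto
    finally show ?thesis .
  qed
  have "distr (qlaw p \<xi>) offspring_space (\<lambda>\<omega>. \<lambda>i\<in>UNIV. \<omega> i) = qlaw p \<xi>"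
    using distr_id2[OF sets_qlaw[symmetric]] by (simp add: id_def restrict_UNIV)
  then show ?thesis
    by (subst indep_vars_iff_distr_eq_PiM) (auto simp: comp qlaw_def[symmetric])
qed

lemma nn_integral_qlaw_component:
  "(\<integral>\<^sup>+\<omega>. h (\<omega> i) \<partial>qlaw p \<xi>) = (\<integral>\<^sup>+j. h j \<partial>p (\<xi> (fst i)))"
proof -
  have "(\<integral>\<^sup>+j. h j \<partial>distr (PiM UNIV (\<lambda>i. measure_pmf (p (\<xi> (fst i))))) (measure_pmf (p (\<xi> (fst i)))) (\<lambda>\<omega>. \<omega> i))
      = (\<integral>\<^sup>+\<omega>. h (\<omega> i) \<partial>qlaw p \<xi>)"
    unfolding qlaw_def by (subst nn_integral_distr) auto
  then show ?thesis
    by (subst (asm) distr_PiM_component) (auto intro: measure_pmf.prob_space_axioms)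
qed

definition depends_on :: "('i \<Rightarrow> 'b) set \<Rightarrow> 'i set \<Rightarrow> (('i \<Rightarrow> 'b) \<Rightarrow> 'c) \<Rightarrow> bool" where
  "depends_on S A F \<longleftrightarrow> (\<forall>\<omega>\<in>S. \<forall>\<omega>'\<in>S. (\<forall>i\<in>A. \<omega> i = \<omega>' i) \<longrightarrow> F \<omega> = F \<omega>')"

lemma nn_integral_qlaw_indep:
  fixes F G :: "(nat \<times> nat \<Rightarrow> nat) \<Rightarrow> ennreal"
  assumes [measurable]: "F \<in> borel_measurable offspring_space" "G \<in> borel_measurable offspring_space"
    and dep: "depends_on UNIV A F" "depends_on UNIV B G" and disj: "A \<inter> B = {}"
  shows "(\<integral>\<^sup>+\<omega>. F \<omega> * G \<omega> \<partial>qlaw p \<xi>) = (\<integral>\<^sup>+\<omega>. F \<omega> \<partial>qlaw p \<xi>) * (\<integral>\<^sup>+\<omega>. G \<omega> \<partial>qlaw p \<xi>)"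
proof -
  interpret prob_space "qlaw p \<xi>" by (rule prob_space_qlaw)
  define ext where "ext C v = (\<lambda>i. if i \<in> C then v i else 0)"
    for C :: "(nat \<times> nat) set" and v :: "nat \<times> nat \<Rightarrow> nat"
  have ext[measurable]: "ext C \<in> PiM C (\<lambda>_. count_space UNIV) \<rightarrow>\<^sub>M offspring_space" for C
  proof (rule measurable_PiM_single')
    fix i
    show "(\<lambda>v. ext C v i) \<in> PiM C (\<lambda>_. count_space UNIV) \<rightarrow>\<^sub>M count_space UNIV"
      by (cases "i \<in> C") (auto simp: ext_def)
  qed auto
  have "indep_var (PiM A (\<lambda>_. count_space UNIV)) (\<lambda>\<omega>. restrict (\<lambda>i. \<omega> i) A)
      (PiM B (\<lambda>_. count_space UNIV)) (\<lambda>\<omega>. restrict (\<lambda>i. \<omega> i) B)"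
    by (intro indep_var_restrict[OF indep_vars_qlaw disj]) auto
  then have "indep_var borel ((F \<circ> ext A) \<circ> (\<lambda>\<omega>. restrict (\<lambda>i. \<omega> i) A))
      borel ((G \<circ> ext B) \<circ> (\<lambda>\<omega>. restrict (\<lambda>i. \<omega> i) B))"
    by (rule indep_var_compose) (auto intro!: measurable_comp[OF ext])
  moreover have "(F \<circ> ext A) \<circ> (\<lambda>\<omega>. restrict (\<lambda>i. \<omega> i) A) = F"
    using dep(1) by (auto simp: fun_eq_iff depends_on_def ext_def)
  moreover have "(G \<circ> ext B) \<circ> (\<lambda>\<omega>. restrict (\<lambda>i. \<omega> i) B) = G"
    using dep(2) by (auto simp: fun_eq_iff depends_on_def ext_def)
  ultimately have "indep_var borel F borel G" by simp
  then show ?thesis by (rule indep_var_nn_integral_mult)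
qed

lemma nn_integral_qlaw_substitution:
  fixes F :: "(nat \<times> nat \<Rightarrow> nat) \<Rightarrow> ennreal" and X :: "(nat \<times> nat \<Rightarrow> nat) \<Rightarrow> nat"
  assumes F[measurable]: "F \<in> borel_measurable offspring_space"
    and X[measurable]: "X \<in> offspring_space \<rightarrow>\<^sub>M count_space UNIV"
    and H[measurable]: "\<And>a. H a \<in> borel_measurable offspring_space"
    and dep: "depends_on UNIV A F" "depends_on UNIV A X" "\<And>a. depends_on UNIV B (H a)"
    and disj: "A \<inter> B = {}"
  shows "(\<integral>\<^sup>+\<omega>. F \<omega> * H (X \<omega>) \<omega> \<partial>qlaw p \<xi>) = (\<integral>\<^sup>+\<omega>. F \<omega> * (\<integral>\<^sup>+\<omega>'. H (X \<omega>) \<omega>' \<partial>qlaw p \<xi>) \<partial>qlaw p \<xi>)"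
proof -
  have split: "(\<Sum>a. F \<omega> * indicator {a} (X \<omega>) * h a) = F \<omega> * h (X \<omega>)" for h :: "nat \<Rightarrow> ennreal" and \<omega>
    by (subst suminf_finite[of "{X \<omega>}"]) (auto simp: indicator_def)
  have ind[measurable]: "(\<lambda>\<omega>. F \<omega> * indicator {a} (X \<omega>)) \<in> borel_measurable offspring_space" for a
  proof -
    have [measurable]: "(\<lambda>\<omega>. indicator {a} (X \<omega>) :: ennreal) \<in> borel_measurable offspring_space"
      by (rule measurable_compose[OF X]) simp
    show ?thesis by measurable
  qed
  have dep_ind: "depends_on UNIV A (\<lambda>\<omega>. F \<omega> * indicator {a} (X \<omega>))" for a
    using dep(1,2) unfolding depends_on_def by metis
  have "(\<integral>\<^sup>+\<omega>. F \<omega> * H (X \<omega>) \<omega> \<partial>qlaw p \<xi>) =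
      (\<integral>\<^sup>+\<omega>. (\<Sum>a. F \<omega> * indicator {a} (X \<omega>) * H a \<omega>) \<partial>qlaw p \<xi>)"
    by (intro nn_integral_cong) (simp add: split[of _ "\<lambda>a. H a _"])
  also have "\<dots> = (\<Sum>a. \<integral>\<^sup>+\<omega>. F \<omega> * indicator {a} (X \<omega>) * H a \<omega> \<partial>qlaw p \<xi>)"
    by (intro nn_integral_suminf) measurable
  also have "\<dots> = (\<Sum>a. (\<integral>\<^sup>+\<omega>. F \<omega> * indicator {a} (X \<omega>) \<partial>qlaw p \<xi>) * (\<integral>\<^sup>+\<omega>'. H a \<omega>' \<partial>qlaw p \<xi>))"
    by (intro suminf_cong nn_integral_qlaw_indep[OF ind H dep_ind dep(3) disj])
  also have "\<dots> = (\<Sum>a. (\<integral>\<^sup>+\<omega>. F \<omega> * indicator {a} (X \<omega>) * (\<integral>\<^sup>+\<omega>'. H a \<omega>' \<partial>qlaw p \<xi>) \<partial>qlaw p \<xi>))"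
    by (intro suminf_cong nn_integral_multc[symmetric]) measurable
  also have "\<dots> = (\<integral>\<^sup>+\<omega>. (\<Sum>a. F \<omega> * indicator {a} (X \<omega>) * (\<integral>\<^sup>+\<omega>'. H a \<omega>' \<partial>qlaw p \<xi>)) \<partial>qlaw p \<xi>)"
    by (intro nn_integral_suminf[symmetric]) measurable
  finally show ?thesis
    by (simp add: split[of _ "\<lambda>a. \<integral>\<^sup>+\<omega>'. H a \<omega>' \<partial>qlaw p \<xi>"])
qed

lemma measurable_row_sum [measurable]:
  "(\<lambda>\<omega>. \<Sum>i\<in>{1..z}. \<omega> (n, i)) \<in> offspring_space \<rightarrow>\<^sub>M count_space (UNIV :: nat set)"
  by (induction z) simp_all

lemma measurable_Zpr [measurable]: "(\<lambda>\<omega>. Zpr k \<omega> n) \<in> offspring_space \<rightarrow>\<^sub>M count_space UNIV"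
proof (induction n)
  case (Suc n)
  have "(\<lambda>\<omega>. \<Sum>i\<in>{1..Zpr k \<omega> n}. \<omega> (n, i)) \<in> offspring_space \<rightarrow>\<^sub>M count_space UNIV"
    by (rule measurable_compose_countable[OF measurable_row_sum Suc])
  then show ?case by simp
qed simp

abbreviation rows_below :: "nat \<Rightarrow> (nat \<times> nat) set" where
  "rows_below n \<equiv> {..<n} \<times> UNIV"

lemma depends_on_Zpr: "depends_on UNIV (rows_below n) (\<lambda>\<omega>. Zpr k \<omega> n)"
proof (induction n)
  case (Suc n)
  show ?case unfolding depends_on_def
  proof (intro ballI impI)
    fix \<omega> \<omega>' :: "nat \<times> nat \<Rightarrow> nat" assume *: "\<forall>i\<in>rows_below (Suc n). \<omega> i = \<omega>' i"
    then have "Zpr k \<omega> n = Zpr k \<omega>' n"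
      using Suc by (auto simp: depends_on_def)
    with * show "Zpr k \<omega> (Suc n) = Zpr k \<omega>' (Suc n)" by simp
  qed
qed (simp add: depends_on_def)

lemma nn_integral_row_sum:
  fixes h :: "nat \<Rightarrow> ennreal"
  shows "(\<integral>\<^sup>+\<omega>. h (\<Sum>i\<in>{1..z}. \<omega> (n, i)) \<partial>qlaw p \<xi>) = (\<integral>\<^sup>+j. h j \<partial>iid_sum (p (\<xi> n)) z)"
proof (induction z arbitrary: h)
  case 0
  then show ?case using prob_space.emeasure_space_1[OF prob_space_qlaw, of p \<xi>] by simp
next
  case (Suc z)
  have "(\<integral>\<^sup>+\<omega>. h (\<Sum>i\<in>{1..Suc z}. \<omega> (n, i)) \<partial>qlaw p \<xi>) =
      (\<integral>\<^sup>+\<omega>. 1 * (\<lambda>a \<omega>. h (a + (\<Sum>i\<in>{1..z}. \<omega> (n, i)))) (\<omega> (n, Suc z)) \<omega> \<partial>qlaw p \<xi>)"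
    by (simp add: add.commute)
  also have "\<dots> = (\<integral>\<^sup>+\<omega>. 1 * (\<integral>\<^sup>+\<omega>'. (\<lambda>a \<omega>. h (a + (\<Sum>i\<in>{1..z}. \<omega> (n, i)))) (\<omega> (n, Suc z)) \<omega>' \<partial>qlaw p \<xi>) \<partial>qlaw p \<xi>)"
    by (rule nn_integral_qlaw_substitution[where A="{(n, Suc z)}" and B="{n} \<times> {1..z}"])
      (auto simp: depends_on_def intro!: arg_cong[of _ _ h] sum.cong)
  also have "\<dots> = (\<integral>\<^sup>+a. \<integral>\<^sup>+\<omega>'. h (a + (\<Sum>i\<in>{1..z}. \<omega>' (n, i))) \<partial>qlaw p \<xi> \<partial>p (\<xi> n))"
    using nn_integral_qlaw_component[where h="\<lambda>a. \<integral>\<^sup>+\<omega>'. h (a + (\<Sum>i\<in>{1..z}. \<omega>' (n, i))) \<partial>qlaw p \<xi>"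
        and i="(n, Suc z)" and p=p and \<xi>=\<xi>]
    by simp
  also have "\<dots> = (\<integral>\<^sup>+a. \<integral>\<^sup>+j. h (a + j) \<partial>iid_sum (p (\<xi> n)) z \<partial>p (\<xi> n))"
    by (subst Suc.IH) simp
  finally show ?case by simp
qed

lemma depends_on_row_sum:
  "depends_on UNIV ({n} \<times> UNIV) (\<lambda>\<omega>. h (\<Sum>i\<in>{1..z::nat}. \<omega> (n :: nat, i)))"
  by (auto simp: depends_on_def intro!: arg_cong[of _ _ h] sum.cong)

lemma nn_integral_Zpr_Suc:
  fixes h :: "nat \<Rightarrow> ennreal"
  assumes F[measurable]: "F \<in> borel_measurable offspring_space" and dep: "depends_on UNIV (rows_below n) F"
  shows "(\<integral>\<^sup>+\<omega>. F \<omega> * h (Zpr k \<omega> (Suc n)) \<partial>qlaw p \<xi>) =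
    (\<integral>\<^sup>+\<omega>. F \<omega> * (\<integral>\<^sup>+j. h j \<partial>iid_sum (p (\<xi> n)) (Zpr k \<omega> n)) \<partial>qlaw p \<xi>)"
proof -
  have "(\<integral>\<^sup>+\<omega>. F \<omega> * (\<lambda>z \<omega>. h (\<Sum>i\<in>{1..z}. \<omega> (n, i))) (Zpr k \<omega> n) \<omega> \<partial>qlaw p \<xi>) =
    (\<integral>\<^sup>+\<omega>. F \<omega> * (\<integral>\<^sup>+\<omega>'. (\<lambda>z \<omega>. h (\<Sum>i\<in>{1..z}. \<omega> (n, i))) (Zpr k \<omega> n) \<omega>' \<partial>qlaw p \<xi>) \<partial>qlaw p \<xi>)"
    by (rule nn_integral_qlaw_substitution[where A="rows_below n" and B="{n} \<times> UNIV"])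
      (auto intro!: dep depends_on_Zpr simp: depends_on_row_sum[where n=n, unfolded One_nat_def])
  then show ?thesis
    unfolding nn_integral_row_sum by simp
qed

lemma nn_integral_Zpr:
  fixes h :: "nat \<Rightarrow> ennreal"
  shows "(\<integral>\<^sup>+\<omega>. h (Zpr k \<omega> n) \<partial>qlaw p \<xi>) = (\<integral>\<^sup>+j. h j \<partial>zlaw (\<lambda>i. p (\<xi> i)) n k)"
proof (induction n arbitrary: h)
  case 0
  then show ?case using prob_space.emeasure_space_1[OF prob_space_qlaw, of p \<xi>] by simp
next
  case (Suc n)
  have "(\<integral>\<^sup>+\<omega>. h (Zpr k \<omega> (Suc n)) \<partial>qlaw p \<xi>) =
      (\<integral>\<^sup>+\<omega>. (\<integral>\<^sup>+j. h j \<partial>iid_sum (p (\<xi> n)) (Zpr k \<omega> n)) \<partial>qlaw p \<xi>)"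
    using nn_integral_Zpr_Suc[where F="\<lambda>_. 1" and n=n and h=h and k=k and p=p and \<xi>=\<xi>] by (simp add: depends_on_def)
  also have "\<dots> = (\<integral>\<^sup>+j. h j \<partial>zlaw (\<lambda>i. p (\<xi> i)) (Suc n) k)"
    unfolding zlaw_Suc_last
    using Suc.IH[of "\<lambda>z. \<integral>\<^sup>+j. h j \<partial>iid_sum (p (\<xi> n)) z"] by simp
  finally show ?case .
qed

lemma nn_integral_iid_sum_mean:
  "(\<integral>\<^sup>+j. ennreal (real j) \<partial>iid_sum q z) = of_nat z * (\<integral>\<^sup>+j. ennreal (real j) \<partial>q)"
proof (induction z)
  case (Suc z)
  have "(\<integral>\<^sup>+j. ennreal (real j) \<partial>iid_sum q (Suc z)) =
      (\<integral>\<^sup>+a. \<integral>\<^sup>+j. (ennreal (real a) + ennreal (real j)) \<partial>iid_sum q z \<partial>q)"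
    by (simp flip: ennreal_plus)
  also have "\<dots> = (\<integral>\<^sup>+j. ennreal (real j) \<partial>q) + of_nat z * (\<integral>\<^sup>+j. ennreal (real j) \<partial>q)"
    by (simp add: nn_integral_add Suc measure_pmf.emeasure_space_1[simplified])
  finally show ?case by (simp add: algebra_simps)
qed simp

lemma nn_integral_Zpr_martingale:
  assumes F: "F \<in> borel_measurable offspring_space" "depends_on UNIV (rows_below n) F"
    and int: "integrable (measure_pmf (p (\<xi> n))) real"
  shows "(\<integral>\<^sup>+\<omega>. F \<omega> * ennreal (real (Zpr k \<omega> (Suc n))) \<partial>qlaw p \<xi>) =
    ennreal (mean p (\<xi> n)) * (\<integral>\<^sup>+\<omega>. F \<omega> * ennreal (real (Zpr k \<omega> n)) \<partial>qlaw p \<xi>)"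
proof -
  note [measurable] = F(1)
  have m: "(\<integral>\<^sup>+j. ennreal (real j) \<partial>p (\<xi> n)) = ennreal (mean p (\<xi> n))"
    unfolding mean_def by (intro nn_integral_eq_integral int) auto
  have "(\<integral>\<^sup>+\<omega>. F \<omega> * ennreal (real (Zpr k \<omega> (Suc n))) \<partial>qlaw p \<xi>) =
      (\<integral>\<^sup>+\<omega>. ennreal (mean p (\<xi> n)) * (F \<omega> * ennreal (real (Zpr k \<omega> n))) \<partial>qlaw p \<xi>)"
    unfolding nn_integral_Zpr_Suc[OF F, where h="\<lambda>j. ennreal (real j)"] nn_integral_iid_sum_mean m
    by (simp add: ac_simps ennreal_of_nat_eq_real_of_nat)
  also have "\<dots> = ennreal (mean p (\<xi> n)) * (\<integral>\<^sup>+\<omega>. F \<omega> * ennreal (real (Zpr k \<omega> n)) \<partial>qlaw p \<xi>)"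
    by (rule nn_integral_cmult) measurable
  finally show ?thesis .
qed

section \<open>Almost sure convergence of nonnegative supermartingales\<close>

primrec holding :: "real \<Rightarrow> real \<Rightarrow> (nat \<Rightarrow> real) \<Rightarrow> nat \<Rightarrow> bool" where
  "holding a b y 0 = (y 0 < a)"
| "holding a b y (Suc n) = (if holding a b y n then y (Suc n) \<le> b else y (Suc n) < a)"

primrec upcrossings :: "real \<Rightarrow> real \<Rightarrow> (nat \<Rightarrow> real) \<Rightarrow> nat \<Rightarrow> nat" where
  "upcrossings a b y 0 = 0"
| "upcrossings a b y (Suc n) = upcrossings a b y n + of_bool (holding a b y n \<and> y (Suc n) > b)"

text \<open>The gambler buys below \<open>a\<close> and sells above \<open>b\<close>; the last summand is the value of an open
  position.\<close>

lemma upcrossings_gain: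
  "(b - a) * upcrossings a b y n + of_bool (holding a b y n) * (y n - a) \<le>
    (\<Sum>j<n. of_bool (holding a b y j) * (y (Suc j) - y j))"
proof (induction n)
  case (Suc n)
  then show ?case
    by (cases "holding a b y n"; cases "y (Suc n) > b"; cases "y (Suc n) < a")
      (auto simp: algebra_simps)
qed simp

lemma upcrossings_mono: "m \<le> n \<Longrightarrow> upcrossings a b y m \<le> upcrossings a b y n"
  by (rule lift_Suc_mono_le[of "upcrossings a b y"]) auto

lemma upcrossings_unbounded:
  assumes "a < b" and low: "\<exists>\<^sub>F n in sequentially. y n < a" and high: "\<exists>\<^sub>F n in sequentially. y n > b"
  shows "\<exists>n. upcrossings a b y n \<ge> N"
proof (induction N)
  case (Suc N)
  then obtain n0 where n0: "upcrossings a b y n0 \<ge> N" by blast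
  obtain n1 where n1: "n1 > n0" "y n1 < a"
    using low unfolding frequently_sequentially by (metis Suc_le_eq)
  have hold1: "holding a b y n1"
    using n1 \<open>a < b\<close> by (cases n1) auto
  obtain n2 where n2: "n2 > n1" "y n2 > b"
    using high unfolding frequently_sequentially by (metis Suc_le_eq)
  have N: "upcrossings a b y n1 \<ge> N"
    using n0 upcrossings_mono[of n0 n1 a b y] n1 by simp
  have "holding a b y (n1 + d) \<or> upcrossings a b y (n1 + d) \<ge> Suc N" for d
  proof (induction d)
    case (Suc d)
    have "N \<le> upcrossings a b y (n1 + d)" using N upcrossings_mono[of n1 "n1 + d" a b y] by simp
    with Suc show ?case by auto
  qed (simp add: hold1)
  moreover obtain d where "n2 = Suc (n1 + d)"
    using n2(1) less_iff_Suc_add by auto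
  ultimately obtain m where m: "n2 = Suc m" "n1 \<le> m" "holding a b y m \<or> upcrossings a b y m \<ge> Suc N"
    using le_add1 by blast
  have "N \<le> upcrossings a b y m" using N upcrossings_mono[of n1 m a b y] m by simp
  then have "upcrossings a b y n2 \<ge> Suc N" using m n2 by auto
  then show ?case by blast
qed simp

lemma ennreal_convergent_of_no_oscillation:
  fixes x :: "nat \<Rightarrow> ennreal"
  assumes "\<And>a b :: rat. 0 \<le> a \<Longrightarrow> a < b \<Longrightarrow>
    \<not> ((\<exists>\<^sub>F n in sequentially. x n < ennreal (real_of_rat a)) \<and> (\<exists>\<^sub>F n in sequentially. x n > ennreal (real_of_rat b)))"
  shows "x \<longlonglongrightarrow> liminf x"
proof -
  have "limsup x \<le> liminf x"
  proof (rule ccontr)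
    assume "\<not> limsup x \<le> liminf x"
    then have "liminf x < limsup x" by simp
    then obtain b :: rat where b: "liminf x < ennreal (real_of_rat b)" "ennreal (real_of_rat b) < limsup x"
      using ennreal_rat_dense by blast
    then obtain a :: rat where a: "liminf x < ennreal (real_of_rat a)" "ennreal (real_of_rat a) < ennreal (real_of_rat b)"
      using ennreal_rat_dense by blast
    have pos: "0 \<le> a" 
    proof (rule ccontr)
      assume "\<not> 0 \<le> a"
      then have "ennreal (real_of_rat a) = 0" by (intro ennreal_neg) simp
      with a show False by simp
    qed
    have ab: "a < b"
      using a(2) pos by (metis ennreal_less_iff of_rat_less zero_le_of_rat_iff)
    have "\<exists>\<^sub>F n in sequentially. x n < ennreal (real_of_rat a)"
    proof (rule ccontr)
      assume "\<not> ?thesis"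
      then have "\<forall>\<^sub>F n in sequentially. ennreal (real_of_rat a) \<le> x n"
        by (simp add: not_frequently not_less)
      then have "ennreal (real_of_rat a) \<le> liminf x" by (rule Liminf_bounded)
      with a show False by simp
    qed
    moreover have "\<exists>\<^sub>F n in sequentially. x n > ennreal (real_of_rat b)"
    proof (rule ccontr)
      assume "\<not> ?thesis"
      then have "\<forall>\<^sub>F n in sequentially. x n \<le> ennreal (real_of_rat b)"
        by (simp add: not_frequently not_less)
      then have "limsup x \<le> ennreal (real_of_rat b)" by (rule Limsup_bounded)
      with b show False by simp
    qed
    ultimately show False using assms[OF pos ab] by blast
  qed
  then have "limsup x = liminf x"
    using Liminf_le_Limsup[of sequentially x] by (simp add: antisym)
  then show ?thesis by (intro Liminf_eq_Limsup) auto
qed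

text \<open>The filtration is given implicitly: a set is known at time \<open>n\<close> if membership depends only on
  the values of the process up to \<open>n\<close>.\<close>

lemma (in prob_space) nonneg_supermartingale_convergent:
  fixes Y :: "nat \<Rightarrow> 'a \<Rightarrow> real"
  assumes Y[measurable]: "\<And>n. Y n \<in> borel_measurable M" and nonneg: "\<And>n \<omega>. 0 \<le> Y n \<omega>"
    and fin: "(\<integral>\<^sup>+\<omega>. ennreal (Y 0 \<omega>) \<partial>M) < \<infinity>"
    and super: "\<And>n A. A \<in> sets M \<Longrightarrow>
      (\<And>\<omega> \<omega>'. \<omega> \<in> space M \<Longrightarrow> \<omega>' \<in> space M \<Longrightarrow> (\<And>i. i \<le> n \<Longrightarrow> Y i \<omega> = Y i \<omega>') \<Longrightarrow> \<omega> \<in> A \<longleftrightarrow> \<omega>' \<in> A) \<Longrightarrow>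
      (\<integral>\<^sup>+\<omega>. indicator A \<omega> * ennreal (Y (Suc n) \<omega>) \<partial>M) \<le> (\<integral>\<^sup>+\<omega>. indicator A \<omega> * ennreal (Y n \<omega>) \<partial>M)"
  shows "AE \<omega> in M. convergent (\<lambda>n. Y n \<omega>)"
proof -
  have finY: "(\<integral>\<^sup>+\<omega>. ennreal (Y n \<omega>) \<partial>M) \<le> (\<integral>\<^sup>+\<omega>. ennreal (Y 0 \<omega>) \<partial>M)" for n
  proof (induction n)
    case (Suc n)
    have "(\<integral>\<^sup>+\<omega>. ennreal (Y (Suc n) \<omega>) \<partial>M) \<le> (\<integral>\<^sup>+\<omega>. ennreal (Y n \<omega>) \<partial>M)"
    proof -
      have "(\<integral>\<^sup>+\<omega>. indicator (space M) \<omega> * f \<omega> \<partial>M) = (\<integral>\<^sup>+\<omega>. f \<omega> \<partial>M)" for f :: "'a \<Rightarrow> ennreal"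
        by (intro nn_integral_cong) simp
      with super[of "space M" n] show ?thesis by auto
    qed
    with Suc show ?case by simp
  qed simp
  have hold[measurable]: "Measurable.pred M (\<lambda>\<omega>. holding a b (\<lambda>n. Y n \<omega>) n)" for a b n
    by (induction n) simp_all
  have up[measurable]: "(\<lambda>\<omega>. upcrossings a b (\<lambda>n. Y n \<omega>) n) \<in> M \<rightarrow>\<^sub>M count_space UNIV" for a b n
    by (induction n) simp_all
  have hold_dep: "holding a b (\<lambda>n. Y n \<omega>) n = holding a b (\<lambda>n. Y n \<omega>') n"
    if "\<And>i. i \<le> n \<Longrightarrow> Y i \<omega> = Y i \<omega>'" for a b n \<omega> \<omega>'
    using that by (induction n) auto
  have bound: "(\<integral>\<^sup>+\<omega>. ennreal (upcrossings a b (\<lambda>n. Y n \<omega>) n) \<partial>M) \<le> ennreal (a / (b - a))"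
    if ab: "0 \<le> a" "a < b" for a b n
  proof -
    define h where "h j \<omega> = (of_bool (holding a b (\<lambda>n. Y n \<omega>) j) :: real)" for j \<omega>
    have [measurable]: "h j \<in> borel_measurable M" for j
      unfolding h_def by measurable
    have h01: "0 \<le> h j \<omega>" "h j \<omega> \<le> 1" for j \<omega> unfolding h_def by auto
    let ?U = "\<lambda>\<omega>. upcrossings a b (\<lambda>n. Y n \<omega>) n"
    have step: "(\<integral>\<^sup>+\<omega>. ennreal (h j \<omega> * Y (Suc j) \<omega>) \<partial>M) \<le> (\<integral>\<^sup>+\<omega>. ennreal (h j \<omega> * Y j \<omega>) \<partial>M)" for j
    proof -
      let ?A = "{\<omega>\<in>space M. holding a b (\<lambda>n. Y n \<omega>) j}"
      have *: "(\<integral>\<^sup>+\<omega>. ennreal (h j \<omega> * Z \<omega>) \<partial>M) = (\<integral>\<^sup>+\<omega>. indicator ?A \<omega> * ennreal (Z \<omega>) \<partial>M)" for Z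
        by (intro nn_integral_cong) (auto simp: h_def indicator_def)
      show ?thesis unfolding *
      proof (rule super)
        fix \<omega> \<omega>' assume "\<omega> \<in> space M" "\<omega>' \<in> space M" "\<And>i. i \<le> j \<Longrightarrow> Y i \<omega> = Y i \<omega>'"
        then show "\<omega> \<in> ?A \<longleftrightarrow> \<omega>' \<in> ?A" using hold_dep[of j \<omega> \<omega>' a b] by simp
      qed measurable
    qed
    have "(\<integral>\<^sup>+\<omega>. ennreal ((b - a) * ?U \<omega>) + (\<Sum>j<n. ennreal (h j \<omega> * Y j \<omega>)) \<partial>M)
        \<le> (\<integral>\<^sup>+\<omega>. ennreal a + (\<Sum>j<n. ennreal (h j \<omega> * Y (Suc j) \<omega>)) \<partial>M)"
    proof (rule nn_integral_mono)
      fix \<omega>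
      have "(b - a) * ?U \<omega> + h n \<omega> * (Y n \<omega> - a) \<le> (\<Sum>j<n. h j \<omega> * (Y (Suc j) \<omega> - Y j \<omega>))"
        using upcrossings_gain[of b a "\<lambda>n. Y n \<omega>" n] unfolding h_def by simp
      moreover have "h n \<omega> * (Y n \<omega> - a) \<ge> - a"
        using ab nonneg[of n \<omega>] by (auto simp: h_def)
      ultimately have "(b - a) * ?U \<omega> + (\<Sum>j<n. h j \<omega> * Y j \<omega>) \<le> a + (\<Sum>j<n. h j \<omega> * Y (Suc j) \<omega>)"
        by (simp add: algebra_simps sum_subtractf)
      then show "ennreal ((b - a) * ?U \<omega>) + (\<Sum>j<n. ennreal (h j \<omega> * Y j \<omega>))
          \<le> ennreal a + (\<Sum>j<n. ennreal (h j \<omega> * Y (Suc j) \<omega>))"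
        using ab nonneg h01 by (simp add: sum_nonneg flip: ennreal_plus)
    qed
    then have "(\<integral>\<^sup>+\<omega>. ennreal ((b - a) * ?U \<omega>) \<partial>M) + (\<Sum>j<n. \<integral>\<^sup>+\<omega>. ennreal (h j \<omega> * Y j \<omega>) \<partial>M)
        \<le> ennreal a + (\<Sum>j<n. \<integral>\<^sup>+\<omega>. ennreal (h j \<omega> * Y (Suc j) \<omega>) \<partial>M)"
      by (simp add: nn_integral_add nn_integral_sum emeasure_space_1)
    also have "\<dots> \<le> ennreal a + (\<Sum>j<n. \<integral>\<^sup>+\<omega>. ennreal (h j \<omega> * Y j \<omega>) \<partial>M)"
      by (intro add_left_mono sum_mono step)
    finally have 1: "(\<integral>\<^sup>+\<omega>. ennreal ((b - a) * ?U \<omega>) \<partial>M) + (\<Sum>j<n. \<integral>\<^sup>+\<omega>. ennreal (h j \<omega> * Y j \<omega>) \<partial>M)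
        \<le> ennreal a + (\<Sum>j<n. \<integral>\<^sup>+\<omega>. ennreal (h j \<omega> * Y j \<omega>) \<partial>M)" .
    have "(\<integral>\<^sup>+\<omega>. ennreal (h j \<omega> * Y j \<omega>) \<partial>M) < \<infinity>" for j
    proof -
      have "(\<integral>\<^sup>+\<omega>. ennreal (h j \<omega> * Y j \<omega>) \<partial>M) \<le> (\<integral>\<^sup>+\<omega>. ennreal (Y j \<omega>) \<partial>M)"
        by (intro nn_integral_mono ennreal_leI mult_left_le_one_le nonneg h01)
      also have "\<dots> < \<infinity>" using finY[of j] fin by simp
      finally show ?thesis .
    qed
    then have "(\<Sum>j<n. \<integral>\<^sup>+\<omega>. ennreal (h j \<omega> * Y j \<omega>) \<partial>M) \<noteq> \<top>"
      by (simp add: less_top)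
    with 1 have "(\<integral>\<^sup>+\<omega>. ennreal ((b - a) * ?U \<omega>) \<partial>M) \<le> ennreal a"
      by (simp add: ennreal_add_left_cancel_le add.commute)
    then have "ennreal (b - a) * (\<integral>\<^sup>+\<omega>. ennreal (?U \<omega>) \<partial>M) \<le> ennreal a"
      using ab by (simp add: ennreal_mult nn_integral_cmult)
    then have "ennreal (1 / (b - a)) * (ennreal (b - a) * (\<integral>\<^sup>+\<omega>. ennreal (?U \<omega>) \<partial>M)) \<le> ennreal (1 / (b - a)) * ennreal a"
      by (rule mult_left_mono) simp
    then show ?thesis
      using ab by (simp add: mult.assoc[symmetric] ennreal_mult[symmetric])
  qed
  have osc: "AE \<omega> in M. \<not> ((\<exists>\<^sub>F n in sequentially. ennreal (Y n \<omega>) < ennreal (real_of_rat a)) \<and>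
      (\<exists>\<^sub>F n in sequentially. ennreal (Y n \<omega>) > ennreal (real_of_rat b)))"
    if ab: "0 \<le> a" "a < b" for a b
  proof -
    let ?a = "real_of_rat a" and ?b = "real_of_rat b"
    let ?U = "\<lambda>n \<omega>. ennreal (upcrossings ?a ?b (\<lambda>n. Y n \<omega>) n)"
    have ab': "0 \<le> ?a" "?a < ?b" using ab by (simp_all add: of_rat_less)
    have "(\<integral>\<^sup>+\<omega>. (SUP n. ?U n \<omega>) \<partial>M) = (SUP n. \<integral>\<^sup>+\<omega>. ?U n \<omega> \<partial>M)"
      by (intro nn_integral_monotone_convergence_SUP)
        (auto simp: incseq_def le_fun_def intro!: ennreal_leI upcrossings_mono)
    also have "\<dots> \<le> ennreal (?a / (?b - ?a))"
      by (intro SUP_least bound ab')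
    finally have "AE \<omega> in M. (SUP n. ?U n \<omega>) \<noteq> \<infinity>"
      by (intro nn_integral_PInf_AE) (auto simp: top_unique)
    then show ?thesis
    proof eventually_elim
      case (elim \<omega>)
      show ?case
      proof
        assume *: "(\<exists>\<^sub>F n in sequentially. ennreal (Y n \<omega>) < ennreal ?a) \<and>
          (\<exists>\<^sub>F n in sequentially. ennreal (Y n \<omega>) > ennreal ?b)"
        have low: "\<exists>\<^sub>F n in sequentially. Y n \<omega> < ?a"
          using * nonneg by (auto simp: ennreal_less_iff)
        have "0 \<le> ?b" using ab' by linarith
        then have "\<exists>\<^sub>F n in sequentially. Y n \<omega> > ?b"
          using * by (auto simp: ennreal_less_iff)
        from upcrossings_unbounded[OF ab'(2) low this]
        have "\<exists>n. N \<le> upcrossings ?a ?b (\<lambda>n. Y n \<omega>) n" for N .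
        then have "of_nat N \<le> (SUP n. ?U n \<omega>)" for N
        proof -
          obtain n where "N \<le> upcrossings ?a ?b (\<lambda>n. Y n \<omega>) n"
            using \<open>\<And>N. \<exists>n. N \<le> upcrossings ?a ?b (\<lambda>n. Y n \<omega>) n\<close> by blast
          then have "of_nat N \<le> ?U n \<omega>" by (simp add: ennreal_of_nat_eq_real_of_nat)
          also have "\<dots> \<le> (SUP n. ?U n \<omega>)" by (rule SUP_upper) simp
          finally show ?thesis .
        qed
        then have "(SUP N. of_nat N :: ennreal) \<le> (SUP n. ?U n \<omega>)" by (intro SUP_least)
        then have "(SUP n. ?U n \<omega>) = \<infinity>"
          by (simp add: ennreal_SUP_of_nat_eq_top top_unique)
        with elim show False by simp
      qed
    qed
  qed
  have "(\<integral>\<^sup>+\<omega>. liminf (\<lambda>n. ennreal (Y n \<omega>)) \<partial>M) \<le> liminf (\<lambda>n. \<integral>\<^sup>+\<omega>. ennreal (Y n \<omega>) \<partial>M)"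
    by (intro nn_integral_liminf) auto
  also have "\<dots> \<le> limsup (\<lambda>n. \<integral>\<^sup>+\<omega>. ennreal (Y n \<omega>) \<partial>M)"
    by (rule Liminf_le_Limsup) simp
  also have "\<dots> \<le> (\<integral>\<^sup>+\<omega>. ennreal (Y 0 \<omega>) \<partial>M)"
    by (intro Limsup_bounded) (simp add: finY)
  finally have "AE \<omega> in M. liminf (\<lambda>n. ennreal (Y n \<omega>)) \<noteq> \<infinity>"
    using fin by (intro nn_integral_PInf_AE) (auto simp: top_unique)
  moreover have "AE \<omega> in M. \<forall>ab :: rat \<times> rat. 0 \<le> fst ab \<longrightarrow> fst ab < snd ab \<longrightarrow>
      \<not> ((\<exists>\<^sub>F n in sequentially. ennreal (Y n \<omega>) < ennreal (real_of_rat (fst ab))) \<and>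
      (\<exists>\<^sub>F n in sequentially. ennreal (Y n \<omega>) > ennreal (real_of_rat (snd ab))))"
    unfolding AE_all_countable using osc by auto
  ultimately show ?thesis
  proof eventually_elim
    case (elim \<omega>)
    have "(\<lambda>n. ennreal (Y n \<omega>)) \<longlonglongrightarrow> liminf (\<lambda>n. ennreal (Y n \<omega>))"
      using elim(2) by (intro ennreal_convergent_of_no_oscillation) auto
    moreover obtain l where "0 \<le> l" "liminf (\<lambda>n. ennreal (Y n \<omega>)) = ennreal l"
      using elim(1) by (cases "liminf (\<lambda>n. ennreal (Y n \<omega>))") auto
    ultimately have "(\<lambda>n. Y n \<omega>) \<longlonglongrightarrow> l"
      using nonneg by simp
    then show ?case by (rule convergentI)
  qed
qed

section \<open>The quenched Laplace transform of W\<close>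

lemma mean_ge_1:
  assumes "pmf (p x) 0 = 0" "integrable (measure_pmf (p x)) real"
  shows "1 \<le> mean p x"
proof -
  have "(\<integral>j. 1 \<partial>measure_pmf (p x)) \<le> (\<integral>j. real j \<partial>measure_pmf (p x))"
  proof (rule integral_mono_AE)
    show "AE j in measure_pmf (p x). 1 \<le> real j"
      using assms(1) by (intro AE_pmfI) (metis One_nat_def Suc_leI gr0I of_nat_1 of_nat_mono set_pmf_iff)
  qed (use assms in auto)
  then show ?thesis by (simp add: mean_def)
qed

locale good_env =
  fixes p :: "'e \<Rightarrow> nat pmf" and \<xi> :: "nat \<Rightarrow> 'e"
  assumes pmf_0: "pmf (p (\<xi> i)) 0 = 0" and mean_fin: "integrable (measure_pmf (p (\<xi> i))) real"
begin

lemma mean_pos: "1 \<le> mean p (\<xi> i)"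
  using mean_ge_1 pmf_0 mean_fin .

lemma Pin_pos: "0 < Pin p \<xi> n"
  unfolding Pin_def using mean_pos by (intro prod_pos) (metis less_le_trans zero_less_one)

lemma AE_convergent_W: "AE \<omega> in qlaw p \<xi>. convergent (\<lambda>n. real (Zpr k \<omega> n) / Pin p \<xi> n)"
proof -
  interpret prob_space "qlaw p \<xi>" by (rule prob_space_qlaw)
  let ?Y = "\<lambda>n \<omega>. real (Zpr k \<omega> n) / Pin p \<xi> n"
  show ?thesis
  proof (rule nonneg_supermartingale_convergent)
    show "?Y n \<in> borel_measurable (qlaw p \<xi>)" for n by measurable
    show "0 \<le> ?Y n \<omega>" for n \<omega> using Pin_pos[of n] by simp
    show "(\<integral>\<^sup>+\<omega>. ennreal (?Y 0 \<omega>) \<partial>qlaw p \<xi>) < \<infinity>"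
      using emeasure_space_1 by (simp add: ennreal_mult_less_top Pin_def)
    fix n A
    assume A: "A \<in> sets (qlaw p \<xi>)"
      and dep: "\<And>\<omega> \<omega>'. \<omega> \<in> space (qlaw p \<xi>) \<Longrightarrow> \<omega>' \<in> space (qlaw p \<xi>) \<Longrightarrow>
        (\<And>i. i \<le> n \<Longrightarrow> ?Y i \<omega> = ?Y i \<omega>') \<Longrightarrow> \<omega> \<in> A \<longleftrightarrow> \<omega>' \<in> A"
    have A'[measurable]: "A \<in> sets offspring_space" using A sets_qlaw by blast
    have depA: "depends_on UNIV (rows_below n) (indicator A :: _ \<Rightarrow> ennreal)"
      unfolding depends_on_def
    proof (intro ballI impI)
      fix \<omega> \<omega>' :: "nat \<times> nat \<Rightarrow> nat" assume eq: "\<forall>i\<in>rows_below n. \<omega> i = \<omega>' i"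
      have "Zpr k \<omega> i = Zpr k \<omega>' i" if "i \<le> n" for i
        using depends_on_Zpr[of i k] eq that unfolding depends_on_def by auto
      then have "\<omega> \<in> A \<longleftrightarrow> \<omega>' \<in> A" by (intro dep) auto
      then show "indicator A \<omega> = (indicator A \<omega>' :: ennreal)" by (auto simp: indicator_def)
    qed
    have div: "(\<integral>\<^sup>+\<omega>. indicator A \<omega> * ennreal (?Y m \<omega>) \<partial>qlaw p \<xi>) =
        ennreal (1 / Pin p \<xi> m) * (\<integral>\<^sup>+\<omega>. indicator A \<omega> * ennreal (real (Zpr k \<omega> m)) \<partial>qlaw p \<xi>)" for m
    proof -
      have "(\<integral>\<^sup>+\<omega>. indicator A \<omega> * ennreal (?Y m \<omega>) \<partial>qlaw p \<xi>) =
        (\<integral>\<^sup>+\<omega>. ennreal (1 / Pin p \<xi> m) * (indicator A \<omega> * ennreal (real (Zpr k \<omega> m))) \<partial>qlaw p \<xi>)"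
        using Pin_pos[of m] by (intro nn_integral_cong) (simp add: indicator_def ennreal_mult[symmetric])
      also have "\<dots> = ennreal (1 / Pin p \<xi> m) * (\<integral>\<^sup>+\<omega>. indicator A \<omega> * ennreal (real (Zpr k \<omega> m)) \<partial>qlaw p \<xi>)"
        by (rule nn_integral_cmult) measurable
      finally show ?thesis .
    qed
    have "ennreal (1 / Pin p \<xi> (Suc n)) * ennreal (mean p (\<xi> n)) = ennreal (1 / Pin p \<xi> n)"
      using Pin_pos[of n] mean_pos[of n] by (subst ennreal_mult[symmetric]) (auto simp: Pin_def)
    then show "(\<integral>\<^sup>+\<omega>. indicator A \<omega> * ennreal (?Y (Suc n) \<omega>) \<partial>qlaw p \<xi>)
        \<le> (\<integral>\<^sup>+\<omega>. indicator A \<omega> * ennreal (?Y n \<omega>) \<partial>qlaw p \<xi>)"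
      unfolding div using depA
      by (subst nn_integral_Zpr_martingale) (simp_all add: mean_fin mult.assoc[symmetric])
  qed
qed

end

definition phiN :: "('e \<Rightarrow> nat pmf) \<Rightarrow> (nat \<Rightarrow> 'e) \<Rightarrow> nat \<Rightarrow> nat \<Rightarrow> real \<Rightarrow> ennreal" where
  "phiN p \<xi> k n t = (\<integral>\<^sup>+\<omega>. ennreal (exp (- t * (real (Zpr k \<omega> n) / Pin p \<xi> n))) \<partial>qlaw p \<xi>)"

definition phiW :: "('e \<Rightarrow> nat pmf) \<Rightarrow> (nat \<Rightarrow> 'e) \<Rightarrow> nat \<Rightarrow> real \<Rightarrow> real" where
  "phiW p \<xi> k t = (\<integral>\<omega>. exp (- t * Wlim p \<xi> k \<omega>) \<partial>qlaw p \<xi>)"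

lemma phiN_eq_zlaw:
  "phiN p \<xi> k n t = (\<integral>\<^sup>+j. ennreal (exp (- t / Pin p \<xi> n)) ^ j \<partial>zlaw (\<lambda>i. p (\<xi> i)) n k)"
  unfolding phiN_def nn_integral_Zpr[where h="\<lambda>j. ennreal (exp (- t * (real j / Pin p \<xi> n)))"]
  by (simp add: ennreal_power exp_of_nat_mult[symmetric] algebra_simps)

lemma phiN_power: "phiN p \<xi> k n t = phiN p \<xi> 1 n t ^ k"
  unfolding phiN_eq_zlaw by (rule nn_integral_power_zlaw)

context good_env
begin

lemma phiN_le_Suc: "phiN p \<xi> k n t \<le> phiN p \<xi> k (Suc n) t"
proof -
  define m where "m = mean p (\<xi> n)"
  have m: "m > 0" "Pin p \<xi> (Suc n) = Pin p \<xi> n * m"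
    using mean_pos[of n] by (auto simp: m_def Pin_def)
  have "ennreal (exp (- (t / Pin p \<xi> n))) \<le> (\<integral>\<^sup>+j. ennreal (exp (- (t / Pin p \<xi> n) * real j / m)) \<partial>p (\<xi> n))"
    by (rule exp_mean_le_nn_integral) (use m mean_fin in \<open>auto simp: m_def mean_def\<close>)
  also have "\<dots> = (\<integral>\<^sup>+j. ennreal (exp (- t / Pin p \<xi> (Suc n))) ^ j \<partial>p (\<xi> n))"
    using m by (intro nn_integral_cong) (simp add: ennreal_power exp_of_nat_mult[symmetric] field_simps)
  finally have "phiN p \<xi> k n t \<le> (\<integral>\<^sup>+z. (\<integral>\<^sup>+j. ennreal (exp (- t / Pin p \<xi> (Suc n))) ^ j \<partial>p (\<xi> n)) ^ z
      \<partial>zlaw (\<lambda>i. p (\<xi> i)) n k)"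
    unfolding phiN_eq_zlaw by (intro nn_integral_mono power_mono) auto
  also have "\<dots> = phiN p \<xi> k (Suc n) t"
    unfolding phiN_eq_zlaw zlaw_Suc_last by (simp add: nn_integral_power_iid_sum)
  finally show ?thesis .
qed

lemma AE_tendsto_Wlim:
  "AE \<omega> in qlaw p \<xi>. (\<lambda>n. real (Zpr k \<omega> n) / Pin p \<xi> n) \<longlonglongrightarrow> Wlim p \<xi> k \<omega>"
  using AE_convergent_W[of k] by eventually_elim (simp add: Wlim_def convergent_LIMSEQ_iff)

lemma Wlim_measurable [measurable]: "Wlim p \<xi> k \<in> borel_measurable offspring_space"
  unfolding Wlim_def[abs_def] by measurable

lemma AE_Wlim_nonneg: "AE \<omega> in qlaw p \<xi>. 0 \<le> Wlim p \<xi> k \<omega>"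
  using AE_tendsto_Wlim[of k]
proof eventually_elim
  case (elim \<omega>)
  then show ?case
    by (rule LIMSEQ_le_const) (auto intro!: exI[of _ 0] divide_nonneg_nonneg less_imp_le[OF Pin_pos])
qed

lemma ennreal_phiW_eq: 
  assumes "0 \<le> t"
  shows "ennreal (phiW p \<xi> k t) = (\<integral>\<^sup>+\<omega>. ennreal (exp (- t * Wlim p \<xi> k \<omega>)) \<partial>qlaw p \<xi>)"
proof -
  interpret prob_space "qlaw p \<xi>" by (rule prob_space_qlaw)
  have "integrable (qlaw p \<xi>) (\<lambda>\<omega>. exp (- t * Wlim p \<xi> k \<omega>))"
  proof (rule integrable_const_bound[where B=1])
    show "AE \<omega> in qlaw p \<xi>. norm (exp (- t * Wlim p \<xi> k \<omega>)) \<le> 1"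
      using AE_Wlim_nonneg[of k] by eventually_elim (use assms in simp)
  qed measurable
  then show ?thesis
    unfolding phiW_def by (subst nn_integral_eq_integral) auto
qed

lemma phiN_tendsto_phiW:
  assumes "0 \<le> t"
  shows "(\<lambda>n. phiN p \<xi> k n t) \<longlonglongrightarrow> ennreal (phiW p \<xi> k t)"
proof -
  interpret prob_space "qlaw p \<xi>" by (rule prob_space_qlaw)
  show ?thesis
    unfolding ennreal_phiW_eq[OF assms] phiN_def
  proof (rule nn_integral_dominated_convergence[where w="\<lambda>_. 1"])
    show "AE \<omega> in qlaw p \<xi>. (\<lambda>n. ennreal (exp (- t * (real (Zpr k \<omega> n) / Pin p \<xi> n)))) \<longlonglongrightarrow>
        ennreal (exp (- t * Wlim p \<xi> k \<omega>))"
      using AE_tendsto_Wlim[of k]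
      by eventually_elim (intro tendsto_ennrealI tendsto_exp tendsto_mult tendsto_const)
    show "AE \<omega> in qlaw p \<xi>. ennreal (exp (- t * (real (Zpr k \<omega> n) / Pin p \<xi> n))) \<le> 1" for n
      using assms Pin_pos[of n] by (intro AE_I2) (simp add: zero_le_mult_iff)
  qed (auto simp: emeasure_space_1[simplified])
qed

lemma phiN_le_1: "0 \<le> t \<Longrightarrow> phiN p \<xi> k n t \<le> 1"
proof -
  assume "0 \<le> t"
  interpret prob_space "qlaw p \<xi>" by (rule prob_space_qlaw)
  have "phiN p \<xi> k n t \<le> (\<integral>\<^sup>+\<omega>. 1 \<partial>qlaw p \<xi>)"
    unfolding phiN_def using \<open>0 \<le> t\<close> Pin_pos[of n] by (intro nn_integral_mono) (simp add: zero_le_mult_iff)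
  then show ?thesis by (simp add: emeasure_space_1[simplified])
qed

lemma phiW_nonneg: "0 \<le> phiW p \<xi> k t"
  unfolding phiW_def by simp

lemma phiW_le_1: "0 \<le> t \<Longrightarrow> phiW p \<xi> k t \<le> 1"
  using LIMSEQ_le_const2[OF phiN_tendsto_phiW[of t k], of 1] phiN_le_1[of t k] by auto

lemma phiW_power:
  assumes "0 \<le> t"
  shows "phiW p \<xi> k t = phiW p \<xi> 1 t ^ k"
proof -
  have fin: "ennreal (enn2real (phiN p \<xi> 1 n t)) = phiN p \<xi> 1 n t" for n
    using phiN_le_1[OF assms, of 1 n] by (intro ennreal_enn2real) (metis ennreal_one_less_top le_less_trans)
  have eq: "phiN p \<xi> k n t = ennreal (enn2real (phiN p \<xi> 1 n t) ^ k)" for n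
    unfolding phiN_power[of p \<xi> k] ennreal_power[symmetric, OF enn2real_nonneg] fin ..
  have "(\<lambda>n. ennreal (enn2real (phiN p \<xi> 1 n t))) \<longlonglongrightarrow> ennreal (phiW p \<xi> 1 t)"
    unfolding fin by (rule phiN_tendsto_phiW[OF assms])
  then have "(\<lambda>n. enn2real (phiN p \<xi> 1 n t)) \<longlonglongrightarrow> phiW p \<xi> 1 t"
    by (simp add: phiW_nonneg)
  then have "(\<lambda>n. ennreal (enn2real (phiN p \<xi> 1 n t) ^ k)) \<longlonglongrightarrow> ennreal (phiW p \<xi> 1 t ^ k)"
    by (intro tendsto_ennrealI tendsto_power)
  then have "ennreal (phiW p \<xi> k t) = ennreal (phiW p \<xi> 1 t ^ k)"
    using phiN_tendsto_phiW[OF assms, of k] unfolding eq by (intro LIMSEQ_unique)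
  then show ?thesis by (simp add: phiW_nonneg)
qed

end

section \<open>The annealed Markov chain\<close>

lemma integral_measurable_subprob_algebra2:
  fixes f :: "'a \<Rightarrow> 'b \<Rightarrow> real"
  assumes f[measurable]: "(\<lambda>(x, y). f x y) \<in> borel_measurable (M \<Otimes>\<^sub>M N)"
  assumes L[measurable]: "L \<in> measurable M (subprob_algebra N)"
  shows "(\<lambda>x. \<integral>y. f x y \<partial>L x) \<in> borel_measurable M"
proof -
  note integral_measurable_subprob_algebra[measurable]
  note measurable_distr2[measurable]
  have "(\<lambda>x. integral\<^sup>L (distr (L x) (M \<Otimes>\<^sub>M N) (\<lambda>y. (x, y))) (\<lambda>(x, y). f x y)) \<in> borel_measurable M"
    by measurable
  then show ?thesis
  proof (rule measurable_cong[THEN iffD1, rotated])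
    fix x assume x: "x \<in> space M"
    have [measurable_cong]: "sets (L x) = sets N"
      using measurable_space[OF L x] by (auto simp: space_subprob_algebra)
    show "(\<integral>z. (case z of (x, y) \<Rightarrow> f x y) \<partial>distr (L x) (M \<Otimes>\<^sub>M N) (\<lambda>y. (x, y))) = (\<integral>y. f x y \<partial>L x)"
      using x by (subst integral_distr) auto
  qed
qed

lemma nn_integral_pmf_swap:
  fixes g :: "nat \<Rightarrow> 'a \<Rightarrow> ennreal"
  assumes [measurable]: "\<And>z. g z \<in> borel_measurable N"
  shows "(\<integral>\<^sup>+\<xi>. \<integral>\<^sup>+z. g z \<xi> \<partial>measure_pmf \<mu> \<partial>N) = (\<integral>\<^sup>+z. \<integral>\<^sup>+\<xi>. g z \<xi> \<partial>N \<partial>measure_pmf \<mu>)"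
  by (simp add: nn_integral_measure_pmf nn_integral_count_space_nat nn_integral_suminf nn_integral_cmult)

locale bpre = prob_space M for M :: "'e measure" +
  fixes p :: "'e \<Rightarrow> nat pmf"
  assumes pmf_measurable [measurable]: "\<And>i. (\<lambda>x. pmf (p x) i) \<in> borel_measurable M"
    and AE_pmf_0: "AE x in M. pmf (p x) 0 = 0"
    and AE_mean_fin: "AE x in M. integrable (measure_pmf (p x)) real"
begin

lemma prob_space_envP: "prob_space (envP M)"
  unfolding envP_def by (intro prob_space_PiM prob_space_axioms)

sublocale env: prob_space "envP M" by (rule prob_space_envP)

lemma envP_component [measurable]: "(\<lambda>\<xi>. \<xi> i) \<in> envP M \<rightarrow>\<^sub>M M"
  unfolding envP_def by measurable

lemma measure_pmf_measurable: "(\<lambda>x. measure_pmf (p x)) \<in> M \<rightarrow>\<^sub>M subprob_algebra (count_space UNIV)"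
proof (rule measurable_subprob_algebra)
  fix A :: "nat set"
  have "emeasure (measure_pmf (p x)) A = (\<Sum>j. ennreal (pmf (p x) j) * indicator A j)" for x
    by (simp add: nn_integral_count_space_nat[symmetric] nn_integral_measure_pmf[symmetric]
        flip: nn_integral_indicator)
  then show "(\<lambda>x. emeasure (measure_pmf (p x)) A) \<in> borel_measurable M" by simp
qed (auto intro: measure_pmf.subprob_space_axioms)

lemma qlaw_measurable: "qlaw p \<in> envP M \<rightarrow>\<^sub>M prob_algebra offspring_space"
proof (rule measurable_prob_algebra_generated[OF sets_PiM Int_stable_prod_algebra prod_algebra_sets_into_space])
  show "prob_space (qlaw p \<xi>)" for \<xi> by (rule prob_space_qlaw)
  show "sets (qlaw p \<xi>) = sets offspring_space" for \<xi> by (rule sets_qlaw)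
  fix A assume "A \<in> prod_algebra UNIV (\<lambda>_ :: nat \<times> nat. count_space (UNIV :: nat set))"
  then obtain J E where A: "A = prod_emb UNIV (\<lambda>_. count_space UNIV) J (Pi\<^sub>E J E)" "finite J"
    by (auto elim!: prod_algebraE)
  have "emeasure (qlaw p \<xi>) A = (\<Prod>i\<in>J. emeasure (measure_pmf (p (\<xi> (fst i)))) (E i))" for \<xi>
  proof -
    have "A = prod_emb UNIV (\<lambda>i. measure_pmf (p (\<xi> (fst i)))) J (Pi\<^sub>E J E)"
      unfolding A prod_emb_def by simp
    then show ?thesis
      unfolding qlaw_def
      using emeasure_PiM_emb[of UNIV "\<lambda>i. measure_pmf (p (\<xi> (fst i)))" J E] A(2)
      by (simp add: measure_pmf.prob_space_axioms)
  qed
  moreover have "(\<lambda>\<xi>. emeasure (measure_pmf (p (\<xi> (fst i)))) (E i)) \<in> borel_measurable (envP M)" for i :: "nat \<times> nat"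
    by (rule measurable_compose[OF measurable_compose[OF envP_component measure_pmf_measurable]])
      (rule measurable_emeasure_subprob_algebra, simp)
  ultimately show "(\<lambda>\<xi>. emeasure (qlaw p \<xi>) A) \<in> borel_measurable (envP M)" by simp
qed

lemma qlaw_subprob [measurable]: "qlaw p \<in> envP M \<rightarrow>\<^sub>M subprob_algebra offspring_space"
  using qlaw_measurable measurable_prob_algebraD by blast

lemma mean_measurable [measurable]: "mean p \<in> borel_measurable M"
  unfolding mean_def[abs_def]
  by (rule measurable_compose[OF measure_pmf_measurable]) (rule integral_measurable_subprob_algebra, simp)

lemma Pin_measurable [measurable]: "(\<lambda>\<xi>. Pin p \<xi> n) \<in> borel_measurable (envP M)"
  unfolding Pin_def by measurable

lemma Wlim_joint_measurable [measurable]: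
  "(\<lambda>z. Wlim p (fst z) k (snd z)) \<in> borel_measurable (envP M \<Otimes>\<^sub>M offspring_space)"
  unfolding Wlim_def by measurable

lemma phiN_measurable [measurable]:
  "(\<lambda>z. phiN p (fst z) k n (snd z)) \<in> borel_measurable (envP M \<Otimes>\<^sub>M borel)"
  unfolding phiN_def by (rule nn_integral_measurable_subprob_algebra2) measurable

lemma phiW_measurable [measurable]:
  "(\<lambda>z. phiW p (fst z) k (snd z)) \<in> borel_measurable (envP M \<Otimes>\<^sub>M borel)"
proof -
  have [measurable]: "(\<lambda>z. Wlim p (fst (fst z)) k (snd z)) \<in> borel_measurable ((envP M \<Otimes>\<^sub>M borel) \<Otimes>\<^sub>M offspring_space)"
  proof -
    have "(\<lambda>z. (fst (fst z), snd z)) \<in> (envP M \<Otimes>\<^sub>M borel) \<Otimes>\<^sub>M offspring_space \<rightarrow>\<^sub>M envP M \<Otimes>\<^sub>M offspring_space"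
      by measurable
    from measurable_compose[OF this Wlim_joint_measurable] show ?thesis by simp
  qed
  show ?thesis
    unfolding phiW_def by (rule integral_measurable_subprob_algebra2) measurable
qed

lemma AE_good_env: "AE \<xi> in envP M. good_env p \<xi>"
proof -
  have "AE \<xi> in envP M. pmf (p (\<xi> i)) 0 = 0 \<and> integrable (measure_pmf (p (\<xi> i))) real" for i
    unfolding envP_def using AE_pmf_0 AE_mean_fin
    by (intro AE_PiM_component[where P="\<lambda>x. pmf (p x) 0 = 0 \<and> integrable (measure_pmf (p x)) real"])
      (auto intro: prob_space_axioms)
  then have "AE \<xi> in envP M. \<forall>i. pmf (p (\<xi> i)) 0 = 0 \<and> integrable (measure_pmf (p (\<xi> i))) real"
    unfolding AE_all_countable by blast
  then show ?thesis
    by eventually_elim (simp add: good_env_def)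
qed

lemma AE_mean_ge_1: "AE x in M. 1 \<le> mean p x"
  using AE_pmf_0 AE_mean_fin by eventually_elim (rule mean_ge_1)

lemma nn_integral_envP_Suc:
  assumes f: "f \<in> borel_measurable (envP M)"
  shows "(\<integral>\<^sup>+\<xi>. f \<xi> \<partial>envP M) = (\<integral>\<^sup>+x. \<integral>\<^sup>+\<xi>. f (case_nat x \<xi>) \<partial>envP M \<partial>M)"
proof -
  interpret S: sequence_space M ..
  have [measurable]: "f \<in> borel_measurable (PiM UNIV (\<lambda>_. M))" using f by (simp add: envP_def)
  have eq: "(\<lambda>(s, \<omega>). case_nat s \<omega>) \<in> M \<Otimes>\<^sub>M envP M \<rightarrow>\<^sub>M PiM UNIV (\<lambda>_. M)"
    unfolding envP_def
  proof (rule measurable_PiM_single')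
    show "(\<lambda>\<omega>. (case \<omega> of (x, xa) \<Rightarrow> case_nat x xa) i) \<in> M \<Otimes>\<^sub>M PiM UNIV (\<lambda>_. M) \<rightarrow>\<^sub>M M" for i :: nat
      by (cases i) (auto simp: case_prod_unfold)
  qed (auto simp: space_pair_measure space_PiM PiE_iff split: nat.split)
  have "(\<integral>\<^sup>+\<xi>. f \<xi> \<partial>envP M) = (\<integral>\<^sup>+\<xi>. f \<xi> \<partial>distr (M \<Otimes>\<^sub>M envP M) (PiM UNIV (\<lambda>_. M)) (\<lambda>(s, \<omega>). case_nat s \<omega>))"
    unfolding envP_def S.PiM_iter ..
  also have "\<dots> = (\<integral>\<^sup>+z. f (case_nat (fst z) (snd z)) \<partial>(M \<Otimes>\<^sub>M envP M))"
    using eq by (subst nn_integral_distr) (auto simp: case_prod_unfold)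
  also have "\<dots> = (\<integral>\<^sup>+x. \<integral>\<^sup>+\<xi>. f (case_nat x \<xi>) \<partial>envP M \<partial>M)"
    using measurable_compose[OF eq, of f borel]
    by (subst env.nn_integral_fst[symmetric]) (auto simp: case_prod_unfold)
  finally show ?thesis .
qed

lemma nn_integral_zlaw_measurable [measurable]:
  fixes h :: "nat \<Rightarrow> ennreal"
  shows "(\<lambda>\<xi>. \<integral>\<^sup>+j. h j \<partial>zlaw (\<lambda>i. p (\<xi> i)) n k) \<in> borel_measurable (envP M)"
  unfolding nn_integral_Zpr[symmetric]
  by (rule measurable_compose[OF qlaw_subprob]) (rule nn_integral_measurable_subprob_algebra, measurable)

lemma nn_integral_iid_sum_measurable [measurable]:
  fixes h :: "nat \<Rightarrow> ennreal"
  shows "(\<lambda>x. \<integral>\<^sup>+j. h j \<partial>iid_sum (p x) z) \<in> borel_measurable M"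
proof -
  have "(\<lambda>x _. x) \<in> M \<rightarrow>\<^sub>M envP M"
    unfolding envP_def by (rule measurable_PiM_single') (auto simp: space_PiM)
  from measurable_compose[OF this nn_integral_zlaw_measurable[where h=h and n="Suc 0" and k=z]]
  show ?thesis by simp
qed

definition akern :: "nat \<Rightarrow> nat pmf" where
  "akern z = embed_pmf (\<lambda>j. \<integral>x. pmf (iid_sum (p x) z) j \<partial>M)"

lemma pmf_iid_sum_measurable [measurable]: "(\<lambda>x. pmf (iid_sum (p x) z) j) \<in> borel_measurable M"
proof -
  have "(\<lambda>x. pmf (iid_sum (p x) z) j) = (\<lambda>x. enn2real (\<integral>\<^sup>+i. indicator {j} i \<partial>iid_sum (p x) z))"
    by (simp add: emeasure_pmf_single)
  also have "\<dots> \<in> borel_measurable M"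
    by (intro borel_measurable_enn2real nn_integral_iid_sum_measurable)
  finally show ?thesis .
qed

lemma pmf_akern: "ennreal (pmf (akern z) j) = (\<integral>\<^sup>+x. ennreal (pmf (iid_sum (p x) z) j) \<partial>M)"
  and pmf_akern_real: "pmf (akern z) j = (\<integral>x. pmf (iid_sum (p x) z) j \<partial>M)"
proof -
  have *: "ennreal (\<integral>x. pmf (iid_sum (p x) z) j \<partial>M) = (\<integral>\<^sup>+x. ennreal (pmf (iid_sum (p x) z) j) \<partial>M)" for j
    by (rule nn_integral_eq_integral[symmetric])
      (auto intro!: integrable_const_bound[where B=1] simp: pmf_le_1)
  have "(\<integral>\<^sup>+j. ennreal (\<integral>x. pmf (iid_sum (p x) z) j \<partial>M) \<partial>count_space UNIV) =
      (\<integral>\<^sup>+x. \<integral>\<^sup>+j. ennreal (pmf (iid_sum (p x) z) j) \<partial>count_space UNIV \<partial>M)"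
    unfolding * by (simp add: nn_integral_count_space_nat nn_integral_suminf)
  also have "\<dots> = 1"
    by (simp add: nn_integral_pmf emeasure_space_1 measure_pmf.emeasure_space_1[simplified])
  finally show real: "pmf (akern z) j = (\<integral>x. pmf (iid_sum (p x) z) j \<partial>M)"
    unfolding akern_def by (intro pmf_embed_pmf) auto
  then show "ennreal (pmf (akern z) j) = (\<integral>\<^sup>+x. ennreal (pmf (iid_sum (p x) z) j) \<partial>M)"
    using * by simp
qed

lemma nn_integral_akern:
  fixes h :: "nat \<Rightarrow> ennreal"
  shows "(\<integral>\<^sup>+j. h j \<partial>akern z) = (\<integral>\<^sup>+x. \<integral>\<^sup>+j. h j \<partial>iid_sum (p x) z \<partial>M)"
  by (simp add: nn_integral_measure_pmf nn_integral_count_space_nat pmf_akern nn_integral_multc[symmetric]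
      nn_integral_suminf)

primrec alaw :: "nat \<Rightarrow> nat \<Rightarrow> nat pmf" where
  "alaw 0 k = return_pmf k"
| "alaw (Suc n) k = bind_pmf (akern k) (alaw n)"

lemma alaw_Suc_last: "alaw (Suc n) k = bind_pmf (alaw n k) akern"
proof (induction n arbitrary: k)
  case 0
  have "alaw 0 = return_pmf" by (simp add: fun_eq_iff)
  then show ?case by (simp add: bind_return_pmf' bind_return_pmf)
next
  case (Suc n)
  have "alaw (Suc n) = (\<lambda>j. bind_pmf (alaw n j) akern)"
    using Suc.IH by (simp add: fun_eq_iff)
  then have "alaw (Suc (Suc n)) k = bind_pmf (akern k) (\<lambda>j. bind_pmf (alaw n j) akern)"
    using alaw.simps(2)[of "Suc n" k] by simp
  then show ?case by (simp add: bind_assoc_pmf)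
qed

lemma nn_integral_zlaw_envP:
  fixes h :: "nat \<Rightarrow> ennreal"
  shows "(\<integral>\<^sup>+\<xi>. \<integral>\<^sup>+j. h j \<partial>zlaw (\<lambda>i. p (\<xi> i)) n k \<partial>envP M) = (\<integral>\<^sup>+j. h j \<partial>alaw n k)"
proof (induction n arbitrary: k)
  case 0
  then show ?case by (simp add: env.emeasure_space_1)
next
  case (Suc n)
  have "(\<integral>\<^sup>+\<xi>. \<integral>\<^sup>+j. h j \<partial>zlaw (\<lambda>i. p (\<xi> i)) (Suc n) k \<partial>envP M) =
    (\<integral>\<^sup>+x. \<integral>\<^sup>+\<xi>. \<integral>\<^sup>+z. \<integral>\<^sup>+j. h j \<partial>zlaw (\<lambda>i. p (\<xi> i)) n z \<partial>iid_sum (p x) k \<partial>envP M \<partial>M)"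
    by (subst nn_integral_envP_Suc[OF nn_integral_zlaw_measurable]) simp
  also have "\<dots> = (\<integral>\<^sup>+x. \<integral>\<^sup>+z. \<integral>\<^sup>+\<xi>. \<integral>\<^sup>+j. h j \<partial>zlaw (\<lambda>i. p (\<xi> i)) n z \<partial>envP M \<partial>iid_sum (p x) k \<partial>M)"
    by (simp add: nn_integral_pmf_swap)
  also have "\<dots> = (\<integral>\<^sup>+j. h j \<partial>alaw (Suc n) k)"
    by (simp add: Suc.IH nn_integral_akern)
  finally show ?case .
qed

end

section \<open>One-step harmonic moments\<close>

lemma one_minus_powr_le:
  fixes q r :: real
  assumes "0 < q" "q \<le> 1" "0 < r"
  shows "1 - q powr r \<le> of_int \<lceil>r\<rceil> * (1 - q)"
proof -
  have n: "real (nat \<lceil>r\<rceil>) = of_int \<lceil>r\<rceil>" using assms by simp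
  have "1 + real (nat \<lceil>r\<rceil>) * (q - 1) \<le> (1 + (q - 1)) ^ nat \<lceil>r\<rceil>"
    by (rule Bernoulli_inequality) (use assms in auto)
  also have "\<dots> = q powr real (nat \<lceil>r\<rceil>)"
    using powr_realpow[OF assms(1), of "nat \<lceil>r\<rceil>"] by simp
  also have "\<dots> \<le> q powr r"
    using assms unfolding n by (intro powr_mono') auto
  finally show ?thesis unfolding n by (simp add: algebra_simps)
qed

lemma powr_minus_le_linear:
  fixes X m r :: real
  assumes "1 \<le> X" "1 \<le> m" "0 < r"
  shows "X powr (- r) \<le> m powr (- r) + of_int \<lceil>r\<rceil> * max 0 (1 - X / m)"
proof (cases "m \<le> X")
  case True
  then have "X powr (- r) \<le> m powr (- r)"
    using assms by (intro powr_mono2') auto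
  moreover have "0 \<le> of_int \<lceil>r\<rceil> * max 0 (1 - X / m)"
    using assms by (intro mult_nonneg_nonneg) auto
  ultimately show ?thesis by simp
next
  case False
  have "X powr (- r) - m powr (- r) = X powr (- r) * (1 - (X / m) powr r)"
    using assms by (simp add: powr_divide powr_minus field_simps)
  also have "\<dots> \<le> 1 * (1 - (X / m) powr r)"
  proof (rule mult_right_mono)
    show "X powr (- r) \<le> 1"
      using assms powr_mono2'[of "-r" 1 X] by simp
    show "0 \<le> 1 - (X / m) powr r"
      using assms False by (simp add: powr_le1)
  qed
  also have "\<dots> \<le> of_int \<lceil>r\<rceil> * (1 - X / m)"
    using assms False one_minus_powr_le[of "X / m" r] by simp
  also have "\<dots> = of_int \<lceil>r\<rceil> * max 0 (1 - X / m)"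
    using assms False by simp
  finally show ?thesis by simp
qed

lemma finite_set_iid_sum: "finite (set_pmf q) \<Longrightarrow> finite (set_pmf (iid_sum q z))"
  by (induction z) auto

lemma expectation_iid_sum:
  assumes "finite (set_pmf q)"
  shows "(\<integral>j. real j \<partial>iid_sum q z) = real z * (\<integral>j. real j \<partial>q)"
proof -
  have eq: "(\<integral>\<^sup>+j. ennreal (real j) \<partial>\<mu>) = ennreal (\<integral>j. real j \<partial>measure_pmf \<mu>)" if "finite (set_pmf \<mu>)" for \<mu> :: "nat pmf"
    by (intro nn_integral_eq_integral integrable_measure_pmf_finite that) auto
  have "ennreal (\<integral>j. real j \<partial>iid_sum q z) = ennreal (real z * (\<integral>j. real j \<partial>q))"
    using nn_integral_iid_sum_mean[of q z] unfolding eq[OF assms] eq[OF finite_set_iid_sum[OF assms]]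
    by (simp add: ennreal_mult ennreal_of_nat_eq_real_of_nat)
  then show ?thesis by simp
qed

lemma variance_iid_sum:
  assumes fin: "finite (set_pmf q)" and \<mu>: "\<mu> = (\<integral>j. real j \<partial>q)"
  shows "(\<integral>\<^sup>+j. ennreal ((real j - real z * \<mu>)\<^sup>2) \<partial>iid_sum q z) = ennreal (real z * (\<integral>j. (real j - \<mu>)\<^sup>2 \<partial>q))"
proof (induction z)
  case (Suc z)
  let ?V = "\<integral>j. (real j - \<mu>)\<^sup>2 \<partial>q"
  have int: "integrable (measure_pmf q) f" "integrable (measure_pmf (iid_sum q z)) f" for f :: "nat \<Rightarrow> real"
    by (intro integrable_measure_pmf_finite finite_set_iid_sum fin)+
  have IH: "(\<integral>j. (real j - real z * \<mu>)\<^sup>2 \<partial>iid_sum q z) = real z * ?V"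
    using Suc nn_integral_eq_integral[OF int(2), of "\<lambda>j. (real j - real z * \<mu>)\<^sup>2"] by simp
  have mean0: "(\<integral>j. real j - real z * \<mu> \<partial>iid_sum q z) = 0"
    using int(2)[of real] by (simp add: expectation_iid_sum[OF fin] \<mu>)
  have inner: "(\<integral>\<^sup>+j. ennreal ((real (a + j) - real (Suc z) * \<mu>)\<^sup>2) \<partial>iid_sum q z) = ennreal ((real a - \<mu>)\<^sup>2 + real z * ?V)" for a
  proof -
    let ?f = "\<lambda>j. (real a - \<mu>)\<^sup>2 + (2 * (real a - \<mu>) * (real j - real z * \<mu>) + (real j - real z * \<mu>)\<^sup>2)"
    have f: "(\<lambda>j. ennreal ((real (a + j) - real (Suc z) * \<mu>)\<^sup>2)) = (\<lambda>j. ennreal (?f j))"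
      by (auto simp: fun_eq_iff power2_eq_square algebra_simps)
    have pos: "0 \<le> ?f j" for j
    proof -
      have "?f j = (real (a + j) - real (Suc z) * \<mu>)\<^sup>2"
        by (simp add: power2_eq_square algebra_simps)
      then show ?thesis by simp
    qed
    have "(\<integral>\<^sup>+j. ennreal (?f j) \<partial>iid_sum q z) = ennreal (\<integral>j. ?f j \<partial>iid_sum q z)"
      by (intro nn_integral_eq_integral int AE_I2 pos)
    also have "(\<integral>j. ?f j \<partial>iid_sum q z) = (real a - \<mu>)\<^sup>2 + (2 * (real a - \<mu>) * (\<integral>j. real j - real z * \<mu> \<partial>iid_sum q z)
          + (\<integral>j. (real j - real z * \<mu>)\<^sup>2 \<partial>iid_sum q z))"
      by (subst Bochner_Integration.integral_add, (intro int)+)+ (simp add: int)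
    finally show ?thesis unfolding f IH mean0 by simp
  qed
  have "(\<integral>\<^sup>+j. ennreal ((real j - real (Suc z) * \<mu>)\<^sup>2) \<partial>iid_sum q (Suc z)) =
      (\<integral>\<^sup>+a. ennreal ((real a - \<mu>)\<^sup>2 + real z * ?V) \<partial>q)"
    using inner by simp
  also have "\<dots> = ennreal (\<integral>a. (real a - \<mu>)\<^sup>2 + real z * ?V \<partial>q)"
    by (intro nn_integral_eq_integral int) auto
  also have "(\<integral>a. (real a - \<mu>)\<^sup>2 + real z * ?V \<partial>q) = real (Suc z) * ?V"
    by (simp add: int algebra_simps)
  finally show ?case .
qed simp

text \<open>Truncation at \<open>y\<close> followed by Chebyshev; the square root is avoided by
  \<open>2 \<bar>a\<bar> \<le> l a\<^sup>2 + 1 / l\<close>.\<close>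

lemma deficit_iid_sum:
  fixes y l :: real
  assumes q: "integrable (measure_pmf q) real" and m: "m = (\<integral>j. real j \<partial>q)" "1 \<le> m"
    and z: "1 \<le> z" and y: "0 \<le> y" and l: "0 < l"
  shows "(\<integral>\<^sup>+j. ennreal (max 0 (1 - real j / (real z * m))) \<partial>iid_sum q z) \<le>
    (\<integral>\<^sup>+j. ennreal (real j / m) * indicator {j. y < real j} j \<partial>q) + ennreal ((l * y / real z + 1 / l) / 2)"
proof -
  define tr where "tr j = (if real j \<le> y then j else 0)" for j :: nat
  define q' where "q' = map_pmf tr q"
  define \<mu> where "\<mu> = (\<integral>j. real j \<partial>q')"
  define V where "V = (\<integral>j. (real j - \<mu>)\<^sup>2 \<partial>q')"
  have le_y: "real j \<le> y" if "j \<in> set_pmf q'" for j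
    using that y by (auto simp: q'_def tr_def)
  then have "set_pmf q' \<subseteq> {..nat \<lfloor>y\<rfloor>}" by (auto simp: le_nat_floor)
  then have fin: "finite (set_pmf q')" by (rule finite_subset) simp
  note int = integrable_measure_pmf_finite[OF fin]
  have int_tr: "integrable (measure_pmf q) (\<lambda>j. real (tr j))"
    using int[of real] unfolding q'_def by (simp add: integrable_map_pmf_eq)
  have \<mu>_eq: "\<mu> = (\<integral>j. real (tr j) \<partial>q)" unfolding \<mu>_def q'_def by simp
  have \<mu>_le: "\<mu> \<le> m"
    unfolding \<mu>_eq m by (intro integral_mono int_tr q) (auto simp: tr_def)
  have \<mu>_nonneg: "0 \<le> \<mu>" unfolding \<mu>_def by simp
  have "V = (\<integral>j. (real j)\<^sup>2 - 2 * \<mu> * real j + \<mu>\<^sup>2 \<partial>q')"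
    unfolding V_def by (intro Bochner_Integration.integral_cong) (auto simp: power2_eq_square algebra_simps)
  also have "\<dots> = (\<integral>j. (real j)\<^sup>2 \<partial>q') - \<mu>\<^sup>2"
    by (simp add: int \<mu>_def[symmetric] power2_eq_square)
  also have "\<dots> \<le> (\<integral>j. (real j)\<^sup>2 \<partial>q')" by simp
  also have "\<dots> \<le> (\<integral>j. y * real j \<partial>q')"
  proof (intro integral_mono_AE int AE_pmfI)
    fix j assume "j \<in> set_pmf q'"
    from le_y[OF this] show "(real j)\<^sup>2 \<le> y * real j"
      by (simp add: power2_eq_square mult_right_mono)
  qed
  also have "\<dots> = y * \<mu>" by (simp add: \<mu>_def)
  also have "\<dots> \<le> y * m" using y \<mu>_le by (rule mult_left_mono[rotated])
  finally have V: "V \<le> y * m" .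
  have V0: "0 \<le> V" unfolding V_def by simp
  have tail: "(\<integral>\<^sup>+j. ennreal (real j / m) * indicator {j. y < real j} j \<partial>q) = ennreal (1 - \<mu> / m)"
  proof -
    have "(\<integral>\<^sup>+j. ennreal (real j / m) * indicator {j. y < real j} j \<partial>q) =
        (\<integral>\<^sup>+j. ennreal ((real j - real (tr j)) / m) \<partial>q)"
      by (intro nn_integral_cong) (auto simp: tr_def indicator_def)
    also have "\<dots> = ennreal (\<integral>j. (real j - real (tr j)) / m \<partial>q)"
      using m q int_tr by (intro nn_integral_eq_integral) (auto simp: tr_def)
    also have "(\<integral>j. (real j - real (tr j)) / m \<partial>q) = 1 - \<mu> / m"
      using m q int_tr by (simp add: \<mu>_eq diff_divide_distrib)
    finally show ?thesis .
  qed
  let ?b = "1 - \<mu> / m + 1 / (2 * l)" and ?d = "l / (2 * (real z * m)\<^sup>2)"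
  have pos: "0 < real z * m" using z m by simp
  have ptw: "max 0 (1 - real j / (real z * m)) \<le> ?b + ?d * (real j - real z * \<mu>)\<^sup>2" for j
  proof -
    define a where "a = (real j - real z * \<mu>) / (real z * m)"
    have "1 - real j / (real z * m) = 1 - \<mu> / m - a"
      using m z by (simp add: a_def field_simps)
    moreover have "- a \<le> 1 / (2 * l) + l * a\<^sup>2 / 2"
    proof -
      have "0 \<le> (l * a + 1)\<^sup>2 / (2 * l)" using l by simp
      also have "\<dots> = 1 / (2 * l) + l * a\<^sup>2 / 2 + a"
        using l by (simp add: power2_eq_square field_simps)
      finally show ?thesis by simp
    qed
    moreover have "l * a\<^sup>2 / 2 = ?d * (real j - real z * \<mu>)\<^sup>2"
      by (simp add: a_def power_divide)
    moreover have "0 \<le> ?b + ?d * (real j - real z * \<mu>)\<^sup>2"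
      using \<mu>_le m l by (auto intro!: add_nonneg_nonneg)
    ultimately show ?thesis by simp
  qed
  have b0: "0 \<le> ?b" using \<mu>_le m l by (auto intro!: add_nonneg_nonneg)
  have "(\<integral>\<^sup>+j. ennreal (max 0 (1 - real j / (real z * m))) \<partial>iid_sum q z) \<le>
      (\<integral>\<^sup>+j. ennreal (max 0 (1 - real j / (real z * m))) \<partial>iid_sum q' z)"
    unfolding q'_def using pos
    by (intro nn_integral_iid_sum_mono)
      (auto simp: tr_def antimono_def divide_right_mono intro!: ennreal_leI max.mono)
  also have "\<dots> \<le> (\<integral>\<^sup>+j. ennreal ?b + ennreal ?d * ennreal ((real j - real z * \<mu>)\<^sup>2) \<partial>iid_sum q' z)"
    using ptw b0 l by (intro nn_integral_mono) (auto simp flip: ennreal_plus ennreal_mult intro!: ennreal_leI)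
  also have "\<dots> = ennreal ?b + ennreal ?d * ennreal (real z * V)"
    unfolding V_def variance_iid_sum[OF fin \<mu>_def, symmetric]
    by (simp add: nn_integral_add nn_integral_cmult measure_pmf.emeasure_space_1[simplified])
  also have "\<dots> = ennreal (?b + ?d * (real z * V))"
    using b0 l V0 by (simp flip: ennreal_plus ennreal_mult)
  also have "\<dots> \<le> ennreal ((1 - \<mu> / m) + (l * y / real z + 1 / l) / 2)"
  proof (rule ennreal_leI)
    have "?d * (real z * V) \<le> ?d * (real z * (y * m))"
      using V l by (intro mult_left_mono) auto
    also have "\<dots> = l * y / (2 * real z) * (1 / m)"
      using pos z by (simp add: power2_eq_square field_simps)
    also have "\<dots> \<le> l * y / (2 * real z) * 1"
      using m l y z by (intro mult_left_mono) auto
    finally show "?b + ?d * (real z * V) \<le> (1 - \<mu> / m) + (l * y / real z + 1 / l) / 2"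
      by (simp add: add_divide_distrib)
  qed
  also have "\<dots> = ennreal (1 - \<mu> / m) + ennreal ((l * y / real z + 1 / l) / 2)"
    using \<mu>_le m l y by (intro ennreal_plus) auto
  finally show ?thesis unfolding tail .
qed

lemma harmonic_moment_iid_sum:
  fixes r :: real
  assumes q0: "pmf q 0 = 0" and q: "integrable (measure_pmf q) real" and m: "m = (\<integral>j. real j \<partial>q)" "1 \<le> m"
    and z: "1 \<le> z" and r: "0 < r"
  shows "(\<integral>\<^sup>+j. ennreal (real j powr (- r)) \<partial>iid_sum q z) \<le>
    ennreal (real z powr (- r)) * (ennreal (m powr (- r)) + ennreal (of_int \<lceil>r\<rceil>) *
      ((\<integral>\<^sup>+j. ennreal (real j / m) * indicator {j. sqrt (real z) < real j} j \<partial>q) + ennreal (real z powr (- 1/4))))"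
proof -
  have c: "0 \<le> (of_int \<lceil>r\<rceil> :: real)" using r by simp
  have "(\<integral>\<^sup>+j. ennreal (real j powr (- r)) \<partial>iid_sum q z) \<le>
      (\<integral>\<^sup>+j. ennreal (real z powr (- r)) * (ennreal (m powr (- r)) + ennreal (of_int \<lceil>r\<rceil>) *
        ennreal (max 0 (1 - real j / (real z * m)))) \<partial>iid_sum q z)"
  proof (intro nn_integral_mono_AE AE_pmfI)
    fix j assume "j \<in> set_pmf (iid_sum q z)"
    then have j: "z \<le> j" using set_iid_sum_ge[of q j z] q0 by (simp add: set_pmf_iff)
    have "real j powr (- r) = real z powr (- r) * (real j / real z) powr (- r)"
      using z j by (simp add: powr_divide)
    also have "\<dots> \<le> real z powr (- r) * (m powr (- r) + of_int \<lceil>r\<rceil> * max 0 (1 - (real j / real z) / m))"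
      using z j m r by (intro mult_left_mono powr_minus_le_linear) auto
    finally have "ennreal (real j powr (- r)) \<le> ennreal (real z powr (- r) * (m powr (- r) + of_int \<lceil>r\<rceil> * max 0 (1 - real j / (real z * m))))"
      by (simp add: ennreal_leI)
    also have "\<dots> = ennreal (real z powr (- r)) * (ennreal (m powr (- r)) + ennreal (of_int \<lceil>r\<rceil>) *
        ennreal (max 0 (1 - real j / (real z * m))))"
      using c by (subst ennreal_mult, simp, simp, subst ennreal_plus, simp, simp, subst ennreal_mult) simp_all
    finally show "ennreal (real j powr (- r)) \<le> \<dots>" .
  qed
  also have "\<dots> = ennreal (real z powr (- r)) * (ennreal (m powr (- r)) + ennreal (of_int \<lceil>r\<rceil>) *
        (\<integral>\<^sup>+j. ennreal (max 0 (1 - real j / (real z * m))) \<partial>iid_sum q z))"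
    by (simp add: nn_integral_add nn_integral_cmult measure_pmf.emeasure_space_1[simplified])
  also have "(\<integral>\<^sup>+j. ennreal (max 0 (1 - real j / (real z * m))) \<partial>iid_sum q z) \<le>
    (\<integral>\<^sup>+j. ennreal (real j / m) * indicator {j. sqrt (real z) < real j} j \<partial>q)
      + ennreal ((real z powr (1/4) * sqrt (real z) / real z + 1 / real z powr (1/4)) / 2)"
    by (rule deficit_iid_sum[OF q m z]) (use z in auto)
  also have "(real z powr (1/4) * sqrt (real z) / real z + 1 / real z powr (1/4)) / 2 = real z powr (- 1/4)"
  proof -
    have "real z powr (1/4 + 1/2 - 1) = real z powr (1/4) * real z powr (1/2) / real z powr 1"
      unfolding powr_diff powr_add ..
    then have "real z powr (1/4) * sqrt (real z) / real z = real z powr (1/4 + 1/2 - 1)"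
      using z by (simp add: powr_half_sqrt)
    moreover have "1 / real z powr (1/4) = real z powr (- 1/4)"
      by (simp add: powr_minus_divide)
    ultimately show ?thesis by simp
  qed
  finally show ?thesis by (simp add: mult_left_mono add_left_mono)
qed

context bpre
begin

definition size_tail :: "real \<Rightarrow> ennreal" where
  "size_tail y = (\<integral>\<^sup>+x. \<integral>\<^sup>+j. ennreal (real j / mean p x) * indicator {j. y < real j} j \<partial>p x \<partial>M)"

lemma nn_integral_pmf_measurable:
  assumes "(\<lambda>z. f (fst z) (snd z)) \<in> borel_measurable (M \<Otimes>\<^sub>M count_space UNIV)"
  shows "(\<lambda>x. \<integral>\<^sup>+j. f x j \<partial>p x) \<in> borel_measurable M"
  using assms by (intro nn_integral_measurable_subprob_algebra2[OF _ measure_pmf_measurable])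
    (simp add: case_prod_unfold)

lemma size_tail_measurable [measurable]:
  "(\<lambda>x. \<integral>\<^sup>+j. ennreal (real j / mean p x) * indicator {j. y < real j} j \<partial>p x) \<in> borel_measurable M"
  by (rule nn_integral_pmf_measurable) measurable

lemma integrable_mean_powr:
  assumes "0 \<le> r"
  shows "integrable M (\<lambda>x. mean p x powr (- r))"
proof (rule integrable_const_bound[where B=1])
  show "AE x in M. norm (mean p x powr (- r)) \<le> 1"
    using AE_mean_ge_1 by eventually_elim (use assms powr_mono2'[of "- r" 1] in force)
qed measurable

lemma ennreal_cr: "0 \<le> r \<Longrightarrow> ennreal (cr M p r) = (\<integral>\<^sup>+x. ennreal (mean p x powr (- r)) \<partial>M)"
  unfolding cr_def by (rule nn_integral_eq_integral[symmetric]) (auto intro: integrable_mean_powr)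

lemma akern_harmonic_moment:
  assumes z: "1 \<le> z" and r: "0 < r"
  shows "(\<integral>\<^sup>+j. ennreal (real j powr (- r)) \<partial>akern z) \<le>
    ennreal (real z powr (- r)) * (ennreal (cr M p r) + ennreal (of_int \<lceil>r\<rceil>) *
      (size_tail (sqrt (real z)) + ennreal (real z powr (- 1/4))))"
proof -
  have "(\<integral>\<^sup>+j. ennreal (real j powr (- r)) \<partial>akern z) \<le>
    (\<integral>\<^sup>+x. ennreal (real z powr (- r)) * (ennreal (mean p x powr (- r)) + ennreal (of_int \<lceil>r\<rceil>) *
      ((\<integral>\<^sup>+j. ennreal (real j / mean p x) * indicator {j. sqrt (real z) < real j} j \<partial>p x) + ennreal (real z powr (- 1/4)))) \<partial>M)"
    unfolding nn_integral_akern
  proof (rule nn_integral_mono_AE)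
    show "AE x in M. (\<integral>\<^sup>+j. ennreal (real j powr (- r)) \<partial>iid_sum (p x) z) \<le>
      ennreal (real z powr (- r)) * (ennreal (mean p x powr (- r)) + ennreal (of_int \<lceil>r\<rceil>) *
      ((\<integral>\<^sup>+j. ennreal (real j / mean p x) * indicator {j. sqrt (real z) < real j} j \<partial>p x) + ennreal (real z powr (- 1/4))))"
      using AE_pmf_0 AE_mean_fin AE_mean_ge_1
      by eventually_elim (rule harmonic_moment_iid_sum, use z r in \<open>auto simp: mean_def\<close>)
  qed
  also have "\<dots> = ennreal (real z powr (- r)) * (ennreal (cr M p r) + ennreal (of_int \<lceil>r\<rceil>) *
      (size_tail (sqrt (real z)) + ennreal (real z powr (- 1/4))))"
    using r by (simp add: nn_integral_cmult nn_integral_add ennreal_cr size_tail_def emeasure_space_1)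
  finally show ?thesis .
qed

lemma size_tail_antimono: "y \<le> y' \<Longrightarrow> size_tail y' \<le> size_tail y"
  unfolding size_tail_def by (intro nn_integral_mono mult_left_mono) (auto simp: indicator_def)

lemma size_biased_mass: "(\<integral>\<^sup>+x. \<integral>\<^sup>+j. ennreal (real j / mean p x) \<partial>p x \<partial>M) = 1"
proof -
  have "(\<integral>\<^sup>+x. \<integral>\<^sup>+j. ennreal (real j / mean p x) \<partial>p x \<partial>M) = (\<integral>\<^sup>+x. 1 \<partial>M)"
  proof (rule nn_integral_cong_AE)
    show "AE x in M. (\<integral>\<^sup>+j. ennreal (real j / mean p x) \<partial>p x) = 1"
      using AE_mean_fin AE_mean_ge_1
    proof eventually_elim
      case (elim x)
      then have "(\<integral>\<^sup>+j. ennreal (real j / mean p x) \<partial>p x) = ennreal (\<integral>j. real j / mean p x \<partial>p x)"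
        by (intro nn_integral_eq_integral) auto
      also have "(\<integral>j. real j / mean p x \<partial>p x) = 1"
        using elim by (simp add: mean_def)
      finally show ?case by simp
    qed
  qed
  then show ?thesis by (simp add: emeasure_space_1)
qed

lemma size_tail_le_1: "size_tail y \<le> 1"
  unfolding size_biased_mass[symmetric] size_tail_def
  by (intro nn_integral_mono) (auto simp: indicator_def)

definition step_error :: "real \<Rightarrow> real \<Rightarrow> real" where
  "step_error r z = of_int \<lceil>r\<rceil> * (enn2real (size_tail (sqrt z)) + z powr (- 1/4))"

lemma ennreal_size_tail: "ennreal (enn2real (size_tail y)) = size_tail y"
  by (intro ennreal_enn2real le_less_trans[OF size_tail_le_1]) simp

lemma step_error_nonneg: "0 < r \<Longrightarrow> 0 \<le> step_error r z"
  unfolding step_error_def by (intro mult_nonneg_nonneg) auto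

lemma step_error_antimono:
  assumes "0 < r" "0 < z" "z \<le> z'"
  shows "step_error r z' \<le> step_error r z"
  unfolding step_error_def
proof (intro mult_left_mono add_mono)
  show "enn2real (size_tail (sqrt z')) \<le> enn2real (size_tail (sqrt z))"
    using assms by (intro enn2real_mono size_tail_antimono) (auto intro: le_less_trans[OF size_tail_le_1])
  show "z' powr (- 1/4) \<le> z powr (- 1/4)"
    using assms by (intro powr_mono2') auto
qed (use assms in auto)

lemma cr_nonneg: "0 \<le> cr M p r"
  unfolding cr_def by simp

lemma akern_harmonic_moment':
  assumes z: "1 \<le> z" and r: "0 < r"
  shows "(\<integral>\<^sup>+j. ennreal (real j powr (- r)) \<partial>akern z) \<le>
    ennreal (real z powr (- r) * (cr M p r + step_error r (real z)))"
proof -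
  have c: "0 \<le> (of_int \<lceil>r\<rceil> :: real)" using r by simp
  have "ennreal (real z powr (- r) * (cr M p r + step_error r (real z))) =
    ennreal (real z powr (- r)) * (ennreal (cr M p r) + ennreal (of_int \<lceil>r\<rceil>) *
      (size_tail (sqrt (real z)) + ennreal (real z powr (- 1/4))))"
    unfolding step_error_def
    using c by (simp add: ennreal_mult ennreal_plus cr_nonneg ennreal_size_tail)
  then show ?thesis using akern_harmonic_moment[OF z r] by simp
qed

end

locale bpre_supercritical = bpre +
  assumes LlogL: "(\<integral>\<^sup>+x. (\<integral>\<^sup>+j. ennreal (real j / mean p x * max 0 (ln (real j))) \<partial>measure_pmf (p x)) \<partial>M) < \<infinity>"
    and nontrivial: "\<not> (AE x in M. mean p x = 1)"
begin

lemma summable_size_tail: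
  assumes a: "0 < a"
  shows "summable (\<lambda>n. enn2real (size_tail (exp (a * real n))))"
proof -
  let ?I = "\<lambda>n j. indicator {j. exp (a * real n) < real j} j :: ennreal"
  have count: "(\<Sum>n. ?I n j) \<le> 1 + ennreal (1 / a) * ennreal (max 0 (ln (real j)))" for j
  proof -
    define N where "N = nat \<lceil>max 0 (ln (real j)) / a\<rceil>"
    have out: "?I n j = 0" if "n \<notin> {..<N}" for n
    proof -
      have "max 0 (ln (real j)) / a \<le> real n"
        using that real_nat_ceiling_ge[of "max 0 (ln (real j)) / a"] unfolding N_def
        by (metis lessThan_iff not_less of_nat_le_iff order_trans)
      then have "ln (real j) \<le> a * real n" using a by (simp add: field_simps)
      then have "real j \<le> exp (a * real n)"
      proof (cases "j = 0")
        case False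
        then have "real j = exp (ln (real j))" by simp
        also have "\<dots> \<le> exp (a * real n)" using \<open>ln (real j) \<le> a * real n\<close> by simp
        finally show ?thesis .
      qed simp
      then show ?thesis by auto
    qed
    have "(\<Sum>n. ?I n j) = (\<Sum>n<N. ?I n j)"
      by (rule suminf_finite) (auto simp: out)
    also have "\<dots> \<le> (\<Sum>n<N. 1)" by (intro sum_mono) (auto simp: indicator_def)
    also have "\<dots> = ennreal (real N)" by (simp add: ennreal_of_nat_eq_real_of_nat)
    also have "\<dots> \<le> ennreal (1 + 1 / a * max 0 (ln (real j)))"
      unfolding N_def using a by (intro ennreal_leI) (use of_int_ceiling_le_add_one[of "max 0 (ln (real j)) / a"] in \<open>simp add: divide_simps\<close>)
    also have "\<dots> = 1 + ennreal (1 / a) * ennreal (max 0 (ln (real j)))"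
      using a by (subst ennreal_plus) (auto simp del: ennreal_max_0 ennreal_max_0' simp flip: ennreal_mult)
    finally show ?thesis .
  qed
  have "(\<Sum>n. size_tail (exp (a * real n))) =
      (\<integral>\<^sup>+x. \<integral>\<^sup>+j. ennreal (real j / mean p x) * (\<Sum>n. ?I n j) \<partial>p x \<partial>M)"
    unfolding size_tail_def
    by (subst nn_integral_suminf[symmetric], measurable,
        intro nn_integral_cong, subst nn_integral_suminf[symmetric], simp, simp)
  also have "\<dots> \<le> (\<integral>\<^sup>+x. \<integral>\<^sup>+j. ennreal (real j / mean p x) * (1 + ennreal (1 / a) * ennreal (max 0 (ln (real j)))) \<partial>p x \<partial>M)"
    by (intro nn_integral_mono mult_left_mono count) auto
  also have "\<dots> = (\<integral>\<^sup>+x. (\<integral>\<^sup>+j. ennreal (real j / mean p x) \<partial>p x) +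
      ennreal (1 / a) * (\<integral>\<^sup>+j. ennreal (real j / mean p x * max 0 (ln (real j))) \<partial>p x) \<partial>M)"
  proof (intro nn_integral_cong)
    fix x
    have "0 \<le> mean p x" by (simp add: mean_def)
    then have "ennreal (real j / mean p x) * (1 + ennreal (1 / a) * ennreal (max 0 (ln (real j)))) =
        ennreal (real j / mean p x) + ennreal (1 / a) * ennreal (real j / mean p x * max 0 (ln (real j)))" for j
      using ennreal_mult[of "real j / mean p x" "max 0 (ln (real j))"]
      by (simp only: distrib_left mult_1_right mult.left_commute[of "ennreal (real j / mean p x)"]) simp
    then show "(\<integral>\<^sup>+j. ennreal (real j / mean p x) * (1 + ennreal (1 / a) * ennreal (max 0 (ln (real j)))) \<partial>p x) =
        (\<integral>\<^sup>+j. ennreal (real j / mean p x) \<partial>p x) + ennreal (1 / a) * (\<integral>\<^sup>+j. ennreal (real j / mean p x * max 0 (ln (real j))) \<partial>p x)"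
      by (simp add: nn_integral_add nn_integral_cmult)
  qed
  also have "\<dots> = 1 + ennreal (1 / a) * (\<integral>\<^sup>+x. \<integral>\<^sup>+j. ennreal (real j / mean p x * max 0 (ln (real j))) \<partial>p x \<partial>M)"
  proof -
    have [measurable]: "(\<lambda>x. \<integral>\<^sup>+j. ennreal (real j / mean p x) \<partial>p x) \<in> borel_measurable M"
      "(\<lambda>x. \<integral>\<^sup>+j. ennreal (real j / mean p x * max 0 (ln (real j))) \<partial>p x) \<in> borel_measurable M"
      by (rule nn_integral_pmf_measurable, measurable)+
    show ?thesis
      by (subst nn_integral_add, measurable, subst nn_integral_cmult, measurable) (simp only: size_biased_mass)
  qed
  also have "\<dots> < \<infinity>" using LlogL by (simp add: ennreal_mult_less_top)
  finally have "(\<Sum>n. ennreal (enn2real (size_tail (exp (a * real n))))) < \<infinity>"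
    unfolding ennreal_size_tail .
  then show ?thesis by (intro summable_suminf_not_top) auto
qed

lemma summable_step_error:
  assumes a: "0 < a" and r: "0 < r"
  shows "summable (\<lambda>n. step_error r (exp (a * real n)))"
proof -
  have 1: "sqrt (exp (a * real n)) = exp (a / 2 * real n)" for n
    by (rule real_sqrt_unique) (simp_all add: power2_eq_square exp_add[symmetric])
  have 2: "exp (a * real n) powr (- 1/4) = exp (- a / 4) ^ n" for n
    by (simp add: powr_def exp_of_nat_mult[symmetric] algebra_simps)
  show ?thesis
    unfolding step_error_def 1 2
    using a summable_size_tail[of "a / 2"] by (intro summable_mult summable_add summable_geometric) auto
qed

lemma cr_strict_antimono:
  assumes "0 \<le> r" "r < s"
  shows "cr M p s < cr M p r"
proof -
  have int: "integrable M (\<lambda>x. mean p x powr (- r))" "integrable M (\<lambda>x. mean p x powr (- s))"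
    using assms by (auto intro: integrable_mean_powr)
  have le: "AE x in M. mean p x powr (- s) \<le> mean p x powr (- r)"
    using AE_mean_ge_1 by eventually_elim (use assms in \<open>auto intro: powr_mono\<close>)
  have "cr M p s \<le> cr M p r" unfolding cr_def by (intro integral_mono_AE int le)
  moreover have "cr M p s \<noteq> cr M p r"
  proof
    assume eq: "cr M p s = cr M p r"
    have "AE x in M. mean p x powr (- r) - mean p x powr (- s) = 0"
      using int le eq by (subst integral_nonneg_eq_0_iff_AE[symmetric]) (auto simp: cr_def)
    then have "AE x in M. mean p x = 1"
      using AE_mean_ge_1
    proof eventually_elim
      case (elim x)
      then show ?case using assms powr_less_cancel_iff[of "mean p x" "-s" "-r"] by (cases "mean p x = 1") auto
    qed
    with nontrivial show False by blast
  qed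
  ultimately show ?thesis by simp
qed

lemma cr_pos: "0 \<le> r \<Longrightarrow> 0 < cr M p r"
  using cr_strict_antimono[of r "r + 1"] cr_nonneg[of "r + 1"] by simp

end

context bpre
begin

lemma AE_set_iid_sum: "AE x in M. \<forall>z. \<forall>j\<in>set_pmf (iid_sum (p x) z). z \<le> j"
  using AE_pmf_0 by eventually_elim (auto simp: set_pmf_iff intro: set_iid_sum_ge)

lemma set_akern_ge:
  assumes "j \<in> set_pmf (akern z)"
  shows "z \<le> j"
proof (rule ccontr)
  assume "\<not> z \<le> j"
  have "AE x in M. ennreal (pmf (iid_sum (p x) z) j) = 0"
    using AE_set_iid_sum by eventually_elim (use \<open>\<not> z \<le> j\<close> in \<open>auto simp: pmf_eq_0_set_pmf\<close>)
  then have "(\<integral>\<^sup>+x. ennreal (pmf (iid_sum (p x) z) j) \<partial>M) = 0"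
    by (subst nn_integral_0_iff_AE) auto
  then have "pmf (akern z) j = 0" using pmf_akern[of z j] by simp
  with assms show False by (simp add: set_pmf_iff)
qed

lemma set_alaw_ge: "j \<in> set_pmf (alaw n k) \<Longrightarrow> k \<le> j"
proof (induction n arbitrary: k)
  case (Suc n)
  then obtain i where "i \<in> set_pmf (akern k)" "j \<in> set_pmf (alaw n i)" by auto
  then show ?case using set_akern_ge Suc.IH le_trans by blast
qed simp

lemma pmf_akern_same: "pmf (akern k) k = gam M p k"
  unfolding pmf_akern_real gam_def
  by (intro integral_cong_AE) (use AE_pmf_0 in \<open>auto simp: set_pmf_iff pmf_iid_sum_same\<close>)

lemma gam_antimono: "k \<le> j \<Longrightarrow> gam M p j \<le> gam M p k"
  unfolding gam_def
  by (intro integral_mono integrable_const_bound[where B=1] power_decreasing)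
    (auto simp: pmf_le_1 power_le_one)

lemma nn_integral_akern_split:
  fixes h :: "nat \<Rightarrow> ennreal"
  shows "(\<integral>\<^sup>+j. h j \<partial>akern k) = ennreal (gam M p k) * h k + (\<integral>\<^sup>+j. h j * indicator {k<..} j \<partial>akern k)"
proof -
  have "(\<integral>\<^sup>+j. h j \<partial>akern k) = (\<integral>\<^sup>+j. h k * indicator {k} j + h j * indicator {k<..} j \<partial>akern k)"
  proof (intro nn_integral_cong_AE AE_pmfI)
    fix j assume "j \<in> set_pmf (akern k)"
    then have "k \<le> j" by (rule set_akern_ge)
    then show "h j = h k * indicator {k} j + h j * indicator {k<..} j"
      by (cases "j = k") (auto simp: indicator_def)
  qed
  also have "\<dots> = ennreal (gam M p k) * h k + (\<integral>\<^sup>+j. h j * indicator {k<..} j \<partial>akern k)"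
    by (simp add: nn_integral_add nn_integral_cmult emeasure_pmf_single pmf_akern_same mult.commute)
  finally show ?thesis .
qed

end

section \<open>Sharp bounds for harmonic moments\<close>

lemma discrete_gronwall:
  fixes u e :: "nat \<Rightarrow> real"
  assumes c: "0 < c" and \<kappa>: "0 \<le> \<kappa>" "\<kappa> < c" and B: "0 \<le> B" and e: "\<And>n. 0 \<le> e n" "summable e"
    and u0: "u 0 \<le> U" "0 \<le> U" and step: "\<And>n. u (Suc n) \<le> (c + e n) * u n + B * \<kappa> ^ n"
  shows "u n \<le> exp (suminf e / c) * (U + B / (c - \<kappa>)) * c ^ n"
proof -
  define E where "E n = exp ((\<Sum>i<n. e i) / c)" for n
  define S where "S n = U + B / c * (\<Sum>i<n. (\<kappa> / c) ^ i)" for n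
  have S0: "0 \<le> S n" for n
    unfolding S_def using c \<kappa> B u0 by (intro add_nonneg_nonneg mult_nonneg_nonneg sum_nonneg) auto
  have E1: "1 \<le> E n" for n
    unfolding E_def using c e by (simp add: sum_nonneg)
  have main: "u n \<le> c ^ n * E n * S n" for n
  proof (induction n)
    case 0
    then show ?case using u0 by (simp add: E_def S_def)
  next
    case (Suc n)
    have "u (Suc n) \<le> (c + e n) * u n + B * \<kappa> ^ n" by (rule step)
    also have "(c + e n) * u n \<le> (c + e n) * (c ^ n * E n * S n)"
      using Suc c e by (intro mult_left_mono) (auto intro: add_nonneg_nonneg)
    also have "c + e n = c * (1 + e n / c)" using c by (simp add: field_simps)
    also have "\<dots> \<le> c * exp (e n / c)"
      using c exp_ge_add_one_self[of "e n / c"] by (intro mult_left_mono) auto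
    also have "c * exp (e n / c) * (c ^ n * E n * S n) = c ^ Suc n * E (Suc n) * S n"
      by (simp add: E_def add_divide_distrib exp_add)
    also have "B * \<kappa> ^ n \<le> E (Suc n) * (B * \<kappa> ^ n)"
      using mult_right_mono[OF E1[of "Suc n"], of "B * \<kappa> ^ n"] B \<kappa> by simp
    also have "c ^ Suc n * E (Suc n) * S n + E (Suc n) * (B * \<kappa> ^ n) = c ^ Suc n * E (Suc n) * S (Suc n)"
      using c by (simp add: S_def field_simps power_divide)
    finally show ?case
      using S0[of n] c E1[of n] by (simp add: mult_right_mono)
  qed
  have "E n \<le> exp (suminf e / c)"
    unfolding E_def using c e by (auto intro!: divide_right_mono sum_le_suminf)
  moreover have "S n \<le> U + B / (c - \<kappa>)"
  proof -
    have "(\<Sum>i<n. (\<kappa> / c) ^ i) \<le> (\<Sum>i. (\<kappa> / c) ^ i)"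
      using c \<kappa> by (intro sum_le_suminf summable_geometric) auto
    also have "\<dots> = 1 / (1 - \<kappa> / c)"
      using c \<kappa> by (intro suminf_geometric) auto
    finally have "B / c * (\<Sum>i<n. (\<kappa> / c) ^ i) \<le> B / c * (1 / (1 - \<kappa> / c))"
      using B c by (intro mult_left_mono) auto
    also have "\<dots> = B / (c - \<kappa>)" using c \<kappa> by (simp add: field_simps)
    finally show ?thesis by (simp add: S_def)
  qed
  ultimately have "E n * S n \<le> exp (suminf e / c) * (U + B / (c - \<kappa>))"
    using S0[of n] by (intro mult_mono) auto
  then have "c ^ n * (E n * S n) \<le> c ^ n * (exp (suminf e / c) * (U + B / (c - \<kappa>)))"
    using c by (intro mult_left_mono) auto
  with main[of n] show ?thesis by (simp add: algebra_simps)
qed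

context bpre_supercritical
begin

text \<open>A Lyapunov function: \<open>z powr (- s)\<close> for large \<open>z\<close>, and geometrically larger values on the
  finitely many small states, which are left only upwards.\<close>

lemma harmonic_moment_weak_bound:
  assumes k: "1 \<le> k" and s: "0 < s" and \<rho>: "cr M p s < \<rho>" "gam M p k < \<rho>"
  obtains C where "0 \<le> C"
    "\<And>j n. k \<le> j \<Longrightarrow> (\<integral>\<^sup>+i. ennreal (real i powr (- s)) \<partial>alaw n j) \<le> ennreal (C * \<rho> ^ n)"
proof -
  have "(\<lambda>n. step_error s (exp (1 * real n))) \<longlonglongrightarrow> 0"
    by (intro summable_LIMSEQ_zero summable_step_error s) simp
  then have "\<forall>\<^sub>F n in sequentially. step_error s (exp (1 * real n)) < \<rho> - cr M p s"
    using \<rho> by (intro order_tendstoD(2)) auto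
  then obtain N where N: "step_error s (exp (real N)) < \<rho> - cr M p s"
    by (auto simp: eventually_sequentially)
  define K where "K = max k (nat \<lceil>exp (real N)\<rceil>)"
  have K: "step_error s (real z) \<le> \<rho> - cr M p s" if "K \<le> z" for z
  proof -
    have "exp (real N) \<le> real z"
      using that real_nat_ceiling_ge[of "exp (real N)"] unfolding K_def
      by (metis max.boundedE of_nat_le_iff order_trans)
    then have "step_error s (real z) \<le> step_error s (exp (real N))"
      by (intro step_error_antimono s) auto
    with N show ?thesis by simp
  qed
  define D where "D = max 1 (1 / (\<rho> - gam M p k))"
  have D1: "1 \<le> D" unfolding D_def by simp
  have \<rho>0: "0 < \<rho>" using \<rho>(1) cr_nonneg[of s] by linarith
  define V where "V z = (if z < K then D ^ (K - z) else real z powr (- s))" for z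
  have V0: "0 \<le> V z" for z unfolding V_def using D1 by auto
  have powr_le1: "real z powr (- s) \<le> 1" if "1 \<le> z" for z
    using powr_mono2'[of "- s" 1 "real z"] s that by simp
  have V_step: "(\<integral>\<^sup>+j. ennreal (V j) \<partial>akern z) \<le> ennreal (\<rho> * V z)" if z: "k \<le> z" for z
  proof (cases "K \<le> z")
    case True
    have "(\<integral>\<^sup>+j. ennreal (V j) \<partial>akern z) = (\<integral>\<^sup>+j. ennreal (real j powr (- s)) \<partial>akern z)"
      using True by (intro nn_integral_cong_AE AE_pmfI) (auto simp: V_def dest: set_akern_ge)
    also have "\<dots> \<le> ennreal (real z powr (- s) * (cr M p s + step_error s (real z)))"
      using k z by (intro akern_harmonic_moment' s) simp
    also have "\<dots> \<le> ennreal (\<rho> * V z)"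
    proof (rule ennreal_leI)
      have "real z powr (- s) * (cr M p s + step_error s (real z)) \<le> real z powr (- s) * \<rho>"
        using K[OF True] by (intro mult_left_mono) auto
      then show "real z powr (- s) * (cr M p s + step_error s (real z)) \<le> \<rho> * V z"
        using True by (simp add: V_def mult.commute)
    qed
    finally show ?thesis .
  next
    case False
    let ?d = "D ^ (K - z - 1)"
    have V_le: "V j \<le> ?d" if j: "z < j" for j
    proof (cases "j < K")
      case True
      then show ?thesis unfolding V_def using D1 j by (auto intro: power_increasing)
    next
      case False
      then have "V j \<le> 1" unfolding V_def using powr_le1[of j] k z j by simp
      also have "1 \<le> ?d" using D1 by (rule one_le_power)
      finally show ?thesis .
    qed
    have Vz: "V z = D * ?d"
      using False power_Suc[of D "K - z - 1"] by (simp add: V_def Suc_diff_Suc del: power_Suc)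
    have "(\<integral>\<^sup>+j. ennreal (V j) * indicator {z<..} j \<partial>akern z) \<le> (\<integral>\<^sup>+j. ennreal ?d \<partial>akern z)"
      using V_le by (intro nn_integral_mono) (auto simp: indicator_def intro: ennreal_leI)
    also have "\<dots> = ennreal ?d" by (simp add: measure_pmf.emeasure_space_1[simplified])
    finally have "(\<integral>\<^sup>+j. ennreal (V j) \<partial>akern z) \<le> ennreal (gam M p z) * ennreal (V z) + ennreal ?d"
      by (subst nn_integral_akern_split) (rule add_left_mono)
    also have "\<dots> = ennreal (gam M p z * V z + ?d)"
      using V0[of z] D1 pmf_nonneg[of "akern z" z]
      by (simp add: pmf_akern_same flip: ennreal_plus ennreal_mult)
    also have "\<dots> \<le> ennreal (\<rho> * V z)"
    proof (rule ennreal_leI)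
      have "1 \<le> (\<rho> - gam M p k) * D"
        using \<rho>(2) by (simp add: D_def max_def divide_simps)
      also have "\<dots> \<le> (\<rho> - gam M p z) * D"
        using gam_antimono[OF z] D1 by (intro mult_right_mono) auto
      finally have "1 * ?d \<le> (\<rho> - gam M p z) * D * ?d"
        using D1 by (intro mult_right_mono) auto
      then show "gam M p z * V z + ?d \<le> \<rho> * V z"
        unfolding Vz by (simp add: algebra_simps)
    qed
    finally show ?thesis .
  qed
  have V_iter: "(\<integral>\<^sup>+j. ennreal (V j) \<partial>alaw n z) \<le> ennreal (\<rho> ^ n * V z)" if "k \<le> z" for n z
    using that
  proof (induction n arbitrary: z)
    case (Suc n)
    have "(\<integral>\<^sup>+j. ennreal (V j) \<partial>alaw (Suc n) z) \<le> (\<integral>\<^sup>+i. ennreal (\<rho> ^ n) * ennreal (V i) \<partial>akern z)"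
      unfolding alaw.simps nn_integral_bind_pmf
    proof (intro nn_integral_mono_AE AE_pmfI)
      fix i assume "i \<in> set_pmf (akern z)"
      then have "k \<le> i" using set_akern_ge Suc.prems le_trans by blast
      from Suc.IH[OF this] show "(\<integral>\<^sup>+j. ennreal (V j) \<partial>alaw n i) \<le> ennreal (\<rho> ^ n) * ennreal (V i)"
        using \<rho>0 V0[of i] by (simp add: ennreal_mult)
    qed
    also have "\<dots> \<le> ennreal (\<rho> ^ n) * ennreal (\<rho> * V z)"
      by (simp add: nn_integral_cmult mult_left_mono V_step[OF Suc.prems])
    also have "\<dots> = ennreal (\<rho> ^ Suc n * V z)"
      using \<rho>0 V0[of z] by (simp add: ennreal_mult[symmetric] algebra_simps)
    finally show ?case .
  qed simp
  show thesis
  proof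
    show "0 \<le> D ^ K" using D1 by simp
    fix j n assume j: "k \<le> j"
    have "(\<integral>\<^sup>+i. ennreal (real i powr (- s)) \<partial>alaw n j) \<le> (\<integral>\<^sup>+i. ennreal (V i) \<partial>alaw n j)"
    proof (intro nn_integral_mono_AE AE_pmfI ennreal_leI)
      fix i assume "i \<in> set_pmf (alaw n j)"
      then have "1 \<le> i" using set_alaw_ge[of i n j] j k by linarith
      then show "real i powr (- s) \<le> V i"
        using powr_le1[of i] one_le_power[OF D1, of "K - i"] by (simp add: V_def)
    qed
    also have "\<dots> \<le> ennreal (\<rho> ^ n * V j)" by (rule V_iter[OF j])
    also have "\<dots> \<le> ennreal (D ^ K * \<rho> ^ n)"
    proof -
      have "V j \<le> D ^ K"
        unfolding V_def using D1 order_trans[OF powr_le1[of j] one_le_power[OF D1, of K]] j k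
        by (auto intro: power_increasing)
      then show ?thesis using \<rho>0 by (intro ennreal_leI) (simp add: mult.commute mult_right_mono)
    qed
    finally show "(\<integral>\<^sup>+i. ennreal (real i powr (- s)) \<partial>alaw n j) \<le> ennreal (D ^ K * \<rho> ^ n)" .
  qed
qed

text \<open>The exact rate: states \<open>z \<ge> exp (a * n)\<close> cost only a summable relative error, and smaller
  states are controlled by the weak bound for the exponent \<open>r + 1\<close>.\<close>

proposition harmonic_moment_sharp_bound:
  assumes k: "1 \<le> k" and r: "0 < r" and less: "gam M p k < cr M p r"
  obtains C where "0 \<le> C"
    "\<And>j n. k \<le> j \<Longrightarrow> (\<integral>\<^sup>+i. ennreal (real i powr (- r)) \<partial>alaw n j) \<le> ennreal (C * cr M p r ^ n)"
proof -
  define c where "c = cr M p r"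
  have c: "0 < c" unfolding c_def using cr_pos r by simp
  obtain \<rho> where \<rho>: "max (cr M p (r + 1)) (gam M p k) < \<rho>" "\<rho> < c"
    using dense[of "max (cr M p (r + 1)) (gam M p k)" c] cr_strict_antimono[of r "r + 1"] r less
    unfolding c_def by auto
  have \<rho>0: "0 < \<rho>" using \<rho>(1) cr_nonneg[of "r + 1"] by linarith
  obtain C where C: "0 \<le> C"
    "\<And>j n. k \<le> j \<Longrightarrow> (\<integral>\<^sup>+i. ennreal (real i powr (- (r + 1))) \<partial>alaw n j) \<le> ennreal (C * \<rho> ^ n)"
    using harmonic_moment_weak_bound[OF k, of "r + 1" \<rho>] \<rho> r by auto
  define a where "a = ln (c / \<rho>) / 2"
  have a: "0 < a" unfolding a_def using \<rho> \<rho>0 c by simp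
  define \<kappa> where "\<kappa> = exp a * \<rho>"
  have \<kappa>: "0 \<le> \<kappa>" "\<kappa> < c"
  proof -
    have "exp a < exp (2 * a)" using a by simp
    also have "\<dots> = c / \<rho>" unfolding a_def using c \<rho>0 by simp
    finally show "\<kappa> < c" unfolding \<kappa>_def using \<rho>0 by (simp add: field_simps)
  qed (simp add: \<kappa>_def less_imp_le[OF \<rho>0])
  define e where "e n = step_error r (exp (a * real n))" for n
  define E0 where "E0 = step_error r 1"
  have e0: "0 \<le> e n" for n unfolding e_def by (rule step_error_nonneg[OF r])
  have E0: "0 \<le> E0" unfolding E0_def by (rule step_error_nonneg[OF r])
  have sum_e: "summable e" unfolding e_def[abs_def] by (rule summable_step_error[OF a r])
  show thesis
  proof
    show "0 \<le> exp (suminf e / c) * (1 + E0 * C / (c - \<kappa>))"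
      using \<kappa> E0 C(1) by (intro mult_nonneg_nonneg add_nonneg_nonneg divide_nonneg_nonneg) auto
    fix j n assume j: "k \<le> j"
    have powr_le1: "real z powr (- r) \<le> 1" for z :: nat
      using powr_mono2'[of "- r" 1 "real z"] r by (cases "z = 0") auto
    define u where "u n = (\<integral>i. real i powr (- r) \<partial>alaw n j)" for n
    have u: "(\<integral>\<^sup>+i. ennreal (real i powr (- r)) \<partial>alaw n j) = ennreal (u n)" for n
      unfolding u_def
      by (intro nn_integral_eq_integral measure_pmf.integrable_const_bound[where B=1]) (auto simp: powr_le1)
    have u0: "0 \<le> u n" for n unfolding u_def by simp
    have step: "u (Suc n) \<le> (c + e n) * u n + E0 * C * \<kappa> ^ n" for n
    proof -
      have "ennreal (u (Suc n)) = (\<integral>\<^sup>+z. \<integral>\<^sup>+i. ennreal (real i powr (- r)) \<partial>akern z \<partial>alaw n j)"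
        unfolding u[symmetric] alaw_Suc_last by simp
      also have "\<dots> \<le> (\<integral>\<^sup>+z. ennreal (c + e n) * ennreal (real z powr (- r)) +
          ennreal (E0 * exp a ^ n) * ennreal (real z powr (- (r + 1))) \<partial>alaw n j)"
      proof (intro nn_integral_mono_AE AE_pmfI)
        fix z assume "z \<in> set_pmf (alaw n j)"
        then have z: "1 \<le> z" using set_alaw_ge[of z n j] j k by linarith
        have "(\<integral>\<^sup>+i. ennreal (real i powr (- r)) \<partial>akern z) \<le> ennreal (real z powr (- r) * (c + step_error r (real z)))"
          unfolding c_def by (rule akern_harmonic_moment'[OF z r])
        also have "\<dots> \<le> ennreal ((c + e n) * real z powr (- r) + (E0 * exp a ^ n) * real z powr (- (r + 1)))"
        proof (rule ennreal_leI)
          have "real z powr (- r) * step_error r (real z) \<le> e n * real z powr (- r) + E0 * exp a ^ n * real z powr (- (r + 1))"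
          proof (cases "exp (a * real n) \<le> real z")
            case True
            then have "step_error r (real z) \<le> e n"
              unfolding e_def by (intro step_error_antimono r) auto
            then have "real z powr (- r) * step_error r (real z) \<le> real z powr (- r) * e n"
              by (intro mult_left_mono) auto
            moreover have "0 \<le> E0 * exp a ^ n * real z powr (- (r + 1))" using E0 by simp
            ultimately show ?thesis by (simp add: mult.commute)
          next
            case False
            have "step_error r (real z) \<le> E0"
              unfolding E0_def using z by (intro step_error_antimono r) auto
            then have "real z powr (- r) * step_error r (real z) \<le> real z powr (- r) * E0"
              by (intro mult_left_mono) auto
            also have "\<dots> \<le> exp a ^ n * real z powr (- (r + 1)) * E0"
            proof (rule mult_right_mono[OF _ E0])
              have "real z powr (- r) = real z * real z powr (- (r + 1))"
                using z by (simp add: powr_diff powr_minus powr_add field_simps)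
              also have "\<dots> \<le> exp a ^ n * real z powr (- (r + 1))"
                using False by (intro mult_right_mono) (auto simp: exp_of_nat_mult[symmetric] mult.commute)
              finally show "real z powr (- r) \<le> exp a ^ n * real z powr (- (r + 1))" .
            qed
            also have "\<dots> \<le> e n * real z powr (- r) + E0 * exp a ^ n * real z powr (- (r + 1))"
              using e0[of n] by (simp add: algebra_simps)
            finally show ?thesis .
          qed
          then show "real z powr (- r) * (c + step_error r (real z)) \<le> (c + e n) * real z powr (- r) + (E0 * exp a ^ n) * real z powr (- (r + 1))"
            by (simp add: algebra_simps)
        qed
        also have "\<dots> = ennreal (c + e n) * ennreal (real z powr (- r)) +
          ennreal (E0 * exp a ^ n) * ennreal (real z powr (- (r + 1)))"
          using c e0[of n] E0 by (subst ennreal_plus) (auto simp: ennreal_mult)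
        finally show "(\<integral>\<^sup>+i. ennreal (real i powr (- r)) \<partial>akern z) \<le> \<dots>" .
      qed
      also have "\<dots> = ennreal (c + e n) * ennreal (u n) +
          ennreal (E0 * exp a ^ n) * (\<integral>\<^sup>+z. ennreal (real z powr (- (r + 1))) \<partial>alaw n j)"
        by (simp add: nn_integral_add nn_integral_cmult u)
      also have "\<dots> \<le> ennreal (c + e n) * ennreal (u n) + ennreal (E0 * exp a ^ n) * ennreal (C * \<rho> ^ n)"
        by (intro add_left_mono mult_left_mono C(2) j) auto
      also have "\<dots> = ennreal ((c + e n) * u n + E0 * C * \<kappa> ^ n)"
        using c e0[of n] E0 C(1) u0[of n] \<rho>0
        by (simp add: \<kappa>_def power_mult_distrib ac_simps flip: ennreal_mult ennreal_plus)
      finally show ?thesis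
        using c e0[of n] E0 C(1) u0[of n] \<kappa> by (subst (asm) ennreal_le_iff) auto
    qed
    have "u 0 \<le> 1" using powr_le1[of j] by (simp add: u_def)
    from discrete_gronwall[OF c \<kappa> _ e0 sum_e this _ step, of n] E0 C(1)
    have "u n \<le> exp (suminf e / c) * (1 + E0 * C / (c - \<kappa>)) * c ^ n" by simp
    then show "(\<integral>\<^sup>+i. ennreal (real i powr (- r)) \<partial>alaw n j) \<le>
        ennreal (exp (suminf e / c) * (1 + E0 * C / (c - \<kappa>)) * cr M p r ^ n)"
      unfolding u c_def[symmetric] by (rule ennreal_leI)
  qed
qed

end

section \<open>Laplace transforms and tilting\<close>

abbreviation gweight :: "real \<Rightarrow> real \<Rightarrow> ennreal" where
  "gweight r t \<equiv> ennreal (t powr (r - 1)) * indicator {0<..} t"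

lemma nn_integral_exp_gweight:
  fixes r z :: real
  assumes r: "0 < r" and z: "0 < z"
  shows "(\<integral>\<^sup>+t. ennreal (exp (- t * z)) * gweight r t \<partial>lborel) = ennreal (Gamma r) * ennreal (z powr (- r))"
proof -
  have pt: "ennreal (indicator {0..} (0 + z * t) * (0 + z * t) powr (r - 1) / exp (0 + z * t)) =
      ennreal (z powr (r - 1)) * (ennreal (exp (- t * z)) * gweight r t)" for t
    using z by (cases "0 < t")
      (auto simp: indicator_def powr_mult exp_minus field_simps zero_le_mult_iff simp flip: ennreal_mult)
  have "ennreal (Gamma r) = ennreal z * (\<integral>\<^sup>+t. ennreal (indicator {0..} (0 + z * t) * (0 + z * t) powr (r - 1) / exp (0 + z * t)) \<partial>lborel)"
    unfolding Gamma_conv_nn_integral_real[OF r]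
    using z by (subst nn_integral_real_affine[where c=z and t=0]) auto
  also have "\<dots> = ennreal z * (ennreal (z powr (r - 1)) * (\<integral>\<^sup>+t. ennreal (exp (- t * z)) * gweight r t \<partial>lborel))"
    unfolding pt by (subst nn_integral_cmult) auto
  also have "\<dots> = ennreal (z powr r) * (\<integral>\<^sup>+t. ennreal (exp (- t * z)) * gweight r t \<partial>lborel)"
    using z by (simp add: mult.assoc[symmetric] powr_diff flip: ennreal_mult)
  finally have "ennreal (z powr (- r)) * ennreal (Gamma r) =
      ennreal (z powr (- r)) * ennreal (z powr r) * (\<integral>\<^sup>+t. ennreal (exp (- t * z)) * gweight r t \<partial>lborel)"
    by (simp add: mult.assoc)
  also have "ennreal (z powr (- r)) * ennreal (z powr r) = 1"
    using z by (simp add: powr_minus flip: ennreal_mult)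
  finally show ?thesis by (simp add: mult.commute)
qed

lemma integral_gweight_eq:
  fixes f :: "real \<Rightarrow> real"
  assumes [measurable]: "f \<in> borel_measurable borel"
    and nonneg: "AE t in lborel. 0 < t \<longrightarrow> 0 \<le> f t"
  shows "(LBINT t:{0<..}. f t * t powr (r - 1)) = enn2real (\<integral>\<^sup>+t. ennreal (f t) * gweight r t \<partial>lborel)"
proof -
  have "(LBINT t:{0<..}. f t * t powr (r - 1)) =
      enn2real (\<integral>\<^sup>+t. ennreal (indicator {0<..} t *\<^sub>R (f t * t powr (r - 1))) \<partial>lborel)"
    unfolding set_lebesgue_integral_def
    by (rule integral_eq_nn_integral) (use nonneg in \<open>auto simp: indicator_def\<close>)
  also have "(\<integral>\<^sup>+t. ennreal (indicator {0<..} t *\<^sub>R (f t * t powr (r - 1))) \<partial>lborel) =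
      (\<integral>\<^sup>+t. ennreal (f t) * gweight r t \<partial>lborel)"
    using nonneg by (intro nn_integral_cong_AE, eventually_elim) (auto simp: indicator_def ennreal_mult)
  finally show ?thesis .
qed

lemma tendsto_div_of_diff_tendsto:
  fixes x :: "nat \<Rightarrow> real"
  assumes "(\<lambda>n. x (Suc n) - x n) \<longlonglongrightarrow> L"
  shows "(\<lambda>n. x n / real n) \<longlonglongrightarrow> L"
proof (rule LIMSEQ_I)
  fix \<epsilon> :: real assume \<epsilon>: "0 < \<epsilon>"
  obtain N where N: "\<And>n. n \<ge> N \<Longrightarrow> \<bar>x (Suc n) - x n - L\<bar> < \<epsilon> / 2"
    using LIMSEQ_D[OF assms, of "\<epsilon> / 2"] \<epsilon> by auto
  define y where "y n = x n - real n * L" for n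
  have y: "\<bar>y (N + d)\<bar> \<le> \<bar>y N\<bar> + real d * (\<epsilon> / 2)" for d
  proof (induction d)
    case (Suc d)
    have "y (N + Suc d) = y (N + d) + (x (Suc (N + d)) - x (N + d) - L)"
      by (simp add: y_def algebra_simps)
    then have "\<bar>y (N + Suc d)\<bar> \<le> \<bar>y (N + d)\<bar> + \<epsilon> / 2"
      using N[of "N + d"] abs_triangle_ineq[of "y (N + d)" "x (Suc (N + d)) - x (N + d) - L"] by simp
    moreover have "real (Suc d) * (\<epsilon> / 2) = real d * (\<epsilon> / 2) + \<epsilon> / 2"
      by (simp add: algebra_simps add_divide_distrib)
    ultimately show ?case using Suc by linarith
  qed simp
  obtain n0 :: nat where n0: "2 * \<bar>y N\<bar> / \<epsilon> < real n0" using reals_Archimedean2 by blast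
  have "norm (x n / real n - L) < \<epsilon>" if n: "n \<ge> Suc (max N n0)" for n
  proof -
    have pos: "0 < real n" using n by simp
    obtain d where d: "n = N + d" using n by (metis le_iff_add max.boundedE Suc_leD)
    have "2 * \<bar>y N\<bar> / \<epsilon> < real n" using n0 n by linarith
    then have "\<bar>y N\<bar> < real n * (\<epsilon> / 2)" using \<epsilon> by (simp add: field_simps)
    moreover have "real d * (\<epsilon> / 2) \<le> real n * (\<epsilon> / 2)" using d \<epsilon> by (intro mult_right_mono) auto
    ultimately have "\<bar>y n\<bar> < real n * \<epsilon>" using y[of d] d by simp
    then have "\<bar>y n / real n\<bar> < \<epsilon>" using pos by (simp add: field_simps)
    moreover have "y n / real n = x n / real n - L" using pos by (simp add: y_def diff_divide_distrib)
    ultimately show ?thesis by simp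
  qed
  then show "\<exists>no. \<forall>n\<ge>no. norm (x n / real n - L) < \<epsilon>" by blast
qed

lemma nn_integral_monotone_limit:
  fixes f :: "nat \<Rightarrow> 'a \<Rightarrow> ennreal"
  assumes [measurable]: "\<And>n. f n \<in> borel_measurable N"
    and mono: "AE x in N. \<forall>n. f n x \<le> f (Suc n) x"
    and lim: "AE x in N. (\<lambda>n. f n x) \<longlonglongrightarrow> g x"
  shows "incseq (\<lambda>n. \<integral>\<^sup>+x. f n x \<partial>N)" "(\<lambda>n. \<integral>\<^sup>+x. f n x \<partial>N) \<longlonglongrightarrow> (\<integral>\<^sup>+x. g x \<partial>N)"
proof -
  show inc: "incseq (\<lambda>n. \<integral>\<^sup>+x. f n x \<partial>N)"
    using mono by (intro incseq_SucI nn_integral_mono_AE) auto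
  have "(\<integral>\<^sup>+x. g x \<partial>N) = (\<integral>\<^sup>+x. (SUP n. f n x) \<partial>N)"
    using lim mono
  proof (intro nn_integral_cong_AE, eventually_elim)
    case (elim x)
    then have "(\<lambda>n. f n x) \<longlonglongrightarrow> (SUP n. f n x)" by (intro LIMSEQ_SUP incseq_SucI) auto
    with elim show ?case by (intro LIMSEQ_unique)
  qed
  also have "\<dots> = (SUP n. \<integral>\<^sup>+x. f n x \<partial>N)"
    by (rule nn_integral_monotone_convergence_SUP_AE) (use mono in auto)
  finally show "(\<lambda>n. \<integral>\<^sup>+x. f n x \<partial>N) \<longlonglongrightarrow> (\<integral>\<^sup>+x. g x \<partial>N)"
    using LIMSEQ_SUP[OF inc] by simp
qed

context bpre
begin

lemma annE_eq_alaw: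
  fixes h :: "nat \<Rightarrow> real"
  assumes h: "\<And>j. 0 \<le> h j" "\<And>j. h j \<le> 1"
  shows "ennreal (annE M p (\<lambda>\<xi> \<omega>. h (Zpr k \<omega> n))) = (\<integral>\<^sup>+j. ennreal (h j) \<partial>alaw n k)"
proof -
  have inner: "ennreal (\<integral>\<omega>. h (Zpr k \<omega> n) \<partial>qlaw p \<xi>) = (\<integral>\<^sup>+\<omega>. ennreal (h (Zpr k \<omega> n)) \<partial>qlaw p \<xi>)" for \<xi>
  proof -
    interpret Q: prob_space "qlaw p \<xi>" by (rule prob_space_qlaw)
    have "(\<lambda>\<omega>. h (Zpr k \<omega> n)) \<in> borel_measurable (qlaw p \<xi>)" by measurable
    then show ?thesis
      by (intro nn_integral_eq_integral[symmetric] Q.integrable_const_bound[where B=1]) (auto simp: h)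
  qed
  have le1: "(\<integral>\<omega>. h (Zpr k \<omega> n) \<partial>qlaw p \<xi>) \<le> 1" for \<xi>
  proof -
    interpret Q: prob_space "qlaw p \<xi>" by (rule prob_space_qlaw)
    have "ennreal (\<integral>\<omega>. h (Zpr k \<omega> n) \<partial>qlaw p \<xi>) \<le> (\<integral>\<^sup>+\<omega>. 1 \<partial>qlaw p \<xi>)"
      unfolding inner by (intro nn_integral_mono) (simp add: h)
    then show ?thesis by (simp add: Q.emeasure_space_1[simplified])
  qed
  have [measurable]: "(\<lambda>\<xi>. \<integral>\<omega>. h (Zpr k \<omega> n) \<partial>qlaw p \<xi>) \<in> borel_measurable (envP M)"
    by (rule measurable_compose[OF qlaw_subprob]) (rule integral_measurable_subprob_algebra, measurable)
  have "ennreal (annE M p (\<lambda>\<xi> \<omega>. h (Zpr k \<omega> n))) = (\<integral>\<^sup>+\<xi>. ennreal (\<integral>\<omega>. h (Zpr k \<omega> n) \<partial>qlaw p \<xi>) \<partial>envP M)"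
    unfolding annE_def
    by (intro nn_integral_eq_integral[symmetric] env.integrable_const_bound[where B=1])
      (auto simp: h le1)
  also have "\<dots> = (\<integral>\<^sup>+j. ennreal (h j) \<partial>alaw n k)"
    unfolding inner nn_integral_Zpr[where h="\<lambda>j. ennreal (h j)"] by (rule nn_integral_zlaw_envP)
  finally show ?thesis .
qed

lemma phiN_laplace:
  assumes "good_env p \<xi>" and k: "1 \<le> k" and r: "0 < r"
  shows "(\<integral>\<^sup>+t. phiN p \<xi> k n t * gweight r t \<partial>lborel) =
    ennreal (Gamma r) * (ennreal (Pin p \<xi> n powr r) * (\<integral>\<^sup>+j. ennreal (real j powr (- r)) \<partial>zlaw (\<lambda>i. p (\<xi> i)) n k))"
proof -
  interpret good_env p \<xi> by fact
  have P: "0 < Pin p \<xi> n" by (rule Pin_pos)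
  have "(\<integral>\<^sup>+t. phiN p \<xi> k n t * gweight r t \<partial>lborel) =
     (\<integral>\<^sup>+t. \<integral>\<^sup>+j. ennreal (exp (- t * (real j / Pin p \<xi> n))) * gweight r t \<partial>zlaw (\<lambda>i. p (\<xi> i)) n k \<partial>lborel)"
    unfolding phiN_def nn_integral_Zpr[where h="\<lambda>j. ennreal (exp (- _ * (real j / Pin p \<xi> n)))"]
    by (simp add: nn_integral_multc)
  also have "\<dots> = (\<integral>\<^sup>+j. \<integral>\<^sup>+t. ennreal (exp (- t * (real j / Pin p \<xi> n))) * gweight r t \<partial>lborel \<partial>zlaw (\<lambda>i. p (\<xi> i)) n k)"
    by (rule nn_integral_pmf_swap) measurable
  also have "\<dots> = (\<integral>\<^sup>+j. ennreal (Gamma r) * (ennreal (Pin p \<xi> n powr r) * ennreal (real j powr (- r))) \<partial>zlaw (\<lambda>i. p (\<xi> i)) n k)"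
  proof (intro nn_integral_cong_AE AE_pmfI)
    fix j assume "j \<in> set_pmf (zlaw (\<lambda>i. p (\<xi> i)) n k)"
    then have "k \<le> j" using set_zlaw_ge[of "\<lambda>i. p (\<xi> i)" j n k] pmf_0 by (auto simp: set_pmf_iff)
    then have j: "0 < real j" using k by simp
    have "(real j / Pin p \<xi> n) powr (- r) = Pin p \<xi> n powr r * real j powr (- r)"
      using j P by (simp add: powr_divide powr_minus field_simps)
    then show "(\<integral>\<^sup>+t. ennreal (exp (- t * (real j / Pin p \<xi> n))) * gweight r t \<partial>lborel) =
        ennreal (Gamma r) * (ennreal (Pin p \<xi> n powr r) * ennreal (real j powr (- r)))"
      using j P by (subst nn_integral_exp_gweight[OF r]) (auto simp flip: ennreal_mult)
  qed
  also have "\<dots> = ennreal (Gamma r) * (ennreal (Pin p \<xi> n powr r) * (\<integral>\<^sup>+j. ennreal (real j powr (- r)) \<partial>zlaw (\<lambda>i. p (\<xi> i)) n k))"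
    by (simp add: nn_integral_cmult)
  finally show ?thesis .
qed

end

context bpre_supercritical
begin

lemma nn_integral_tilt:
  assumes [measurable]: "f \<in> borel_measurable M"
  shows "(\<integral>\<^sup>+x. f x \<partial>tilt M p r) = (\<integral>\<^sup>+x. ennreal (mean p x powr (- r) / cr M p r) * f x \<partial>M)"
  unfolding tilt_def by (rule nn_integral_density) measurable

lemma sets_tilt [measurable_cong, simp]: "sets (tilt M p r) = sets M"
  unfolding tilt_def by simp

lemma AE_tilt: "AE x in M. P x \<Longrightarrow> AE x in tilt M p r. P x"
  unfolding tilt_def by (subst AE_density) auto

lemma bpre_tilt:
  assumes r: "0 \<le> r"
  shows "bpre (tilt M p r) p"
proof -
  have "(\<integral>\<^sup>+x. ennreal (mean p x powr (- r) / cr M p r) \<partial>M) = ennreal (1 / cr M p r) * (\<integral>\<^sup>+x. ennreal (mean p x powr (- r)) \<partial>M)"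
    using cr_pos[OF r] by (subst nn_integral_cmult[symmetric]) (auto simp flip: ennreal_mult)
  also have "\<dots> = 1"
    using cr_pos[OF r] by (simp add: ennreal_cr[OF r, symmetric] flip: ennreal_mult)
  finally have "emeasure (tilt M p r) (space (tilt M p r)) = 1"
    unfolding tilt_def by (simp add: emeasure_density cong: nn_integral_cong)
  then interpret T: prob_space "tilt M p r" by (rule prob_spaceI)
  show ?thesis
  proof
    show "(\<lambda>x. pmf (p x) i) \<in> borel_measurable (tilt M p r)" for i
      using pmf_measurable[of i] by (simp add: measurable_cong_sets[OF sets_tilt refl])
    show "AE x in tilt M p r. pmf (p x) 0 = 0" by (rule AE_tilt[OF AE_pmf_0])
    show "AE x in tilt M p r. integrable (measure_pmf (p x)) real" by (rule AE_tilt[OF AE_mean_fin])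
  qed
qed

lemma change_of_environment:
  fixes h :: "nat \<Rightarrow> ennreal"
  assumes r: "0 \<le> r"
  shows "(\<integral>\<^sup>+\<xi>. ennreal (Pin p \<xi> n powr r) * (\<integral>\<^sup>+j. h j \<partial>zlaw (\<lambda>i. p (\<xi> i)) n k) \<partial>envP (tilt M p r)) =
    ennreal (1 / cr M p r ^ n) * (\<integral>\<^sup>+j. h j \<partial>alaw n k)"
proof -
  interpret T: bpre "tilt M p r" p by (rule bpre_tilt[OF r])
  note c = cr_pos[OF r]
  show ?thesis
  proof (induction n arbitrary: k)
    case 0
    then show ?case by (simp add: Pin_def T.env.emeasure_space_1)
  next
    case (Suc n)
    let ?H = "\<lambda>\<xi> z. \<integral>\<^sup>+j. h j \<partial>zlaw (\<lambda>i. p (\<xi> i)) n z"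
    have Pin: "Pin p (case_nat x \<xi>) (Suc n) powr r = mean p x powr r * Pin p \<xi> n powr r" for x \<xi>
      unfolding Pin_def prod.lessThan_Suc_shift by (simp add: powr_mult mean_def prod_nonneg)
    have "(\<integral>\<^sup>+\<xi>. ennreal (Pin p \<xi> (Suc n) powr r) * (\<integral>\<^sup>+j. h j \<partial>zlaw (\<lambda>i. p (\<xi> i)) (Suc n) k) \<partial>envP (tilt M p r)) =
      (\<integral>\<^sup>+x. \<integral>\<^sup>+\<xi>. ennreal (Pin p (case_nat x \<xi>) (Suc n) powr r) *
        (\<integral>\<^sup>+j. h j \<partial>zlaw (\<lambda>i. p ((case_nat x \<xi>) i)) (Suc n) k) \<partial>envP (tilt M p r) \<partial>tilt M p r)"
      by (rule T.nn_integral_envP_Suc) (intro borel_measurable_times_ennreal T.nn_integral_zlaw_measurable, measurable)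
    also have "\<dots> = (\<integral>\<^sup>+x. \<integral>\<^sup>+\<xi>. \<integral>\<^sup>+z. ennreal (mean p x powr r) * (ennreal (Pin p \<xi> n powr r) * ?H \<xi> z)
        \<partial>iid_sum (p x) k \<partial>envP (tilt M p r) \<partial>tilt M p r)"
      unfolding Pin by (simp add: nn_integral_cmult ennreal_mult mult.assoc)
    also have "\<dots> = (\<integral>\<^sup>+x. \<integral>\<^sup>+z. \<integral>\<^sup>+\<xi>. ennreal (mean p x powr r) * (ennreal (Pin p \<xi> n powr r) * ?H \<xi> z)
        \<partial>envP (tilt M p r) \<partial>iid_sum (p x) k \<partial>tilt M p r)"
      by (intro nn_integral_cong nn_integral_pmf_swap) measurable
    also have "\<dots> = (\<integral>\<^sup>+x. ennreal (mean p x powr r) * (ennreal (1 / cr M p r ^ n) *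
        (\<integral>\<^sup>+z. (\<integral>\<^sup>+j. h j \<partial>alaw n z) \<partial>iid_sum (p x) k)) \<partial>tilt M p r)"
      by (simp add: nn_integral_cmult Suc.IH)
    also have "\<dots> = (\<integral>\<^sup>+x. ennreal (mean p x powr (- r) / cr M p r) * (ennreal (mean p x powr r) * (ennreal (1 / cr M p r ^ n) *
        (\<integral>\<^sup>+z. (\<integral>\<^sup>+j. h j \<partial>alaw n z) \<partial>iid_sum (p x) k))) \<partial>M)"
      by (rule nn_integral_tilt) measurable
    also have "\<dots> = (\<integral>\<^sup>+x. ennreal (1 / cr M p r ^ Suc n) *
        (\<integral>\<^sup>+z. (\<integral>\<^sup>+j. h j \<partial>alaw n z) \<partial>iid_sum (p x) k) \<partial>M)"
    proof (intro nn_integral_cong_AE)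
      show "AE x in M. ennreal (mean p x powr (- r) / cr M p r) * (ennreal (mean p x powr r) * (ennreal (1 / cr M p r ^ n) *
        (\<integral>\<^sup>+z. (\<integral>\<^sup>+j. h j \<partial>alaw n z) \<partial>iid_sum (p x) k))) = ennreal (1 / cr M p r ^ Suc n) *
        (\<integral>\<^sup>+z. (\<integral>\<^sup>+j. h j \<partial>alaw n z) \<partial>iid_sum (p x) k)"
        using AE_mean_ge_1
      proof eventually_elim
        case (elim x)
        then have "ennreal (mean p x powr (- r) / cr M p r) * ennreal (mean p x powr r) * ennreal (1 / cr M p r ^ n) =
            ennreal (1 / cr M p r ^ Suc n)"
          using c by (simp add: powr_minus flip: ennreal_mult)
        then show ?case by (simp add: mult.assoc[symmetric])
      qed
    qed
    also have "\<dots> = ennreal (1 / cr M p r ^ Suc n) * (\<integral>\<^sup>+j. h j \<partial>alaw (Suc n) k)"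
      by (simp add: nn_integral_cmult nn_integral_akern)
    finally show ?case .
  qed
qed

text \<open>The harmonic moment of \<open>Z\<^sub>n\<close>, normalised by \<open>c\<^sub>r\<^sup>n\<close>, is the harmonic moment of
  \<open>W\<^sub>n\<close> under the tilted law.\<close>

definition norm_moment :: "real \<Rightarrow> nat \<Rightarrow> nat \<Rightarrow> ennreal" where
  "norm_moment r n k = ennreal (1 / cr M p r ^ n) * (\<integral>\<^sup>+j. ennreal (real j powr (- r)) \<partial>alaw n k)"

lemma norm_moment_laplace:
  assumes r: "0 < r" and k: "1 \<le> k"
  shows "(\<integral>\<^sup>+\<xi>. \<integral>\<^sup>+t. phiN p \<xi> k n t * gweight r t \<partial>lborel \<partial>envP (tilt M p r)) = ennreal (Gamma r) * norm_moment r n k"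
proof -
  interpret T: bpre "tilt M p r" p using r by (intro bpre_tilt) simp
  have "(\<integral>\<^sup>+\<xi>. \<integral>\<^sup>+t. phiN p \<xi> k n t * gweight r t \<partial>lborel \<partial>envP (tilt M p r)) =
    (\<integral>\<^sup>+\<xi>. ennreal (Gamma r) * (ennreal (Pin p \<xi> n powr r) * (\<integral>\<^sup>+j. ennreal (real j powr (- r)) \<partial>zlaw (\<lambda>i. p (\<xi> i)) n k)) \<partial>envP (tilt M p r))"
    by (intro nn_integral_cong_AE, use T.AE_good_env in eventually_elim) (rule phiN_laplace[OF _ k r])
  also have "\<dots> = ennreal (Gamma r) * norm_moment r n k"
    unfolding norm_moment_def change_of_environment[OF less_imp_le[OF r], symmetric]
    by (rule nn_integral_cmult) measurable
  finally show ?thesis .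
qed

lemma norm_moment_limit:
  assumes r: "0 < r" and k: "1 \<le> k"
  shows "incseq (\<lambda>n. norm_moment r n k)"
    and "(\<lambda>n. ennreal (Gamma r) * norm_moment r n k) \<longlonglongrightarrow>
      (\<integral>\<^sup>+\<xi>. \<integral>\<^sup>+t. ennreal (phiW p \<xi> k t) * gweight r t \<partial>lborel \<partial>envP (tilt M p r))"
proof -
  interpret T: bpre "tilt M p r" p using r by (intro bpre_tilt) simp
  have [measurable]: "(\<lambda>t. phiN p \<xi> k n t) \<in> borel_measurable borel" for \<xi> n
    unfolding phiN_eq_zlaw nn_integral_measure_pmf nn_integral_count_space_nat by measurable
  have inner: "AE \<xi> in envP (tilt M p r). incseq (\<lambda>n. \<integral>\<^sup>+t. phiN p \<xi> k n t * gweight r t \<partial>lborel) \<and>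
    (\<lambda>n. \<integral>\<^sup>+t. phiN p \<xi> k n t * gweight r t \<partial>lborel) \<longlonglongrightarrow> (\<integral>\<^sup>+t. ennreal (phiW p \<xi> k t) * gweight r t \<partial>lborel)"
    using T.AE_good_env
  proof eventually_elim
    case (elim \<xi>)
    interpret good_env p \<xi> by fact
    have *: "AE t in lborel. (\<lambda>n. phiN p \<xi> k n t * gweight r t) \<longlonglongrightarrow> ennreal (phiW p \<xi> k t) * gweight r t"
    proof (rule AE_I2)
      fix t
      show "(\<lambda>n. phiN p \<xi> k n t * gweight r t) \<longlonglongrightarrow> ennreal (phiW p \<xi> k t) * gweight r t"
      proof (cases "0 < t")
        case True
        then have "(\<lambda>n. gweight r t * phiN p \<xi> k n t) \<longlonglongrightarrow> gweight r t * ennreal (phiW p \<xi> k t)"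
          by (intro ennreal_tendsto_cmult phiN_tendsto_phiW) auto
        then show ?thesis by (simp only: mult.commute)
      qed simp
    qed
    have **: "AE t in lborel. \<forall>n. phiN p \<xi> k n t * gweight r t \<le> phiN p \<xi> k (Suc n) t * gweight r t"
      using phiN_le_Suc by (intro AE_I2 allI mult_right_mono) auto
    have "(\<lambda>t. phiN p \<xi> k n t * gweight r t) \<in> borel_measurable lborel" for n by measurable
    from nn_integral_monotone_limit[where f="\<lambda>n t. phiN p \<xi> k n t * gweight r t" and N=lborel, OF this ** *]
    show ?case by blast
  qed
  have [measurable]: "(\<lambda>\<xi>. \<integral>\<^sup>+t. phiN p \<xi> k n t * gweight r t \<partial>lborel) \<in> borel_measurable (envP (tilt M p r))" for n
    using T.phiN_measurable[of k n] by measurable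
  note lim = nn_integral_monotone_limit[of "\<lambda>n \<xi>. \<integral>\<^sup>+t. phiN p \<xi> k n t * gweight r t \<partial>lborel" "envP (tilt M p r)"
      "\<lambda>\<xi>. \<integral>\<^sup>+t. ennreal (phiW p \<xi> k t) * gweight r t \<partial>lborel", unfolded norm_moment_laplace[OF r k]]
  have inc: "AE \<xi> in envP (tilt M p r). \<forall>n. (\<integral>\<^sup>+t. phiN p \<xi> k n t * gweight r t \<partial>lborel) \<le> (\<integral>\<^sup>+t. phiN p \<xi> k (Suc n) t * gweight r t \<partial>lborel)"
    using inner by eventually_elim (auto dest: incseq_SucD)
  have conv: "AE \<xi> in envP (tilt M p r). (\<lambda>n. \<integral>\<^sup>+t. phiN p \<xi> k n t * gweight r t \<partial>lborel) \<longlonglongrightarrow> (\<integral>\<^sup>+t. ennreal (phiW p \<xi> k t) * gweight r t \<partial>lborel)"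
    using inner by eventually_elim auto
  show "(\<lambda>n. ennreal (Gamma r) * norm_moment r n k) \<longlonglongrightarrow>
      (\<integral>\<^sup>+\<xi>. \<integral>\<^sup>+t. ennreal (phiW p \<xi> k t) * gweight r t \<partial>lborel \<partial>envP (tilt M p r))"
    using inc conv by (intro lim(2)) measurable
  have "incseq (\<lambda>n. ennreal (Gamma r) * norm_moment r n k)"
    using inc conv by (intro lim(1)) measurable
  then have "incseq (\<lambda>n. ennreal (1 / Gamma r) * (ennreal (Gamma r) * norm_moment r n k))"
    unfolding incseq_def by (blast intro: mult_left_mono zero_le)
  moreover have "ennreal (1 / Gamma r) * (ennreal (Gamma r) * x) = x" for x
  proof -
    have "ennreal (1 / Gamma r) * ennreal (Gamma r) = 1"
      using Gamma_real_pos[OF r] by (simp flip: ennreal_mult)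
    then show ?thesis by (simp add: mult.assoc[symmetric])
  qed
  ultimately show "incseq (\<lambda>n. norm_moment r n k)" by simp
qed

end

section \<open>The three regimes\<close>

lemma scaled_limit_of_bounded_incseq:
  fixes a :: "nat \<Rightarrow> real"
  assumes G: "0 < G" and a: "\<And>n. 0 \<le> a n" "incseq a" "\<And>n. a n \<le> C" "0 < a 0"
    and lim: "(\<lambda>n. ennreal G * ennreal (a n)) \<longlonglongrightarrow> F"
  shows "F < \<infinity>" "a \<longlonglongrightarrow> enn2real F / G" "0 < enn2real F / G"
proof -
  have "F \<le> ennreal (G * C)"
    using lim by (rule LIMSEQ_le_const2) (use G a in \<open>auto simp flip: ennreal_mult intro!: ennreal_leI\<close>)
  then show fin: "F < \<infinity>" by (rule le_less_trans) simp
  then obtain f where f: "F = ennreal f" "0 \<le> f" by (cases F) auto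
  have "(\<lambda>n. ennreal (G * a n)) \<longlonglongrightarrow> ennreal f"
    using lim G a(1) f by (simp add: ennreal_mult)
  then have "(\<lambda>n. G * a n) \<longlonglongrightarrow> f" using G a f by simp
  then have "(\<lambda>n. G * a n / G) \<longlonglongrightarrow> f / G" using G by (intro tendsto_divide) auto
  then show conv: "a \<longlonglongrightarrow> enn2real F / G" using G f by simp
  show "0 < enn2real F / G"
    using incseq_le[OF a(2) conv, of 0] a(4) by simp
qed

context bpre
begin

lemma Gf_measurable [measurable]: "Gf M p k n \<in> borel_measurable borel"
proof -
  have [measurable]: "(\<lambda>z :: real \<times> (nat \<Rightarrow> 'e). \<integral>\<omega>. fst z ^ Zpr k \<omega> n \<partial>qlaw p (snd z)) \<in> borel_measurable (borel \<Otimes>\<^sub>M envP M)"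
  proof (rule integral_measurable_subprob_algebra2)
    show "(\<lambda>z. qlaw p (snd z)) \<in> borel \<Otimes>\<^sub>M envP M \<rightarrow>\<^sub>M subprob_algebra offspring_space" by measurable
    have "(\<lambda>z :: (real \<times> (nat \<Rightarrow> 'e)) \<times> (nat \<times> nat \<Rightarrow> nat). fst (fst z) ^ Zpr k (snd z) n) \<in> borel_measurable ((borel \<Otimes>\<^sub>M envP M) \<Otimes>\<^sub>M offspring_space)"
    proof (rule measurable_compose_countable[where f="\<lambda>j (z :: (real \<times> (nat \<Rightarrow> 'e)) \<times> (nat \<times> nat \<Rightarrow> nat)). fst (fst z) ^ j"])
      show "(\<lambda>z. (fst (fst z) :: real) ^ j) \<in> borel_measurable ((borel \<Otimes>\<^sub>M envP M) \<Otimes>\<^sub>M offspring_space)" for j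
        by (intro borel_measurable_power measurable_compose[OF measurable_fst measurable_fst])
      show "(\<lambda>z. Zpr k (snd z) n) \<in> (borel \<Otimes>\<^sub>M envP M) \<Otimes>\<^sub>M offspring_space \<rightarrow>\<^sub>M count_space UNIV"
        by (rule measurable_compose[OF measurable_snd measurable_Zpr])
    qed
    then show "(\<lambda>(z :: real \<times> (nat \<Rightarrow> 'e), \<omega>). fst z ^ Zpr k \<omega> n) \<in> borel_measurable ((borel \<Otimes>\<^sub>M envP M) \<Otimes>\<^sub>M offspring_space)"
      by (simp add: case_prod_unfold)
  qed
  show ?thesis
    unfolding Gf_def[abs_def] annE_def
    by (rule env.borel_measurable_lebesgue_integral) (simp add: case_prod_unfold)
qed

lemma Gf_eq_alaw:
  assumes "0 \<le> s" "s \<le> 1"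
  shows "ennreal (Gf M p k n s) = (\<integral>\<^sup>+j. ennreal (s ^ j) \<partial>alaw n k)"
  unfolding Gf_def by (rule annE_eq_alaw) (use assms in \<open>auto simp: power_le_one\<close>)

lemma Gf_nonneg: "0 \<le> s \<Longrightarrow> 0 \<le> Gf M p k n s"
  unfolding Gf_def annE_def by simp

lemma gam_nonneg: "0 \<le> gam M p k"
  unfolding gam_def by simp

lemma alaw_1: "alaw (Suc 0) k = akern k"
  unfolding alaw_Suc_last by (simp add: bind_return_pmf)

lemma Gbar_eq:
  assumes s: "0 \<le> s" "s \<le> 1"
  shows "ennreal (Gbar M p k s) = (\<integral>\<^sup>+j. ennreal (s ^ j) * indicator {k<..} j \<partial>akern k)"
    and "0 \<le> Gbar M p k s"
proof -
  let ?R = "\<integral>\<^sup>+j. ennreal (s ^ j) * indicator {k<..} j \<partial>akern k"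
  have "ennreal (Gf M p k 1 s) = ennreal (gam M p k) * ennreal (s ^ k) + ?R"
    unfolding Gf_eq_alaw[OF s] One_nat_def alaw_1 by (rule nn_integral_akern_split)
  then have eq: "ennreal (Gf M p k 1 s) = ennreal (gam M p k * s ^ k) + ?R"
    using s by (simp add: ennreal_mult gam_nonneg)
  then have "?R \<noteq> \<top>" by (metis ennreal_add_eq_top ennreal_neq_top)
  then obtain R where R: "?R = ennreal R" "0 \<le> R" by (cases ?R) auto
  have "Gf M p k 1 s = gam M p k * s ^ k + R"
    using eq R s Gf_nonneg[OF s(1)] gam_nonneg[of k] by (simp flip: ennreal_plus)
  then have "Gbar M p k s = R" unfolding Gbar_def by simp
  then show "ennreal (Gbar M p k s) = ?R" "0 \<le> Gbar M p k s" using R by simp_all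
qed

lemma nn_integral_alaw_Suc_split:
  fixes h :: "nat \<Rightarrow> ennreal"
  shows "(\<integral>\<^sup>+i. h i \<partial>alaw (Suc n) k) = ennreal (gam M p k) * (\<integral>\<^sup>+i. h i \<partial>alaw n k) +
    (\<integral>\<^sup>+j. (\<integral>\<^sup>+i. h i \<partial>alaw n j) * indicator {k<..} j \<partial>akern k)"
  by (simp add: nn_integral_akern_split[where h="\<lambda>j. \<integral>\<^sup>+i. h i \<partial>alaw n j"])


definition hmoment :: "real \<Rightarrow> nat \<Rightarrow> nat \<Rightarrow> real" where
  "hmoment r n k = annE M p (\<lambda>\<xi> \<omega>. real (Zpr k \<omega> n) powr (- r))"

lemma hmoment_eq_alaw:
  assumes "0 < r"
  shows "ennreal (hmoment r n k) = (\<integral>\<^sup>+j. ennreal (real j powr (- r)) \<partial>alaw n k)"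
  unfolding hmoment_def
proof (rule annE_eq_alaw)
  show "real j powr (- r) \<le> 1" for j :: nat
    using powr_mono2'[of "- r" 1 "real j"] assms by (cases "j = 0") auto
qed simp

lemma hmoment_nonneg: "0 \<le> hmoment r n k"
  unfolding hmoment_def annE_def by simp

lemma hmoment_0:
  assumes "0 < r"
  shows "hmoment r 0 k = real k powr (- r)"
  using hmoment_eq_alaw[OF assms, where n=0 and k=k] hmoment_nonneg[where r=r and n=0 and k=k] by simp

end

context bpre_supercritical
begin

lemma norm_moment_eq:
  assumes "0 < r"
  shows "norm_moment r n k = ennreal (hmoment r n k / cr M p r ^ n)"
  unfolding norm_moment_def hmoment_eq_alaw[OF assms, symmetric]
  using cr_pos[of r] assms hmoment_nonneg by (simp flip: ennreal_mult)

lemma norm_moment_bound: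
  assumes k: "1 \<le> k" and r: "0 < r" and less: "gam M p k < cr M p r"
  obtains C where "0 \<le> C" "\<And>j n. k \<le> j \<Longrightarrow> norm_moment r n j \<le> ennreal C"
proof -
  obtain C where C: "0 \<le> C"
    "\<And>j n. k \<le> j \<Longrightarrow> (\<integral>\<^sup>+i. ennreal (real i powr (- r)) \<partial>alaw n j) \<le> ennreal (C * cr M p r ^ n)"
    using harmonic_moment_sharp_bound[OF k r less] by auto
  have "norm_moment r n j \<le> ennreal C" if "k \<le> j" for j n
  proof -
    have "norm_moment r n j \<le> ennreal (1 / cr M p r ^ n) * ennreal (C * cr M p r ^ n)"
      unfolding norm_moment_def by (intro mult_left_mono C(2) that) auto
    also have "\<dots> = ennreal C"
      using cr_pos[of r] r C(1) by (simp flip: ennreal_mult)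
    finally show ?thesis .
  qed
  with C(1) show thesis by (rule that)
qed

lemma hmoment_limit_subcritical_exponent:
  assumes k: "1 \<le> k" and r: "0 < r" and less: "gam M p k < cr M p r"
  defines "L \<equiv> (1 / Gamma r) * (LBINT t:{0<..}. phir M p r k t * t powr (r - 1))"
  shows "0 < L" "(\<lambda>n. hmoment r n k / cr M p r ^ n) \<longlonglongrightarrow> L"
proof -
  interpret T: bpre "tilt M p r" p using r by (intro bpre_tilt) simp
  interpret TL: pair_sigma_finite "envP (tilt M p r)" lborel ..
  let ?a = "\<lambda>n. hmoment r n k / cr M p r ^ n"
  define F where "F = (\<integral>\<^sup>+\<xi>. \<integral>\<^sup>+t. ennreal (phiW p \<xi> k t) * gweight r t \<partial>lborel \<partial>envP (tilt M p r))"
  obtain C where C: "0 \<le> C" "\<And>j n. k \<le> j \<Longrightarrow> norm_moment r n j \<le> ennreal C"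
    using norm_moment_bound[OF k r less] by auto
  have a0: "0 \<le> ?a n" for n using hmoment_nonneg cr_pos[of r] r by simp
  have inc: "incseq ?a"
    using norm_moment_limit(1)[OF r k] a0 unfolding norm_moment_eq[OF r] incseq_def
    by (simp add: ennreal_le_iff)
  have bound: "?a n \<le> C" for n
    using C(2)[OF order_refl, of n] C(1) unfolding norm_moment_eq[OF r] by simp
  have pos: "0 < ?a 0" using hmoment_0[OF r, of k] k by simp
  have lim: "(\<lambda>n. ennreal (Gamma r) * ennreal (?a n)) \<longlonglongrightarrow> F"
    using norm_moment_limit(2)[OF r k] unfolding norm_moment_eq[OF r] F_def .
  note * = scaled_limit_of_bounded_incseq[where a="?a", OF Gamma_real_pos[OF r] a0 inc bound pos lim]
  have meas: "(\<lambda>z. phiW p (snd z) k (fst z)) \<in> borel_measurable (borel \<Otimes>\<^sub>M envP (tilt M p r))"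
    using measurable_compose[OF measurable_pair_swap' T.phiW_measurable[of k]] by (simp add: case_prod_unfold)
  have phir: "phir M p r k t = (\<integral>\<xi>. phiW p \<xi> k t \<partial>envP (tilt M p r))" for t
    unfolding phir_def annE_def phiW_def ..
  have [measurable]: "phir M p r k \<in> borel_measurable borel"
    unfolding phir[abs_def] by (rule T.env.borel_measurable_lebesgue_integral) (use meas in \<open>simp add: case_prod_unfold\<close>)
  have phir_nonneg: "0 \<le> phir M p r k t" for t
    unfolding phir by (rule integral_nonneg_AE, use T.AE_good_env in eventually_elim) (rule good_env.phiW_nonneg)
  have phir_nn: "ennreal (phir M p r k t) = (\<integral>\<^sup>+\<xi>. ennreal (phiW p \<xi> k t) \<partial>envP (tilt M p r))" if "0 \<le> t" for t
  proof -
    have m: "(\<lambda>\<xi>. phiW p \<xi> k t) \<in> borel_measurable (envP (tilt M p r))"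
      using measurable_compose[OF measurable_Pair2'[of t borel] T.phiW_measurable[of k]] by simp
    have nn: "AE \<xi> in envP (tilt M p r). 0 \<le> phiW p \<xi> k t"
      using T.AE_good_env by eventually_elim (rule good_env.phiW_nonneg)
    have "integrable (envP (tilt M p r)) (\<lambda>\<xi>. phiW p \<xi> k t)"
    proof (rule T.env.integrable_const_bound[OF _ m])
      show "AE \<xi> in envP (tilt M p r). norm (phiW p \<xi> k t) \<le> 1"
        using T.AE_good_env by eventually_elim (simp add: good_env.phiW_nonneg good_env.phiW_le_1 that)
    qed
    then show ?thesis unfolding phir by (rule nn_integral_eq_integral[symmetric]) (rule nn)
  qed
  have "(\<integral>\<^sup>+t. ennreal (phir M p r k t) * gweight r t \<partial>lborel) =
      (\<integral>\<^sup>+t. \<integral>\<^sup>+\<xi>. ennreal (phiW p \<xi> k t) * gweight r t \<partial>envP (tilt M p r) \<partial>lborel)"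
  proof (intro nn_integral_cong)
    fix t
    have m: "(\<lambda>\<xi>. ennreal (phiW p \<xi> k t)) \<in> borel_measurable (envP (tilt M p r))"
      using measurable_compose[OF measurable_Pair2'[of t borel] T.phiW_measurable[of k]] by simp
    show "ennreal (phir M p r k t) * gweight r t = (\<integral>\<^sup>+\<xi>. ennreal (phiW p \<xi> k t) * gweight r t \<partial>envP (tilt M p r))"
      unfolding nn_integral_multc[OF m] by (cases "0 < t") (auto simp: phir_nn)
  qed
  also have "\<dots> = F"
  proof -
    have "(\<lambda>z. ennreal (phiW p (fst z) k (snd z)) * gweight r (snd z)) \<in> borel_measurable (envP (tilt M p r) \<Otimes>\<^sub>M lborel)"
      using T.phiW_measurable[of k] by measurable
    from TL.Fubini[OF this] show ?thesis unfolding F_def by simp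
  qed
  finally have "L = enn2real F / Gamma r"
    unfolding L_def by (subst integral_gweight_eq) (auto simp: phir_nonneg)
  with * show "0 < L" "?a \<longlonglongrightarrow> L" by simp_all
qed

lemma hmoment_limit_critical_exponent:
  assumes k: "1 \<le> k" and r: "0 < r" and eq: "gam M p k = cr M p r" and less: "gam M p (Suc k) < cr M p r"
  defines "L \<equiv> (inverse (gam M p k) / Gamma r) * annE (tilt M p r) p
    (\<lambda>\<xi> \<omega>. LBINT t:{0<..}. Gbar M p k (phiq p \<xi> t) * t powr (r - 1))"
  shows "0 < L" "(\<lambda>n. hmoment r n k / (real n * gam M p k ^ n)) \<longlonglongrightarrow> L"
proof -
  interpret T: bpre "tilt M p r" p using r by (intro bpre_tilt) simp
  let ?M' = "tilt M p r"
  define \<gamma> where "\<gamma> = gam M p k"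
  have \<gamma>: "0 < \<gamma>" "\<gamma> < 1" "cr M p r = \<gamma>"
    using cr_pos[of r] cr_strict_antimono[of 0 r] r eq integrable_mean_powr[of 0]
  proof -
    have "cr M p 0 \<le> (\<integral>x. 1 \<partial>M)" unfolding cr_def by (intro integral_mono) (use integrable_mean_powr[of 0] in auto)
    then show "\<gamma> < 1" using cr_strict_antimono[of 0 r] r eq unfolding \<gamma>_def by (simp add: prob_space)
  qed (auto simp: \<gamma>_def)
  obtain C where C: "0 \<le> C" "\<And>j n. Suc k \<le> j \<Longrightarrow> norm_moment r n j \<le> ennreal C"
    using norm_moment_bound[OF _ r less] by auto
  define D where "D n = (\<integral>\<^sup>+j. norm_moment r n j * indicator {k<..} j \<partial>akern k)" for n
  define F where "F = (\<integral>\<^sup>+\<xi>. \<integral>\<^sup>+t. ennreal (Gbar M p k (phiq p \<xi> t)) * gweight r t \<partial>lborel \<partial>envP ?M')"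
  have phiq: "phiq p \<xi> t = phiW p \<xi> 1 t" for \<xi> t unfolding phiq_def phiW_def ..
  have D_le: "D n \<le> ennreal C" for n
  proof -
    have "D n \<le> (\<integral>\<^sup>+j. ennreal C \<partial>akern k)"
      unfolding D_def using C by (intro nn_integral_mono) (auto simp: indicator_def)
    then show ?thesis by (simp add: measure_pmf.emeasure_space_1[simplified])
  qed
  have D_fin: "ennreal (enn2real (D n)) = D n" for n
    by (intro ennreal_enn2real le_less_trans[OF D_le]) simp
  have D_mono: "incseq D"
  proof (rule incseq_SucI)
    fix n
    show "D n \<le> D (Suc n)"
      unfolding D_def
    proof (intro nn_integral_mono)
      fix j
      show "norm_moment r n j * indicator {k<..} j \<le> norm_moment r (Suc n) j * indicator {k<..} j"
        using incseq_SucD[OF norm_moment_limit(1)[OF r], of j n] k by (auto simp: indicator_def)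
    qed
  qed
  have D_0: "0 < D 0"
  proof (rule ccontr)
    assume "\<not> 0 < D 0"
    then have "AE j in akern k. norm_moment r 0 j * indicator {k<..} j = 0"
      unfolding D_def by (subst nn_integral_0_iff_AE[symmetric]) auto
    then have "AE j in akern k. j = k"
    proof (rule AE_mp, intro AE_pmfI impI)
      fix j assume "j \<in> set_pmf (akern k)" and z: "norm_moment r 0 j * indicator {k<..} j = 0"
      then have "k \<le> j" by (intro set_akern_ge)
      show "j = k"
      proof (rule ccontr)
        assume "j \<noteq> k"
        with \<open>k \<le> j\<close> have "k < j" by simp
        with z show False by (simp add: norm_moment_def)
      qed
    qed
    then have "measure_pmf.prob (akern k) {k} = 1"
      by (intro measure_pmf.prob_eq_1[THEN iffD2]) auto
    then have "pmf (akern k) k = 1" by (simp add: measure_pmf_single)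
    with \<gamma>(2) show False unfolding \<gamma>_def pmf_akern_same by simp
  qed
  have lim: "(\<lambda>n. ennreal (Gamma r) * D n) \<longlonglongrightarrow> F"
  proof -
    let ?I = "\<lambda>j. \<integral>\<^sup>+\<xi>. \<integral>\<^sup>+t. ennreal (phiW p \<xi> j t) * gweight r t \<partial>lborel \<partial>envP ?M'"
    have "(\<lambda>n. \<integral>\<^sup>+j. ennreal (Gamma r) * norm_moment r n j * indicator {k<..} j \<partial>akern k) \<longlonglongrightarrow>
        (\<integral>\<^sup>+j. ?I j * indicator {k<..} j \<partial>akern k)"
    proof (rule nn_integral_monotone_limit)
      show "AE j in akern k. \<forall>n. ennreal (Gamma r) * norm_moment r n j * indicator {k<..} j
          \<le> ennreal (Gamma r) * norm_moment r (Suc n) j * indicator {k<..} j"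
      proof (intro AE_I2 allI)
        fix j n
        show "ennreal (Gamma r) * norm_moment r n j * indicator {k<..} j
          \<le> ennreal (Gamma r) * norm_moment r (Suc n) j * indicator {k<..} j"
          using incseq_SucD[OF norm_moment_limit(1)[OF r], of j n] k
          by (auto simp: indicator_def intro: mult_left_mono)
      qed
      show "AE j in akern k. (\<lambda>n. ennreal (Gamma r) * norm_moment r n j * indicator {k<..} j) \<longlonglongrightarrow> ?I j * indicator {k<..} j"
      proof (rule AE_I2)
        fix j
        show "(\<lambda>n. ennreal (Gamma r) * norm_moment r n j * indicator {k<..} j) \<longlonglongrightarrow> ?I j * indicator {k<..} j"
          using norm_moment_limit(2)[OF r, of j] k by (cases "k < j") auto
      qed
    qed simp
    moreover have "(\<integral>\<^sup>+j. ennreal (Gamma r) * norm_moment r n j * indicator {k<..} j \<partial>akern k) = ennreal (Gamma r) * D n" for n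
      unfolding D_def by (simp add: nn_integral_cmult mult.assoc)
    moreover have "(\<integral>\<^sup>+j. ?I j * indicator {k<..} j \<partial>akern k) = F"
    proof -
      have m1: "(\<lambda>\<xi>. \<integral>\<^sup>+t. ennreal (phiW p \<xi> j t) * gweight r t \<partial>lborel) \<in> borel_measurable (envP ?M')" for j
        using T.phiW_measurable[of j] by measurable
      have "(\<integral>\<^sup>+j. ?I j * indicator {k<..} j \<partial>akern k) =
          (\<integral>\<^sup>+j. \<integral>\<^sup>+\<xi>. (\<integral>\<^sup>+t. ennreal (phiW p \<xi> j t) * gweight r t \<partial>lborel) * indicator {k<..} j \<partial>envP ?M' \<partial>akern k)"
        by (intro nn_integral_cong nn_integral_multc[symmetric] m1)
      also have "\<dots> = (\<integral>\<^sup>+\<xi>. \<integral>\<^sup>+j. (\<integral>\<^sup>+t. ennreal (phiW p \<xi> j t) * gweight r t \<partial>lborel) * indicator {k<..} j \<partial>akern k \<partial>envP ?M')"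
        by (rule nn_integral_pmf_swap[symmetric]) (intro borel_measurable_times_ennreal m1, simp)
      also have "\<dots> = F"
        unfolding F_def
      proof (intro nn_integral_cong_AE, use T.AE_good_env AE_space in eventually_elim)
        case (elim \<xi>)
        interpret good_env p \<xi> by fact
        have m2[measurable]: "(\<lambda>t. phiW p \<xi> j t) \<in> borel_measurable borel" for j
          using measurable_compose[OF measurable_Pair1'[OF elim(2)] T.phiW_measurable[of j]] by simp
        have "(\<integral>\<^sup>+j. (\<integral>\<^sup>+t. ennreal (phiW p \<xi> j t) * gweight r t \<partial>lborel) * indicator {k<..} j \<partial>akern k) =
          (\<integral>\<^sup>+j. \<integral>\<^sup>+t. ennreal (phiW p \<xi> j t) * gweight r t * indicator {k<..} j \<partial>lborel \<partial>akern k)"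
          by (intro nn_integral_cong nn_integral_multc[symmetric]) measurable
        also have "\<dots> = (\<integral>\<^sup>+t. \<integral>\<^sup>+j. ennreal (phiW p \<xi> j t) * gweight r t * indicator {k<..} j \<partial>akern k \<partial>lborel)"
          by (rule nn_integral_pmf_swap[symmetric]) measurable
        also have "\<dots> = (\<integral>\<^sup>+t. ennreal (Gbar M p k (phiq p \<xi> t)) * gweight r t \<partial>lborel)"
        proof (intro nn_integral_cong)
          fix t
          show "(\<integral>\<^sup>+j. ennreal (phiW p \<xi> j t) * gweight r t * indicator {k<..} j \<partial>akern k) =
              ennreal (Gbar M p k (phiq p \<xi> t)) * gweight r t"
          proof (cases "0 < t")
            case True
            then have "(\<integral>\<^sup>+j. ennreal (phiW p \<xi> j t) * gweight r t * indicator {k<..} j \<partial>akern k) =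
              (\<integral>\<^sup>+j. ennreal (phiW p \<xi> 1 t ^ j) * indicator {k<..} j * gweight r t \<partial>akern k)"
              by (intro nn_integral_cong) (subst phiW_power, simp, simp add: ac_simps)
            also have "\<dots> = ennreal (Gbar M p k (phiW p \<xi> 1 t)) * gweight r t"
              using True by (subst Gbar_eq) (auto simp: phiW_nonneg phiW_le_1 nn_integral_multc)
            finally show ?thesis unfolding phiq .
          qed simp
        qed
        finally show ?case .
      qed
      finally show ?thesis .
    qed
    ultimately show ?thesis by simp
  qed
  have F: "F < \<infinity>" and d_lim: "(\<lambda>n. enn2real (D n)) \<longlonglongrightarrow> enn2real F / Gamma r" and F_pos: "0 < enn2real F / Gamma r"
  proof -
    have inc: "incseq (\<lambda>n. enn2real (D n))"
      using D_mono D_fin unfolding incseq_def by (metis ennreal_le_iff enn2real_nonneg)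
    have bound: "enn2real (D n) \<le> C" for n
      using D_le[of n] C(1) by (simp add: enn2real_leI)
    have pos: "0 < enn2real (D 0)"
      using D_0 D_fin[of 0] by (metis ennreal_0 enn2real_nonneg less_eq_real_def less_irrefl)
    have "(\<lambda>n. ennreal (Gamma r) * ennreal (enn2real (D n))) \<longlonglongrightarrow> F"
      using lim unfolding D_fin .
    note * = scaled_limit_of_bounded_incseq[where a="\<lambda>n. enn2real (D n)",
        OF Gamma_real_pos[OF r] enn2real_nonneg inc bound pos this]
    show "F < \<infinity>" "(\<lambda>n. enn2real (D n)) \<longlonglongrightarrow> enn2real F / Gamma r" "0 < enn2real F / Gamma r"
      using * by blast+
  qed
  have L_eq: "L = inverse \<gamma> * (enn2real F / Gamma r)"
  proof -
    define G where "G \<xi> = (LBINT t:{0<..}. Gbar M p k (phiq p \<xi> t) * t powr (r - 1))" for \<xi>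
    have [measurable]: "Gbar M p k \<in> borel_measurable borel"
      unfolding Gbar_def[abs_def] by measurable
    have G_meas [measurable]: "G \<in> borel_measurable (envP ?M')"
    proof -
      have "(\<lambda>(\<xi>, t). indicator {0<..} t *\<^sub>R (Gbar M p k (phiW p \<xi> 1 t) * t powr (r - 1))) \<in> borel_measurable (envP ?M' \<Otimes>\<^sub>M lborel)"
        using T.phiW_measurable[of 1] unfolding case_prod_unfold by measurable
      then show ?thesis
        unfolding G_def[abs_def] set_lebesgue_integral_def phiq
        by (rule lborel.borel_measurable_lebesgue_integral)
    qed
    have G_eq: "AE \<xi> in envP ?M'. G \<xi> = enn2real (\<integral>\<^sup>+t. ennreal (Gbar M p k (phiq p \<xi> t)) * gweight r t \<partial>lborel)"
      using T.AE_good_env AE_space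
    proof eventually_elim
      case (elim \<xi>)
      interpret good_env p \<xi> by fact
      have [measurable]: "(\<lambda>t. phiW p \<xi> 1 t) \<in> borel_measurable borel"
        using measurable_compose[OF measurable_Pair1'[OF elim(2)] T.phiW_measurable[of 1]] by simp
      show ?case
        unfolding G_def phiq
      proof (rule integral_gweight_eq)
        show "(\<lambda>t. Gbar M p k (phiW p \<xi> 1 t)) \<in> borel_measurable borel" by measurable
        show "AE t in lborel. 0 < t \<longrightarrow> 0 \<le> Gbar M p k (phiW p \<xi> 1 t)"
          by (intro AE_I2 impI Gbar_eq(2) phiW_nonneg phiW_le_1) simp
      qed
    qed
    have inner_meas: "(\<lambda>\<xi>. \<integral>\<^sup>+t. ennreal (Gbar M p k (phiq p \<xi> t)) * gweight r t \<partial>lborel) \<in> borel_measurable (envP ?M')"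
      using T.phiW_measurable[of 1] unfolding phiq by measurable
    have "AE \<xi> in envP ?M'. (\<integral>\<^sup>+t. ennreal (Gbar M p k (phiq p \<xi> t)) * gweight r t \<partial>lborel) \<noteq> \<infinity>"
      using F by (intro nn_integral_PInf_AE inner_meas) (simp add: F_def)
    then have "AE \<xi> in envP ?M'. ennreal (G \<xi>) = (\<integral>\<^sup>+t. ennreal (Gbar M p k (phiq p \<xi> t)) * gweight r t \<partial>lborel)"
      using G_eq by eventually_elim (simp add: less_top[symmetric])
    then have "(\<integral>\<^sup>+\<xi>. ennreal (G \<xi>) \<partial>envP ?M') = F"
      unfolding F_def by (rule nn_integral_cong_AE)
    moreover have "(\<integral>\<xi>. G \<xi> \<partial>envP ?M') = enn2real (\<integral>\<^sup>+\<xi>. ennreal (G \<xi>) \<partial>envP ?M')"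
      by (rule integral_eq_nn_integral[OF G_meas]) (use G_eq in eventually_elim, simp)
    moreover have "annE ?M' p (\<lambda>\<xi> \<omega>. G \<xi>) = (\<integral>\<xi>. G \<xi> \<partial>envP ?M')"
      unfolding annE_def by (simp add: prob_space.prob_space[OF prob_space_qlaw, simplified])
    ultimately show ?thesis unfolding L_def G_def[symmetric] \<gamma>_def by simp
  qed
  define x where "x n = hmoment r n k / \<gamma> ^ n" for n
  have step: "x (Suc n) - x n = inverse \<gamma> * enn2real (D n)" for n
  proof -
    have up: "(\<integral>\<^sup>+j. (\<integral>\<^sup>+i. ennreal (real i powr (- r)) \<partial>alaw n j) * indicator {k<..} j \<partial>akern k) = ennreal (\<gamma> ^ n) * D n"
    proof -
      have "ennreal (\<gamma> ^ n) * norm_moment r n j = (\<integral>\<^sup>+i. ennreal (real i powr (- r)) \<partial>alaw n j)" for j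
        unfolding norm_moment_def \<gamma>(3) using \<gamma>(1) by (simp add: mult.assoc[symmetric] flip: ennreal_mult)
      then show ?thesis
        unfolding D_def by (simp add: nn_integral_cmult[symmetric] mult.assoc[symmetric])
    qed
    have "ennreal (hmoment r (Suc n) k) = ennreal \<gamma> * ennreal (hmoment r n k) + ennreal (\<gamma> ^ n) * ennreal (enn2real (D n))"
      unfolding hmoment_eq_alaw[OF r] nn_integral_alaw_Suc_split up D_fin \<gamma>_def ..
    also have "\<dots> = ennreal (\<gamma> * hmoment r n k + \<gamma> ^ n * enn2real (D n))"
      using \<gamma>(1) hmoment_nonneg by (simp flip: ennreal_plus ennreal_mult)
    finally have "hmoment r (Suc n) k = \<gamma> * hmoment r n k + \<gamma> ^ n * enn2real (D n)"
      using \<gamma>(1) hmoment_nonneg by (subst (asm) ennreal_inj) auto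
    then show ?thesis unfolding x_def using \<gamma>(1) by (simp add: field_simps)
  qed
  have "(\<lambda>n. x (Suc n) - x n) \<longlonglongrightarrow> L"
    unfolding step L_eq by (intro tendsto_mult tendsto_const d_lim)
  then have "(\<lambda>n. x n / real n) \<longlonglongrightarrow> L" by (rule tendsto_div_of_diff_tendsto)
  then show "(\<lambda>n. hmoment r n k / (real n * gam M p k ^ n)) \<longlonglongrightarrow> L"
    unfolding x_def \<gamma>_def by (simp add: mult.commute)
  show "0 < L" unfolding L_eq using F_pos \<gamma>(1) by (intro mult_pos_pos) auto
qed

lemma hmoment_limit_supercritical_exponent:
  assumes k: "1 \<le> k" and r: "0 < r" and s: "0 < s" "s \<le> r" and \<gamma>: "cr M p s < gam M p k"
    and less: "gam M p (Suc k) < cr M p s"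
  defines "L \<equiv> (1 / Gamma r) * (LBINT t:{0<..}. Qk M p k (exp (- t)) * t powr (r - 1))"
  shows "0 < L" "(\<lambda>n. hmoment r n k / gam M p k ^ n) \<longlonglongrightarrow> L"
proof -
  define \<gamma> where "\<gamma> = gam M p k"
  have \<gamma>0: "0 < \<gamma>" using \<gamma> cr_nonneg[of s] unfolding \<gamma>_def by linarith
  let ?a = "\<lambda>n. hmoment r n k / \<gamma> ^ n"
  have a0: "0 \<le> ?a n" for n using hmoment_nonneg \<gamma>0 by simp
  have growth: "ennreal (\<gamma>) * (\<integral>\<^sup>+i. h i \<partial>alaw n k) \<le> (\<integral>\<^sup>+i. h i \<partial>alaw (Suc n) k)" for h :: "nat \<Rightarrow> ennreal" and n
    unfolding nn_integral_alaw_Suc_split \<gamma>_def by simp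
  obtain C where C: "0 \<le> C" "\<And>j n. Suc k \<le> j \<Longrightarrow> (\<integral>\<^sup>+i. ennreal (real i powr (- s)) \<partial>alaw n j) \<le> ennreal (C * cr M p s ^ n)"
    using harmonic_moment_sharp_bound[OF _ s(1) less] by auto
  have a_inc: "incseq ?a"
  proof (rule incseq_SucI)
    fix n
    have "ennreal (\<gamma> * hmoment r n k) \<le> ennreal (hmoment r (Suc n) k)"
      using growth[of n "\<lambda>j. ennreal (real j powr (- r))"] \<gamma>0 hmoment_nonneg
      unfolding hmoment_eq_alaw[OF r, symmetric] by (simp add: ennreal_mult)
    then have "\<gamma> * hmoment r n k \<le> hmoment r (Suc n) k" using hmoment_nonneg by simp
    then show "?a n \<le> ?a (Suc n)" using \<gamma>0 by (simp add: field_simps)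
  qed
  have step: "hmoment r (Suc n) k \<le> (\<gamma> + 0) * hmoment r n k + C * cr M p s ^ n" for n
  proof -
    have "(\<integral>\<^sup>+j. (\<integral>\<^sup>+i. ennreal (real i powr (- r)) \<partial>alaw n j) * indicator {k<..} j \<partial>akern k) \<le>
        (\<integral>\<^sup>+j. ennreal (C * cr M p s ^ n) \<partial>akern k)"
    proof (intro nn_integral_mono)
      fix j
      have "(\<integral>\<^sup>+i. ennreal (real i powr (- r)) \<partial>alaw n j) \<le> (\<integral>\<^sup>+i. ennreal (real i powr (- s)) \<partial>alaw n j)"
      proof (intro nn_integral_mono ennreal_leI)
        show "real i powr (- r) \<le> real i powr (- s)" for i
          using s by (cases "i = 0") (auto intro: powr_mono)
      qed
      with C(2)[of j n] show "(\<integral>\<^sup>+i. ennreal (real i powr (- r)) \<partial>alaw n j) * indicator {k<..} j \<le> ennreal (C * cr M p s ^ n)"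
        by (cases "k < j") auto
    qed
    also have "\<dots> = ennreal (C * cr M p s ^ n)" by (simp add: measure_pmf.emeasure_space_1[simplified])
    finally have "ennreal (hmoment r (Suc n) k) \<le> ennreal \<gamma> * ennreal (hmoment r n k) + ennreal (C * cr M p s ^ n)"
      unfolding hmoment_eq_alaw[OF r] nn_integral_alaw_Suc_split \<gamma>_def by (rule add_left_mono)
    also have "\<dots> = ennreal ((\<gamma> + 0) * hmoment r n k + C * cr M p s ^ n)"
      using \<gamma>0 hmoment_nonneg C(1) cr_nonneg[of s] by (simp flip: ennreal_plus ennreal_mult)
    finally show ?thesis
      using \<gamma>0 hmoment_nonneg C(1) cr_nonneg[of s] by (subst (asm) ennreal_le_iff) auto
  qed
  obtain B where B: "?a n \<le> B" for n
  proof
    fix n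
    have "hmoment r n k \<le> exp (suminf (\<lambda>_. 0) / \<gamma>) * (hmoment r 0 k + C / (\<gamma> - cr M p s)) * \<gamma> ^ n"
      by (rule discrete_gronwall[where e="\<lambda>_. 0" and u="\<lambda>n. hmoment r n k", OF \<gamma>0 cr_nonneg _ C(1) _ _ _ _ step])
        (use \<gamma> hmoment_nonneg in \<open>auto simp: \<gamma>_def\<close>)
    then show "?a n \<le> hmoment r 0 k + C / (\<gamma> - cr M p s)"
      using \<gamma>0 by (simp add: field_simps)
  qed
  let ?g = "\<lambda>n t. Gf M p k n (exp (- t)) / \<gamma> ^ n"
  have [measurable]: "Gf M p k n \<in> borel_measurable borel" for n by (rule Gf_measurable)
  have laplace: "(\<integral>\<^sup>+t. ennreal (?g n t) * gweight r t \<partial>lborel) = ennreal (Gamma r) * ennreal (?a n)" for n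
  proof -
    have "(\<integral>\<^sup>+t. ennreal (?g n t) * gweight r t \<partial>lborel) =
        (\<integral>\<^sup>+t. ennreal (1 / \<gamma> ^ n) * (\<integral>\<^sup>+j. ennreal (exp (- t * real j)) * gweight r t \<partial>alaw n k) \<partial>lborel)"
    proof (intro nn_integral_cong)
      fix t
      show "ennreal (?g n t) * gweight r t = ennreal (1 / \<gamma> ^ n) * (\<integral>\<^sup>+j. ennreal (exp (- t * real j)) * gweight r t \<partial>alaw n k)"
      proof (cases "0 < t")
        case True
        have "ennreal (?g n t) = ennreal (1 / \<gamma> ^ n) * ennreal (Gf M p k n (exp (- t)))"
          using \<gamma>0 Gf_nonneg[of "exp (- t)" k n] by (simp flip: ennreal_mult)
        also have "ennreal (Gf M p k n (exp (- t))) = (\<integral>\<^sup>+j. ennreal (exp (- t * real j)) \<partial>alaw n k)"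
          using True by (subst Gf_eq_alaw) (auto simp: exp_of_nat_mult[symmetric] mult.commute)
        finally show ?thesis by (simp add: nn_integral_multc mult.assoc)
      qed simp
    qed
    also have "\<dots> = ennreal (1 / \<gamma> ^ n) * (\<integral>\<^sup>+t. \<integral>\<^sup>+j. ennreal (exp (- t * real j)) * gweight r t \<partial>alaw n k \<partial>lborel)"
    proof (rule nn_integral_cmult)
      show "(\<lambda>t. \<integral>\<^sup>+j. ennreal (exp (- t * real j)) * gweight r t \<partial>alaw n k) \<in> borel_measurable lborel"
        unfolding nn_integral_measure_pmf nn_integral_count_space_nat by measurable
    qed
    also have "\<dots> = ennreal (1 / \<gamma> ^ n) * (\<integral>\<^sup>+j. \<integral>\<^sup>+t. ennreal (exp (- t * real j)) * gweight r t \<partial>lborel \<partial>alaw n k)"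
      by (subst nn_integral_pmf_swap) auto
    also have "(\<integral>\<^sup>+j. \<integral>\<^sup>+t. ennreal (exp (- t * real j)) * gweight r t \<partial>lborel \<partial>alaw n k) =
        (\<integral>\<^sup>+j. ennreal (Gamma r) * ennreal (real j powr (- r)) \<partial>alaw n k)"
    proof (intro nn_integral_cong_AE AE_pmfI nn_integral_exp_gweight r)
      fix j assume "j \<in> set_pmf (alaw n k)"
      then show "0 < real j" using set_alaw_ge k by fastforce
    qed
    also have "\<dots> = ennreal (Gamma r) * ennreal (hmoment r n k)"
      by (simp add: nn_integral_cmult hmoment_eq_alaw[OF r])
    finally show ?thesis
      using \<gamma>0 hmoment_nonneg Gamma_real_pos[OF r] by (simp add: mult.commute flip: ennreal_mult)
  qed
  have g_mono: "?g n t \<le> ?g (Suc n) t" if "0 < t" for n t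
  proof -
    have "ennreal (\<gamma> * Gf M p k n (exp (- t))) \<le> ennreal (Gf M p k (Suc n) (exp (- t)))"
      using growth[of n "\<lambda>j. ennreal (exp (- t) ^ j)"] \<gamma>0 Gf_nonneg[of "exp (- t)" k n] that
      by (simp add: ennreal_mult Gf_eq_alaw del: alaw.simps)
    then have "\<gamma> * Gf M p k n (exp (- t)) \<le> Gf M p k (Suc n) (exp (- t))"
      using Gf_nonneg[of "exp (- t)"] by simp
    then show ?thesis using \<gamma>0 by (simp add: field_simps)
  qed
  define F where "F = (\<integral>\<^sup>+t. (SUP n. ennreal (?g n t) * gweight r t) \<partial>lborel)"
  have mono: "incseq (\<lambda>n. ennreal (?g n t) * gweight r t)" for t
    using g_mono[of t] by (intro incseq_SucI) (auto simp: indicator_def intro!: mult_right_mono ennreal_leI)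
  have lim0: "(\<lambda>n. ennreal (Gamma r) * ennreal (?a n)) \<longlonglongrightarrow> F"
    unfolding laplace[symmetric] F_def
  proof (rule nn_integral_monotone_limit(2))
    show "AE t in lborel. \<forall>n. ennreal (?g n t) * gweight r t \<le> ennreal (?g (Suc n) t) * gweight r t"
      using mono by (intro AE_I2 allI incseq_SucD)
    show "AE t in lborel. (\<lambda>n. ennreal (?g n t) * gweight r t) \<longlonglongrightarrow> (SUP n. ennreal (?g n t) * gweight r t)"
      using mono by (intro AE_I2 LIMSEQ_SUP)
  qed measurable
  have F: "F < \<infinity>" and lim: "?a \<longlonglongrightarrow> enn2real F / Gamma r" and pos: "0 < enn2real F / Gamma r"
    using scaled_limit_of_bounded_incseq[where a="?a", OF Gamma_real_pos[OF r] a0 a_inc B _ lim0] hmoment_0[OF r, of k] k by simp_all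
  have Qk_meas: "(\<lambda>t. Qk M p k (exp (- t))) \<in> borel_measurable borel"
    unfolding Qk_def[abs_def] by measurable
  have Q: "AE t in lborel. 0 < t \<longrightarrow> 0 \<le> Qk M p k (exp (- t)) \<and>
      (SUP n. ennreal (?g n t) * gweight r t) = ennreal (Qk M p k (exp (- t))) * gweight r t"
  proof -
    have "AE t in lborel. (SUP n. ennreal (?g n t) * gweight r t) \<noteq> \<infinity>"
      using F unfolding F_def by (intro nn_integral_PInf_AE) auto
    then show ?thesis
    proof eventually_elim
      case (elim t)
      show ?case
      proof
        assume t: "0 < t"
        let ?w = "t powr (r - 1)"
        have g0: "0 \<le> ?g n t" for n using Gf_nonneg[of "exp (- t)" k n] \<gamma>0 by simp
        obtain S where S: "(SUP n. ennreal (?g n t) * gweight r t) = ennreal S" "0 \<le> S"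
          using elim by (cases "SUP n. ennreal (?g n t) * gweight r t") auto
        have "(\<lambda>n. ennreal (?g n t) * gweight r t) \<longlonglongrightarrow> ennreal S"
          unfolding S(1)[symmetric] by (rule LIMSEQ_SUP[OF mono])
        then have "(\<lambda>n. ennreal (?g n t * ?w)) \<longlonglongrightarrow> ennreal S"
          using t g0 by (simp add: ennreal_mult del: times_divide_eq_left)
        then have "(\<lambda>n. ?g n t * ?w) \<longlonglongrightarrow> S"
          using g0 S(2) by (subst (asm) tendsto_ennreal_iff) (auto simp del: times_divide_eq_left intro!: always_eventually mult_nonneg_nonneg)
        then have "(\<lambda>n. ?g n t * ?w / ?w) \<longlonglongrightarrow> S / ?w"
          using t by (intro tendsto_divide) auto
        then have conv: "(\<lambda>n. ?g n t) \<longlonglongrightarrow> S / ?w" using t by simp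
        then have "Qk M p k (exp (- t)) = S / ?w"
          unfolding Qk_def \<gamma>_def[symmetric] by (rule limI)
        with S t show "0 \<le> Qk M p k (exp (- t)) \<and>
            (SUP n. ennreal (?g n t) * gweight r t) = ennreal (Qk M p k (exp (- t))) * gweight r t"
          by (simp flip: ennreal_mult)
      qed
    qed
  qed
  have "F = (\<integral>\<^sup>+t. ennreal (Qk M p k (exp (- t))) * gweight r t \<partial>lborel)"
    unfolding F_def
  proof (rule nn_integral_cong_AE, use Q in eventually_elim)
    case (elim t)
    then show ?case by (cases "0 < t") auto
  qed
  then have "L = enn2real F / Gamma r"
    unfolding L_def by (subst integral_gweight_eq[OF Qk_meas]) (use Q in auto)
  with lim pos show "0 < L" "(\<lambda>n. hmoment r n k / gam M p k ^ n) \<longlonglongrightarrow> L"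
    unfolding \<gamma>_def by simp_all
qed

lemma tendsto_cr_right:
  assumes "0 \<le> s"
  shows "(\<lambda>n. cr M p (s + 1 / real (Suc n))) \<longlonglongrightarrow> cr M p s"
  unfolding cr_def
proof (rule integral_dominated_convergence[where w="\<lambda>_. 1"])
  have lim: "(\<lambda>n. 1 / real (Suc n)) \<longlonglongrightarrow> 0" by (rule LIMSEQ_Suc) (rule lim_1_over_n)
  show "AE x in M. (\<lambda>n. mean p x powr (- (s + 1 / real (Suc n)))) \<longlonglongrightarrow> mean p x powr (- s)"
    using AE_mean_ge_1
  proof eventually_elim
    case (elim x)
    have "(\<lambda>n. mean p x powr (- (s + 1 / real (Suc n)))) \<longlonglongrightarrow> mean p x powr (- (s + 0))"
      using elim by (intro tendsto_powr tendsto_intros lim) auto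
    then show ?case by simp
  qed
  show "AE x in M. norm (mean p x powr (- (s + 1 / real (Suc n)))) \<le> 1" for n
    using AE_mean_ge_1
  proof eventually_elim
    case (elim x)
    have "0 \<le> s + 1 / real (Suc n)" using assms by (intro add_nonneg_nonneg) auto
    then have "mean p x powr (- (s + 1 / real (Suc n))) \<le> 1 powr (- (s + 1 / real (Suc n)))"
      using elim by (intro powr_mono2') linarith+
    then show ?case by simp
  qed
qed auto

text \<open>Equality would force \<open>p\<^sub>1 \<in> {0, 1}\<close> almost surely, hence \<open>p\<^sub>1\<^sup>k = m powr (- s)\<close>
  and \<open>m = 1\<close>.\<close>

lemma gam_Suc_less:
  assumes k: "1 \<le> k" and s: "0 < s" and eq: "cr M p s = gam M p k"
  shows "gam M p (Suc k) < cr M p s"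
proof (rule ccontr)
  assume "\<not> ?thesis"
  then have g: "gam M p (Suc k) = gam M p k"
    using gam_antimono[of k "Suc k"] eq by simp
  have int: "integrable M (\<lambda>x. pmf (p x) 1 ^ j)" for j
    by (rule integrable_const_bound[where B=1]) (auto simp: pmf_le_1 power_le_one)
  have "AE x in M. pmf (p x) 1 ^ k - pmf (p x) 1 ^ Suc k = 0"
    using int[of k] int[of "Suc k"] g
    by (subst integral_nonneg_eq_0_iff_AE[symmetric])
      (auto simp: gam_def pmf_le_1 intro!: mult_left_le_one_le simp del: One_nat_def)
  then have p01: "AE x in M. pmf (p x) 1 = 0 \<or> pmf (p x) 1 = 1"
    by eventually_elim auto
  have mean_1: "mean p x = 1" if "pmf (p x) 1 = 1" for x
  proof -
    have "p x = return_pmf 1"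
    proof (rule pmf_eqI)
      fix i
      have "set_pmf (p x) = {1}"
        using that by (metis measure_pmf_single measure_pmf.prob_eq_1 UNIV_I insert_not_empty set_pmf_not_empty AE_measure_pmf_iff singletonI space_measure_pmf sets_measure_pmf subset_singletonD subsetI)
      then show "pmf (p x) i = pmf (return_pmf 1) i"
        by (metis set_pmf_subset_singleton subset_refl)
    qed
    then show ?thesis by (simp add: mean_def)
  qed
  have "AE x in M. mean p x powr (- s) - pmf (p x) 1 ^ k = 0"
  proof (subst integral_nonneg_eq_0_iff_AE[symmetric])
    show "integrable M (\<lambda>x. mean p x powr (- s) - pmf (p x) 1 ^ k)"
      using int[of k] integrable_mean_powr[of s] s by auto
    show "AE x in M. 0 \<le> mean p x powr (- s) - pmf (p x) 1 ^ k"
      using p01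
    proof eventually_elim
      case (elim x)
      then show ?case using k mean_1[of x] by (auto simp: power_0_left)
    qed
    show "(\<integral>x. mean p x powr (- s) - pmf (p x) 1 ^ k \<partial>M) = 0"
      using int[of k] integrable_mean_powr[of s] s eq by (simp add: cr_def gam_def)
  qed
  then have "AE x in M. mean p x = 1"
    using p01 AE_mean_ge_1
  proof eventually_elim
    case (elim x)
    then show ?case using k mean_1[of x] by (auto simp: power_0_left)
  qed
  with nontrivial show False by blast
qed

end

theorem theorem2p1:
  fixes M :: "'e measure" and p :: "'e \<Rightarrow> nat pmf"
    and k :: nat and rk \<epsilon> r :: real
  assumes M: "prob_space M"
    and p_meas: "\<And>i. (\<lambda>x. pmf (p x) i) \<in> borel_measurable M"
    and p0: "AE x in M. pmf (p x) 0 = 0"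
    and mean_finite: "AE x in M. integrable (measure_pmf (p x)) real"
    and X_int: "integrable M (\<lambda>x. ln (mean p x))"
    and X_pos: "(\<integral>x. ln (mean p x) \<partial>M) > 0"
    and LlogL: "(\<integral>\<^sup>+x. (\<integral>\<^sup>+j. ennreal (real j / mean p x * max 0 (ln (real j)))
                   \<partial>measure_pmf (p x)) \<partial>M) < \<infinity>"
    and P1: "(\<integral>x. pmf (p x) 1 \<partial>M) > 0"
    and k: "k \<ge> 1"
    and rk: "rk > 0" "cr M p rk = gam M p k"
    and eps: "\<epsilon> > 0" "integrable M (\<lambda>x. mean p x powr (rk + \<epsilon>))"
    and r: "r > 0"
  shows "0 < Cconst M p rk k r \<and>
         (\<lambda>n. annE M p (\<lambda>\<xi> \<omega>. real (Zpr k \<omega> n) powr (- r)) / Acoef M p rk k n r)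
           \<longlonglongrightarrow> Cconst M p rk k r"
proof -
  interpret B: bpre M p
    by (intro bpre.intro bpre_axioms.intro M p_meas p0 mean_finite)
  have nontrivial: "\<not> (AE x in M. mean p x = 1)"
  proof
    assume "AE x in M. mean p x = 1"
    then have "(\<integral>x. ln (mean p x) \<partial>M) = (\<integral>x. 0 \<partial>M)"
      by (intro integral_cong_AE) auto
    with X_pos show False by simp
  qed
  interpret S: bpre_supercritical M p
    by unfold_locales (fact LlogL, fact nontrivial)
  have less: "gam M p (Suc k) < cr M p rk"
    by (rule S.gam_Suc_less[OF k rk])
  consider "r < rk" | "r = rk" | "r > rk" by linarith
  then show ?thesis
  proof cases
    case 1
    have "gam M p k < cr M p r"
      using S.cr_strict_antimono[of r rk] r 1 rk by simp
    from S.hmoment_limit_subcritical_exponent[OF k r this] 1 show ?thesis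
      by (simp add: Cconst_def Acoef_def B.hmoment_def)
  next
    case 2
    have "gam M p k = cr M p r" "gam M p (Suc k) < cr M p r" using 2 rk less by simp_all
    from S.hmoment_limit_critical_exponent[OF k r this] 2 show ?thesis
      by (simp add: Cconst_def Acoef_def B.hmoment_def)
  next
    case 3
    have "\<forall>\<^sub>F n in sequentially. gam M p (Suc k) < cr M p (rk + 1 / real (Suc n))"
      using order_tendstoD(1)[OF S.tendsto_cr_right less] rk by simp
    moreover have "\<forall>\<^sub>F n in sequentially. 1 / real (Suc n) < r - rk"
      using 3 by (intro order_tendstoD(2)[OF LIMSEQ_Suc[OF lim_1_over_n]]) auto
    ultimately obtain n where n: "gam M p (Suc k) < cr M p (rk + 1 / real (Suc n))" "1 / real (Suc n) < r - rk"
      by (metis (mono_tags, lifting) eventually_conj_iff eventually_happens trivial_limit_sequentially)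
    define s where "s = rk + 1 / real (Suc n)"
    have s: "rk < s" "s \<le> r" "gam M p (Suc k) < cr M p s"
      using n by (auto simp: s_def)
    have "cr M p s < gam M p k"
      using S.cr_strict_antimono[of rk s] s rk by simp
    from S.hmoment_limit_supercritical_exponent[OF k r _ s(2) this s(3)] s rk 3 show ?thesis
      by (simp add: Cconst_def Acoef_def B.hmoment_def)
  qed
qed

end
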